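(* Let $\Sigma\subset\mathbb{R}^n$ be a Jordan surface bounded by the Jordan curve $\Gamma$ (not assumed rectifiable), let $f:\mathbb{U}\to\Sigma$ be a harmonic homeomorphism of the unit disk onto $\Sigma$ (that is, onto $\Sigma\setminus\Gamma$), and for $0<r<1$ let $\Gamma_r$ be the curve $t\mapsto f(re^{it})$, $0\le t\le 2\pi$. Then $\partial_t f\in h^1(\mathbb{U})$ if and only if $\Gamma$ is rectifiable. Moreover, when these equivalent conditions hold, $|\Gamma_r|\to|\Gamma|$ as $r\to1^-$.
   Context: $\mathbb{U}=\{z\in\mathbb{C}:|z|<1\}$ is the unit disk and $\mathbb{T}$ is the unit circle. A Jordan surface $\Sigma\subseteq\mathbb{R}^n$ is a set $\Sigma=\Phi(\overline{\mathbb{U}})$, where $\Phi$ is a homeomorphism of the closed unit disk onto its image; its boundary is the Jordan curve $\Gamma=\Phi(\mathbb{T})$. A homeomorphism of $\mathbb{U}$ onto $\Sigma$ means a homeomorphism onto $\Phi(\mathbb{U})=\Sigma\setminus\Gamma$. A mapping $f=(f^1,\dots,f^n)$ is harmonic if each $f^j$ is harmonic. $|\cdot|$ applied to a curve denotes its length, and applied to a vector the Euclidean norm. With $z=re^{it}$, $\partial_t f$ denotes the angular derivative $\frac{\partial}{\partial t}f(re^{it})$, which is a harmonic mapping in $\mathbb{U}$. A harmonic mapping $u:\mathbb{U}\to\mathbb{R}^n$ belongs to the Hardy class $h^1(\mathbb{U})$ if $\sup_{0<r<1}\int_0^{2\pi}|u(re^{it})|\,dt<\infty$. *)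

theory Defs
  imports "HOL-Analysis.Analysis"
begin

text \<open>\<^term>\<open>u\<close> is of class C2 on the open set \<^term>\<open>S\<close> and its Laplacian vanishes there; the witnesses
  are the first and second partial derivatives in \<open>z = x + iy\<close>.\<close>

definition harmonic_on :: "(complex \<Rightarrow> real) \<Rightarrow> complex set \<Rightarrow> bool" where
  "harmonic_on u S \<longleftrightarrow> open S \<and>
     (\<exists>ux uy uxx uxy uyx uyy.
        (\<forall>z\<in>S. (u has_derivative (\<lambda>h. ux z * Re h + uy z * Im h)) (at z) \<and>
               (ux has_derivative (\<lambda>h. uxx z * Re h + uxy z * Im h)) (at z) \<and>
               (uy has_derivative (\<lambda>h. uyx z * Re h + uyy z * Im h)) (at z) \<and>
               uxx z + uyy z = 0) \<and>
        continuous_on S uxx \<and> continuous_on S uxy \<and>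
        continuous_on S uyx \<and> continuous_on S uyy)"

definition harmonic_map_on :: "(complex \<Rightarrow> real ^ 'n) \<Rightarrow> complex set \<Rightarrow> bool" where
  "harmonic_map_on f S \<longleftrightarrow> (\<forall>j. harmonic_on (\<lambda>z. f z $ j) S)"

text \<open>The derivative of \<open>t \<mapsto> f (r e\<^sup>i\<^sup>t)\<close> at any \<open>t\<close> with \<open>z = r e\<^sup>i\<^sup>t\<close>; the choice of \<open>t\<close> is
  irrelevant by periodicity, and the value at \<open>z = 0\<close> is \<open>0\<close>.\<close>

definition angular_deriv :: "(complex \<Rightarrow> 'a::real_normed_vector) \<Rightarrow> complex \<Rightarrow> 'a" where
  "angular_deriv f z = vector_derivative (\<lambda>t. f (rcis (cmod z) t)) (at (Arg z))"

definition hardy_h1 :: "(complex \<Rightarrow> real ^ 'n) set" where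
  "hardy_h1 = {u. harmonic_map_on u (ball 0 1) \<and>
     (SUP r\<in>{0<..<1::real}. \<integral>\<^sup>+t\<in>{0..2*pi}. ennreal (norm (u (rcis r t))) \<partial>lborel) < \<infinity>}"

text \<open>Supremum of the lengths of the inscribed polygons; it may be infinite.\<close>

definition curve_length :: "real \<Rightarrow> real \<Rightarrow> (real \<Rightarrow> 'a::metric_space) \<Rightarrow> ennreal" where
  "curve_length a b \<gamma> =
     (SUP (n, t) \<in> {(n, t :: nat \<Rightarrow> real). t 0 = a \<and> t n = b \<and> mono_on {..n} t}.
        \<Sum>i<n. ennreal (dist (\<gamma> (t i)) (\<gamma> (t (Suc i)))))"

definition rectifiable :: "real \<Rightarrow> real \<Rightarrow> (real \<Rightarrow> 'a::metric_space) \<Rightarrow> bool" where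
  "rectifiable a b \<gamma> \<longleftrightarrow> curve_length a b \<gamma> < \<infinity>"

definition jordan_surface ::
    "(complex \<Rightarrow> 'a::topological_space) \<Rightarrow> 'a set \<Rightarrow> 'a set \<Rightarrow> bool" where
  "jordan_surface \<Phi> \<Sigma> \<Gamma> \<longleftrightarrow>
     (\<exists>\<Psi>. homeomorphism (cball 0 1) \<Sigma> \<Phi> \<Psi>) \<and> \<Gamma> = \<Phi> ` sphere 0 1"

text \<open>The boundary Jordan curve, as a closed curve on \<open>[0, 2\<pi>]\<close>; its length does not depend
  on the homeomorphism \<^term>\<open>\<Phi>\<close> parametrizing the surface.\<close>

definition boundary_curve :: "(complex \<Rightarrow> 'a) \<Rightarrow> real \<Rightarrow> 'a" where
  "boundary_curve \<Phi> t = \<Phi> (cis t)"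

definition circle_image :: "(complex \<Rightarrow> 'a) \<Rightarrow> real \<Rightarrow> real \<Rightarrow> 'a" where
  "circle_image f r t = f (rcis r t)"

end

theory Submission
  imports Defs "HOL-Complex_Analysis.Complex_Analysis"
begin

text \<open>
  Let \<open>F\<close> be \<open>f\<close> followed by the inverse of \<open>\<Phi>\<close>, a homeomorphism of the open disk onto itself with
  \<open>f = \<Phi> \<circ> F\<close>. A homeomorphism of the open disk need not extend to the circle; the point of the proof
  is that harmonicity of \<open>f\<close> makes \<open>F\<close> extend, off a countable set, to a monotone map of the circle.

  In logarithmic coordinates \<open>F\<close> and its inverse become maps \<open>h\<close> and \<open>k\<close> of half-strips
  (\<open>ball_homeomorphism_lift\<close>). For real \<open>x\<close> the curve \<open>\<rho> \<mapsto> k (\<rho> + \<i> x)\<close>, as \<open>\<rho> \<rightarrow> 0\<close> from below, is the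
  preimage of the radius at angle \<open>x\<close>, and \<open>f\<close> tends to \<open>\<Phi> (cis x)\<close> along it. By the intermediate value
  theorem alone, the upper and lower limits of the angle along this curve are monotone in \<open>x\<close>
  (\<open>upper_antimono\<close>, \<open>lower_mono\<close>). If the angle keeps crossing an interval, then \<open>f - \<Phi> (cis x)\<close> is small
  on crosscuts that converge to an arc of the circle, and a maximum principle argument
  (\<open>crossing_estimate\<close>) shows that \<open>f\<close> has the radial limit \<open>\<Phi> (cis x)\<close> at the midpoint of the arc. As \<open>\<Phi>\<close> is
  injective, this cannot happen for two angles \<open>x\<close> and the same arc (\<open>crosses_both_imp_eq\<close>). Hence the
  limiting angles are bounded and the intervals between lower and upper limits do not overlap, which
  yields, after conjugating \<open>\<Phi>\<close> if \<open>F\<close> reverses the orientation,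
  a nondecreasing function \<open>bdry\<close> such that \<open>f\<close> has the limit \<open>\<Phi> (cis (bdry t))\<close> at \<open>cis t\<close> for all
  but countably many \<open>t\<close> (\<open>countable_not_regular\<close>, \<open>regular_boundary_limit\<close>).

  Consequently the image circles are no longer than the boundary curve (\<open>circle_image_length_le\<close>): the
  length of a polygon inscribed in the image of the circle of radius \<open>r\<close> is the value at \<open>r\<close> of the
  bounded harmonic function \<open>\<Sum>\<^sub>i c\<^sub>i \<bullet> (f (z cis t\<^sub>i\<^sub>+\<^sub>1) - f (z cis t\<^sub>i))\<close> for suitable
  vectors \<open>c\<^sub>i\<close> of norm at most \<open>1\<close>. Its boundary values, off a countable set, are bounded by the lengths of polygons whose vertices lie on the
  boundary curve in cyclic order, and a countable set may be ignored in the maximum principle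
  (\<open>Re_holomorphic_le_of_boundary_limits\<close>).

  Conversely, length is lower semicontinuous here (\<open>eventually_less_circle_image_length\<close>): the image of a
  large circle winds once around the centre of the disk, in the coordinates given by \<open>\<Phi>\<close>,
  and passes, in the right order, close to the vertices of any given polygon on the boundary curve. So the length of the boundary curve is both the supremum and the
  limit of the lengths of the image circles. These are smooth curves, whose lengths are the integrals of
  the norm of the angular derivative, and the angular derivative is harmonic
  (\<open>angular_deriv_harmonic\<close>); this is the theorem.
\<close>

section \<open>Length of curves\<close>

lemma polygon_le_curve_length:
  assumes "mono_on {..n} t"
  shows "(\<Sum>i<n. ennreal (dist (\<gamma> (t i)) (\<gamma> (t (Suc i))))) \<le> curve_length (t 0) (t n) \<gamma>"
  unfolding curve_length_def by (rule SUP_upper2[of "(n, t)"]) (use assms in auto)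

lemma curve_length_le:
  assumes "\<And>n t. t 0 = a \<Longrightarrow> t n = b \<Longrightarrow> mono_on {..n} t \<Longrightarrow>
             (\<Sum>i<n. ennreal (dist (\<gamma> (t i)) (\<gamma> (t (Suc i))))) \<le> B"
  shows "curve_length a b \<gamma> \<le> B"
  unfolding curve_length_def by (rule SUP_least) (use assms in auto)

text \<open>A polygon is split at \<open>b\<close> by clamping its parameters from above and from below. Only the edge across \<open>b\<close>
changes its length, and it does so in the sense of the triangle inequality.\<close>

lemma curve_length_split_le:
  assumes "a \<le> b" "b \<le> c"
  shows "curve_length a c \<gamma> \<le> curve_length a b \<gamma> + curve_length b c \<gamma>"
proof (rule curve_length_le)
  fix n and t :: "nat \<Rightarrow> real" assume t: "t 0 = a" "t n = c" "mono_on {..n} t"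
  have mono: "t i \<le> t (Suc i)" if "i < n" for i
    using monotone_onD[OF t(3), of i "Suc i"] that by auto
  define lo hi where "lo i = min (t i) b" and "hi i = max (t i) b" for i
  have "(\<Sum>i<n. ennreal (dist (\<gamma> (t i)) (\<gamma> (t (Suc i))))) \<le>
        (\<Sum>i<n. ennreal (dist (\<gamma> (lo i)) (\<gamma> (lo (Suc i)))) + ennreal (dist (\<gamma> (hi i)) (\<gamma> (hi (Suc i)))))"
  proof (rule sum_mono)
    fix i assume i: "i \<in> {..<n}"
    have "dist (\<gamma> (t i)) (\<gamma> (t (Suc i))) \<le> dist (\<gamma> (lo i)) (\<gamma> (lo (Suc i))) + dist (\<gamma> (hi i)) (\<gamma> (hi (Suc i)))"
      using mono[of i] i dist_triangle[of "\<gamma> (t i)" "\<gamma> (t (Suc i))" "\<gamma> b"]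
      by (auto simp: lo_def hi_def min_def max_def)
    then show "ennreal (dist (\<gamma> (t i)) (\<gamma> (t (Suc i)))) \<le>
      ennreal (dist (\<gamma> (lo i)) (\<gamma> (lo (Suc i)))) + ennreal (dist (\<gamma> (hi i)) (\<gamma> (hi (Suc i))))"
      by (simp flip: ennreal_plus)
  qed
  also have "\<dots> \<le> curve_length (lo 0) (lo n) \<gamma> + curve_length (hi 0) (hi n) \<gamma>"
    unfolding sum.distrib using t(3)
    by (intro add_mono polygon_le_curve_length) (auto simp: monotone_on_def lo_def hi_def min_def max_def intro: order_trans)
  also have "\<dots> = curve_length a b \<gamma> + curve_length b c \<gamma>" using assms t by (simp add: lo_def hi_def)
  finally show "(\<Sum>i<n. ennreal (dist (\<gamma> (t i)) (\<gamma> (t (Suc i))))) \<le> curve_length a b \<gamma> + curve_length b c \<gamma>" .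
qed

lemma SUP_add_SUP_le_ennreal:
  fixes f :: "'a \<Rightarrow> ennreal" and g :: "'b \<Rightarrow> ennreal"
  assumes "A \<noteq> {}" "B \<noteq> {}" "\<And>x y. x \<in> A \<Longrightarrow> y \<in> B \<Longrightarrow> f x + g y \<le> C"
  shows "(SUP x\<in>A. f x) + (SUP y\<in>B. g y) \<le> C"
proof -
  have "(SUP x\<in>A. f x) + g y \<le> C" if "y \<in> B" for y
    using assms(1,3) that by (auto simp: ennreal_SUP_add_left[symmetric] intro!: SUP_least)
  then have "(SUP y\<in>B. g y + (SUP x\<in>A. f x)) \<le> C" by (auto intro!: SUP_least simp: add.commute)
  then show ?thesis using assms(2) by (simp add: ennreal_SUP_add_left add.commute)
qed

lemma curve_length_concat_le:
  assumes "a \<le> b" "b \<le> c"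
  shows "curve_length a b \<gamma> + curve_length b c \<gamma> \<le> curve_length a c \<gamma>"
proof -
  let ?P = "\<lambda>a b. {(n, t :: nat \<Rightarrow> real). t 0 = a \<and> t n = b \<and> mono_on {..n} t}"
  have ne: "?P a b \<noteq> {}" if "a \<le> b" for a b
    using that by (auto intro!: exI[of _ "Suc 0"] exI[of _ "\<lambda>i. if i = 0 then a else b"] simp: monotone_on_def)
  show ?thesis unfolding curve_length_def[of a b] curve_length_def[of b c]
  proof (rule SUP_add_SUP_le_ennreal[OF ne[OF assms(1)] ne[OF assms(2)]])
    fix x y assume "x \<in> ?P a b" "y \<in> ?P b c"
    then obtain n m and t s :: "nat \<Rightarrow> real" where xy: "x = (n, t)" "y = (m, s)"
      and *: "a = t 0" "s 0 = t n" "b = t n" "c = s m" "mono_on {..n} t" "mono_on {..m} s"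
      by auto
    define u where "u i = (if i \<le> n then t i else s (i - n))" for i
    have u: "mono_on {..n + m} u"
    proof (rule monotone_onI)
      fix i j assume ij: "i \<in> {..n + m}" "j \<in> {..n + m}" "i \<le> j"
      have "t i \<le> t n" if "i \<le> n" using monotone_onD[OF *(5), of i n] that by auto
      moreover have "s 0 \<le> s (j - n)" using monotone_onD[OF *(6), of 0 "j - n"] ij by auto
      moreover have "s (i - n) \<le> s (j - n)" using monotone_onD[OF *(6), of "i - n" "j - n"] ij by auto
      moreover have "t i \<le> t j" if "j \<le> n" using monotone_onD[OF *(5), of i j] that ij by auto
      ultimately show "u i \<le> u j" using *(2) ij by (auto simp: u_def)
    qed
    have un: "u (n + i) = s i" for i using *(2) by (cases i) (auto simp: u_def)
    have "(\<Sum>i<n. ennreal (dist (\<gamma> (t i)) (\<gamma> (t (Suc i))))) + (\<Sum>i<m. ennreal (dist (\<gamma> (s i)) (\<gamma> (s (Suc i)))))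
      = (\<Sum>i<n. ennreal (dist (\<gamma> (u i)) (\<gamma> (u (Suc i))))) +
        (\<Sum>i<m. ennreal (dist (\<gamma> (u (n + i))) (\<gamma> (u (n + Suc i)))))"
      unfolding un by (simp add: u_def)
    also have "\<dots> = (\<Sum>i<n + m. ennreal (dist (\<gamma> (u i)) (\<gamma> (u (Suc i)))))"
      by (induction m) (simp_all add: add.assoc[symmetric])
    also have "\<dots> \<le> curve_length (u 0) (u (n + m)) \<gamma>" by (rule polygon_le_curve_length[OF u])
    finally show "(case x of (n, t) \<Rightarrow> \<Sum>i<n. ennreal (dist (\<gamma> (t i)) (\<gamma> (t (Suc i))))) +
        (case y of (n, t) \<Rightarrow> \<Sum>i<n. ennreal (dist (\<gamma> (t i)) (\<gamma> (t (Suc i))))) \<le> curve_length a c \<gamma>"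
      unfolding un xy using * by (simp add: u_def)
  qed
qed

lemma curve_length_translate_le:
  "curve_length (a + p) (b + p) \<gamma> \<le> curve_length a b (\<lambda>t. \<gamma> (t + p))"
proof (rule curve_length_le)
  fix n t assume t: "t 0 = a + p" "t n = b + p" "mono_on {..n} (t :: nat \<Rightarrow> real)"
  have "mono_on {..n} (\<lambda>i. t i - p)" using t(3) by (simp add: monotone_on_def)
  from polygon_le_curve_length[OF this, of "\<lambda>t. \<gamma> (t + p)"] t
  show "(\<Sum>i<n. ennreal (dist (\<gamma> (t i)) (\<gamma> (t (Suc i))))) \<le> curve_length a b (\<lambda>t. \<gamma> (t + p))" by simp
qed

text \<open>The length of a closed curve does not depend on its starting point. A whole number of periods brings \<open>s\<close> into
the first period, and the part of the curve beyond \<open>p\<close> is translated back by one more.\<close>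

lemma curve_length_periodic_shift_le:
  assumes per: "\<And>t. \<gamma> (t + p) = \<gamma> t" and "p > 0"
  shows "curve_length s (s + p) \<gamma> \<le> curve_length 0 p \<gamma>"
proof -
  have "\<gamma> (t + real n * p) = \<gamma> t" for t n
    by (induction n) (simp_all add: distrib_right add.assoc[symmetric] add.commute[of p] per)
  then have per_int: "\<gamma> (t + of_int k * p) = \<gamma> t" for t k
    by (cases k rule: int_cases2) (auto, metis add.commute add_diff_cancel_left' diff_add_cancel)
  define k where "k = \<lfloor>s / p\<rfloor>"
  define r where "r = s - of_int k * p"
  have r: "0 \<le> r" "r \<le> p" using \<open>p > 0\<close> unfolding r_def k_def
    using floor_divide_lower[of p s] floor_divide_upper[of p s] by (simp_all add: distrib_right)
  have "curve_length s (s + p) \<gamma> \<le> curve_length r (r + p) \<gamma>"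
    using curve_length_translate_le[of r "of_int k * p" "r + p" \<gamma>] by (simp add: r_def per_int)
  also have "\<dots> \<le> curve_length r p \<gamma> + curve_length p (r + p) \<gamma>" by (rule curve_length_split_le) (use r in auto)
  also have "curve_length p (r + p) \<gamma> \<le> curve_length 0 r \<gamma>"
    using curve_length_translate_le[of 0 p r \<gamma>] by (simp add: per)
  also have "curve_length r p \<gamma> + curve_length 0 r \<gamma> \<le> curve_length 0 p \<gamma>"
    using curve_length_concat_le[OF r] by (simp add: add.commute)
  finally show ?thesis by (simp add: add_left_mono)
qed

lemma curve_length_reverse_le:
  "curve_length a b (\<lambda>t. \<gamma> (a + b - t)) \<le> curve_length a b \<gamma>"
proof (rule curve_length_le)
  fix n t assume t: "t 0 = a" "t n = b" "mono_on {..n} (t :: nat \<Rightarrow> real)"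
  have "mono_on {..n} (\<lambda>i. a + b - t (n - i))" using t(3) by (auto simp: monotone_on_def)
  from polygon_le_curve_length[OF this, of \<gamma>] t
  have "(\<Sum>i<n. ennreal (dist (\<gamma> (a + b - t (n - i))) (\<gamma> (a + b - t (n - Suc i))))) \<le> curve_length a b \<gamma>" by simp
  also have "(\<Sum>i<n. ennreal (dist (\<gamma> (a + b - t (n - i))) (\<gamma> (a + b - t (n - Suc i))))) =
      (\<Sum>i<n. ennreal (dist (\<gamma> (a + b - t (Suc (n - Suc i)))) (\<gamma> (a + b - t (n - Suc i)))))"
    by (intro sum.cong refl) (simp add: Suc_diff_Suc)
  also have "\<dots> = (\<Sum>i<n. ennreal (dist (\<gamma> (a + b - t (Suc i))) (\<gamma> (a + b - t i))))"
    by (rule sum.nat_diff_reindex)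
  finally show "(\<Sum>i<n. ennreal (dist (\<gamma> (a + b - t i)) (\<gamma> (a + b - t (Suc i))))) \<le> curve_length a b \<gamma>"
    by (simp add: dist_commute)
qed

text \<open>Both curve and integral are compared with the primitive \<open>J\<close> of the speed. Uniform continuity of the
derivative makes each edge of a fine equidistant polygon almost as long as the increment of \<open>J\<close>.\<close>

lemma curve_length_C1_eq_integral:
  fixes \<gamma> :: "real \<Rightarrow> 'a::euclidean_space"
  assumes "a \<le> b" and der: "\<And>t. (\<gamma> has_vector_derivative \<gamma>' t) (at t)" and cont: "continuous_on UNIV \<gamma>'"
  shows "curve_length a b \<gamma> = (\<integral>\<^sup>+t\<in>{a..b}. ennreal (norm (\<gamma>' t)) \<partial>lborel)"
proof -
  define J where "J x = integral {a..x} (\<lambda>t. norm (\<gamma>' t))" for x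
  have int: "(\<lambda>t. norm (\<gamma>' t)) integrable_on {u..v}" for u v
    by (intro integrable_continuous_real continuous_intros continuous_on_subset[OF cont]) auto
  have J_diff: "J v - J u = integral {u..v} (\<lambda>t. norm (\<gamma>' t))" if "a \<le> u" "u \<le> v" for u v
    using Henstock_Kurzweil_Integration.integral_combine[OF that int] by (simp add: J_def)
  have J_mono: "J u \<le> J v" if "a \<le> u" "u \<le> v" for u v
    using J_diff[OF that] Henstock_Kurzweil_Integration.integral_nonneg[OF int, of u v] by simp
  have Ja: "J a = 0" by (simp add: J_def)
  have "(\<integral>\<^sup>+t\<in>{a..b}. ennreal (norm (\<gamma>' t)) \<partial>lborel) = ennreal (J b)"
    by (rule nn_integral_has_integral_lebesgue') (use int in \<open>auto simp: J_def\<close>)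
  moreover have "curve_length a b \<gamma> \<le> ennreal (J b)"
  proof (rule curve_length_le)
    fix n and t :: "nat \<Rightarrow> real" assume t: "t 0 = a" "t n = b" "mono_on {..n} t"
    have t_mono: "a \<le> t i" "t i \<le> t (Suc i)" if "i < n" for i
      using monotone_onD[OF t(3), of i "Suc i"] monotone_onD[OF t(3), of 0 i] that t by auto
    have "(\<Sum>i<n. ennreal (dist (\<gamma> (t i)) (\<gamma> (t (Suc i))))) \<le> (\<Sum>i<n. ennreal (J (t (Suc i)) - J (t i)))"
    proof (rule sum_mono, rule ennreal_leI)
      fix i assume i: "i \<in> {..<n}"
      have "(\<gamma>' has_integral \<gamma> (t (Suc i)) - \<gamma> (t i)) {t i..t (Suc i)}"
        by (rule fundamental_theorem_of_calculus) (use t_mono[of i] i der in \<open>auto intro: has_vector_derivative_at_within\<close>)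
      then have "norm (\<gamma> (t (Suc i)) - \<gamma> (t i)) \<le> integral {t i..t (Suc i)} (\<lambda>t. norm (\<gamma>' t))"
        using Henstock_Kurzweil_Integration.integral_norm_bound_integral[OF _ int, of \<gamma>' "t i" "t (Suc i)"]
        by (metis integral_unique has_integral_integrable order_refl)
      then show "dist (\<gamma> (t i)) (\<gamma> (t (Suc i))) \<le> J (t (Suc i)) - J (t i)"
        using J_diff t_mono i by (simp add: dist_norm norm_minus_commute)
    qed
    also have "\<dots> = ennreal (\<Sum>i<n. J (t (Suc i)) - J (t i))"
      by (intro sum_ennreal) (use J_mono t_mono in auto)
    also have "\<dots> = ennreal (J b)" using sum_lessThan_telescope[of "\<lambda>i. J (t i)" n] by (simp add: t Ja)
    finally show "(\<Sum>i<n. ennreal (dist (\<gamma> (t i)) (\<gamma> (t (Suc i))))) \<le> ennreal (J b)" .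
  qed
  moreover have "ennreal (J b) \<le> curve_length a b \<gamma>"
  proof (rule ennreal_le_epsilon)
    fix e :: real assume "0 < e"
    define e' where "e' = e / (2 * (b - a) + 1)"
    have e': "e' > 0" "2 * e' * (b - a) \<le> e" using \<open>0 < e\<close> \<open>a \<le> b\<close> by (auto simp: e'_def field_simps)
    obtain d where d: "d > 0" "\<And>x y. x \<in> {a..b} \<Longrightarrow> y \<in> {a..b} \<Longrightarrow> \<bar>y - x\<bar> < d \<Longrightarrow> norm (\<gamma>' y - \<gamma>' x) < e'"
      using compact_uniformly_continuous[OF continuous_on_subset[OF cont], of "{a..b}"] e'(1)
      unfolding uniformly_continuous_on_def dist_norm by (auto simp: norm_minus_commute)
    obtain M :: nat where "(b - a) / d < real M" using reals_Archimedean2 by blast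
    then obtain N :: nat where N: "(b - a) / d < real N" "N > 0" by (intro that[of "Suc M"]) auto
    define h where "h = (b - a) / N"
    define t where "t i = a + real i * h" for i
    have h: "0 \<le> h" "h < d" "real N * h = b - a" using N d(1) \<open>a \<le> b\<close> by (auto simp: h_def field_simps)
    have t: "t 0 = a" "t N = b" "mono_on {..N} t"
      using h by (auto simp: t_def monotone_on_def intro!: mult_right_mono)
    have tS: "t (Suc i) = t i + h" for i by (simp add: t_def algebra_simps)
    have step: "J (t (Suc i)) - J (t i) \<le> dist (\<gamma> (t i)) (\<gamma> (t (Suc i))) + 2 * e' * h" if "i < N" for i
    proof -
      have in_ab: "a \<le> t i" "t (Suc i) \<le> b"
        using monotone_onD[OF t(3), of 0 i] monotone_onD[OF t(3), of "Suc i" N] that t by auto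
      have close: "norm (\<gamma>' x - \<gamma>' (t i)) \<le> e'" if "x \<in> {t i..t (Suc i)}" for x
        using d(2)[of "t i" x] that in_ab tS[of i] h by auto
      have "norm (\<gamma> (t (Suc i)) - \<gamma> (t i) - (t (Suc i) - t i) *\<^sub>R \<gamma>' (t i)) \<le> norm (t (Suc i) - t i) * e'"
        by (rule vector_differentiable_bound_linearization[where S = "{t i..t (Suc i)}" and f' = \<gamma>'])
           (use close tS[of i] h der in \<open>auto simp: closed_segment_eq_real_ivl intro: has_vector_derivative_at_within\<close>)
      then have "norm (h *\<^sub>R \<gamma>' (t i)) \<le> dist (\<gamma> (t i)) (\<gamma> (t (Suc i))) + h * e'"
        using h tS[of i] norm_triangle_sub[of "h *\<^sub>R \<gamma>' (t i)" "\<gamma> (t (Suc i)) - \<gamma> (t i)"]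
        by (simp add: dist_norm norm_minus_commute)
      moreover have "J (t (Suc i)) - J (t i) \<le> integral {t i..t (Suc i)} (\<lambda>_. norm (\<gamma>' (t i)) + e')"
      proof -
        have "norm (\<gamma>' x) \<le> norm (\<gamma>' (t i)) + e'" if "x \<in> {t i..t (Suc i)}" for x
          using close[OF that] norm_triangle_sub[of "\<gamma>' x" "\<gamma>' (t i)"] by simp
        then have "integral {t i..t (Suc i)} (\<lambda>t. norm (\<gamma>' t)) \<le> integral {t i..t (Suc i)} (\<lambda>_. norm (\<gamma>' (t i)) + e')"
          by (intro integral_le int) auto
        then show ?thesis using J_diff[of "t i" "t (Suc i)"] in_ab tS[of i] h by simp
      qed
      ultimately show ?thesis using tS[of i] h by (simp add: algebra_simps)
    qed
    have "J b = (\<Sum>i<N. J (t (Suc i)) - J (t i))" using sum_lessThan_telescope[of "\<lambda>i. J (t i)" N] by (simp add: t Ja)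
    also have "\<dots> \<le> (\<Sum>i<N. dist (\<gamma> (t i)) (\<gamma> (t (Suc i))) + 2 * e' * h)"
      by (intro sum_mono step) auto
    also have "\<dots> = (\<Sum>i<N. dist (\<gamma> (t i)) (\<gamma> (t (Suc i)))) + 2 * e' * (real N * h)" by (simp add: sum.distrib)
    also have "\<dots> \<le> (\<Sum>i<N. dist (\<gamma> (t i)) (\<gamma> (t (Suc i)))) + e" using e'(2) h by simp
    finally have "ennreal (J b) \<le> ennreal ((\<Sum>i<N. dist (\<gamma> (t i)) (\<gamma> (t (Suc i)))) + e)" by (rule ennreal_leI)
    also have "\<dots> = (\<Sum>i<N. ennreal (dist (\<gamma> (t i)) (\<gamma> (t (Suc i))))) + ennreal e"
      using \<open>0 < e\<close> by (simp add: sum_nonneg sum_ennreal)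
    also have "\<dots> \<le> curve_length a b \<gamma> + ennreal e"
      using polygon_le_curve_length[OF t(3), of \<gamma>] t by (simp add: add_right_mono)
    finally show "ennreal (J b) \<le> curve_length a b \<gamma> + ennreal e" .
  qed
  ultimately show ?thesis by simp
qed

section \<open>Harmonic functions as real parts of holomorphic functions\<close>

text \<open>By the mean value theorem in the first variable, the second difference of \<open>U\<close> over a square of side \<open>h\<close>
is \<open>h\<close> times a difference of \<open>Ux\<close>, which the linear approximation of \<open>Ux\<close> at the corner determines up to
\<open>o(h)\<close>. The second difference is symmetric in the two variables, whence the equality of the mixed partial
derivatives below.\<close>

lemma second_difference_estimate:
  fixes U Ux :: "real \<Rightarrow> real \<Rightarrow> real"
  assumes "\<delta> > 0"
    and dx: "\<And>s t. \<bar>s\<bar> < \<delta> \<Longrightarrow> \<bar>t\<bar> < \<delta> \<Longrightarrow> ((\<lambda>s. U s t) has_real_derivative Ux s t) (at s)"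
    and lin: "\<And>e. e > 0 \<Longrightarrow> \<exists>d>0. \<forall>s t. \<bar>s\<bar> < d \<longrightarrow> \<bar>t\<bar> < d \<longrightarrow>
                \<bar>Ux s t - Ux 0 0 - a * s - b * t\<bar> \<le> e * (\<bar>s\<bar> + \<bar>t\<bar>)"
    and "e > 0"
  shows "\<exists>d>0. \<forall>h. 0 < h \<longrightarrow> h < d \<longrightarrow> \<bar>U h h - U h 0 - U 0 h + U 0 0 - b * h\<^sup>2\<bar> \<le> e * h\<^sup>2"
proof -
  obtain d where d: "d > 0" "\<And>s t. \<bar>s\<bar> < d \<Longrightarrow> \<bar>t\<bar> < d \<Longrightarrow>
                \<bar>Ux s t - Ux 0 0 - a * s - b * t\<bar> \<le> (e/3) * (\<bar>s\<bar> + \<bar>t\<bar>)"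
    using lin[of "e/3"] \<open>e > 0\<close> by auto
  have "\<bar>U h h - U h 0 - U 0 h + U 0 0 - b * h\<^sup>2\<bar> \<le> e * h\<^sup>2" if h: "0 < h" "h < min d \<delta>" for h
  proof -
    have "\<exists>z>0. z < h \<and> (U h h - U h 0) - (U 0 h - U 0 0) = (h - 0) * (Ux z h - Ux z 0)"
      by (rule MVT2[OF h(1)]) (use h in \<open>auto intro!: DERIV_diff dx\<close>)
    then obtain z where z: "z > 0" "z < h"
      and eq: "(U h h - U h 0) - (U 0 h - U 0 0) = h * (Ux z h - Ux z 0)" by auto
    have "\<bar>Ux z h - Ux 0 0 - a * z - b * h\<bar> \<le> (e/3) * (\<bar>z\<bar> + \<bar>h\<bar>)"
      "\<bar>Ux z 0 - Ux 0 0 - a * z - b * 0\<bar> \<le> (e/3) * (\<bar>z\<bar> + \<bar>0\<bar>)"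
      using d(2)[of z h] d(2)[of z 0] z h by auto
    moreover have "(e/3) * (\<bar>z\<bar> + \<bar>h\<bar>) + (e/3) * (\<bar>z\<bar> + \<bar>0\<bar>) = (e/3) * (2 * z + h)"
      using z by (simp add: field_simps)
    moreover have "(e/3) * (2 * z + h) \<le> (e/3) * (3 * h)"
      using z \<open>e > 0\<close> by (intro mult_left_mono) auto
    ultimately have "\<bar>Ux z h - Ux z 0 - b * h\<bar> \<le> (e/3) * (3 * h)" by linarith
    then have "\<bar>Ux z h - Ux z 0 - b * h\<bar> \<le> e * h" by simp
    then have "h * \<bar>Ux z h - Ux z 0 - b * h\<bar> \<le> h * (e * h)" using h by (intro mult_left_mono) auto
    moreover have "U h h - U h 0 - U 0 h + U 0 0 - b * h\<^sup>2 = h * (Ux z h - Ux z 0 - b * h)"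
      using eq by (simp add: algebra_simps power2_eq_square)
    ultimately have "\<bar>h * (Ux z h - Ux z 0 - b * h)\<bar> \<le> h * (e * h)" using h by (simp add: abs_mult)
    then show ?thesis
      unfolding \<open>U h h - U h 0 - U 0 h + U 0 0 - b * h\<^sup>2 = _\<close> by (simp add: power2_eq_square ac_simps)
  qed
  then show ?thesis using d(1) \<open>\<delta> > 0\<close> by (intro exI[of _ "min d \<delta>"]) auto
qed

lemma mixed_partials_eq:
  fixes u ux uy :: "complex \<Rightarrow> real"
  assumes S: "open S" "z \<in> S"
    and du: "\<And>w. w \<in> S \<Longrightarrow> (u has_derivative (\<lambda>h. ux w * Re h + uy w * Im h)) (at w)"
    and dux: "(ux has_derivative (\<lambda>h. a * Re h + b * Im h)) (at z)"
    and duy: "(uy has_derivative (\<lambda>h. c * Re h + d * Im h)) (at z)"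
  shows "b = c"
proof (rule ccontr)
  assume "b \<noteq> c"
  define e where "e = \<bar>b - c\<bar> / 3"
  have e: "e > 0" using \<open>b \<noteq> c\<close> by (simp add: e_def)
  obtain r where r: "r > 0" "ball z r \<subseteq> S" using S open_contains_ball by blast
  have in_S: "z + Complex s t \<in> S" if "\<bar>s\<bar> < r/2" "\<bar>t\<bar> < r/2" for s t
  proof -
    have "cmod (Complex s t) \<le> \<bar>s\<bar> + \<bar>t\<bar>" using cmod_le[of "Complex s t"] by simp
    then show ?thesis using r(2) that by (intro subsetD[OF r(2)]) (auto simp: dist_norm)
  qed
  define U where "U s t = u (z + Complex s t)" for s t
  have lin: "\<exists>d>0. \<forall>s t. \<bar>s\<bar> < d \<longrightarrow> \<bar>t\<bar> < d \<longrightarrow>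
                \<bar>v (z + Complex s t) - v (z + Complex 0 0) - p * s - q * t\<bar> \<le> e * (\<bar>s\<bar> + \<bar>t\<bar>)"
    if dv: "(v has_derivative (\<lambda>h. p * Re h + q * Im h)) (at z)" and "e > 0" for v p q e
  proof -
    obtain d where d: "d > 0" "\<And>y. norm (y - z) < d \<Longrightarrow>
        norm (v y - v z - (p * Re (y - z) + q * Im (y - z))) \<le> e * norm (y - z)"
      using dv \<open>e > 0\<close> unfolding has_derivative_at_alt by blast
    show ?thesis
    proof (intro exI[of _ "d/2"] conjI allI impI)
      fix s t :: real assume st: "\<bar>s\<bar> < d/2" "\<bar>t\<bar> < d/2"
      have le: "cmod (Complex s t) \<le> \<bar>s\<bar> + \<bar>t\<bar>" using cmod_le[of "Complex s t"] by simp
      then have "norm (v (z + Complex s t) - v z - (p * s + q * t)) \<le> e * cmod (Complex s t)"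
        using d(2)[of "z + Complex s t"] st by auto
      also have "\<dots> \<le> e * (\<bar>s\<bar> + \<bar>t\<bar>)" using le \<open>e > 0\<close> by simp
      finally show "\<bar>v (z + Complex s t) - v (z + Complex 0 0) - p * s - q * t\<bar> \<le> e * (\<bar>s\<bar> + \<bar>t\<bar>)"
        by (simp add: Complex_eq_0 algebra_simps flip: zero_complex.code)
    qed (use d in auto)
  qed
  have lin': "\<exists>d>0. \<forall>t s. \<bar>t\<bar> < d \<longrightarrow> \<bar>s\<bar> < d \<longrightarrow>
                \<bar>v (z + Complex s t) - v (z + Complex 0 0) - q * t - p * s\<bar> \<le> e * (\<bar>t\<bar> + \<bar>s\<bar>)"
    if v: "(v has_derivative (\<lambda>h. p * Re h + q * Im h)) (at z)" "e > 0" for v p q e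
  proof -
    obtain d where "d > 0" and d: "\<And>s t. \<bar>s\<bar> < d \<Longrightarrow> \<bar>t\<bar> < d \<Longrightarrow>
      \<bar>v (z + Complex s t) - v (z + Complex 0 0) - p * s - q * t\<bar> \<le> e * (\<bar>s\<bar> + \<bar>t\<bar>)"
      using lin[OF v] by blast
    have "\<bar>v (z + Complex s t) - v (z + Complex 0 0) - q * t - p * s\<bar> \<le> e * (\<bar>t\<bar> + \<bar>s\<bar>)"
      if "\<bar>t\<bar> < d" "\<bar>s\<bar> < d" for s t
      using d[OF that(2,1)] by (metis diff_diff_eq add.commute)
    then show ?thesis using \<open>d > 0\<close> by blast
  qed
  have "((\<lambda>s. U s t) has_real_derivative ux (z + Complex s t)) (at s)"
    if "\<bar>s\<bar> < r/2" "\<bar>t\<bar> < r/2" for s t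
  proof -
    have "((\<lambda>s. Complex s t) has_derivative (\<lambda>h. Complex h 0)) (at s)"
      unfolding Complex_eq by (auto intro!: derivative_eq_intros)
    from has_derivative_compose[OF has_derivative_add[OF has_derivative_const this, of z] du[OF in_S[OF that]]]
    show ?thesis by (simp add: U_def has_field_derivative_def)
  qed
  moreover have "((\<lambda>t. U s t) has_real_derivative uy (z + Complex s t)) (at t)"
    if "\<bar>s\<bar> < r/2" "\<bar>t\<bar> < r/2" for s t
  proof -
    have "((\<lambda>t. Complex s t) has_derivative (\<lambda>h. Complex 0 h)) (at t)"
      unfolding Complex_eq by (auto intro!: derivative_eq_intros)
    from has_derivative_compose[OF has_derivative_add[OF has_derivative_const this, of z] du[OF in_S[OF that]]]
    show ?thesis by (simp add: U_def has_field_derivative_def)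
  qed
  ultimately have
    "\<exists>d>0. \<forall>h. 0 < h \<longrightarrow> h < d \<longrightarrow> \<bar>U h h - U h 0 - U 0 h + U 0 0 - b * h\<^sup>2\<bar> \<le> e * h\<^sup>2"
    "\<exists>d>0. \<forall>h. 0 < h \<longrightarrow> h < d \<longrightarrow> \<bar>U h h - U 0 h - U h 0 + U 0 0 - c * h\<^sup>2\<bar> \<le> e * h\<^sup>2"
    using r(1) e
    using second_difference_estimate[where \<delta> = "r/2" and U = U and a = a and b = b and e = e and
            Ux = "\<lambda>s t. ux (z + Complex s t)"] lin[OF dux]
          second_difference_estimate[where \<delta> = "r/2" and U = "\<lambda>t s. U s t" and a = d and b = c and e = e and
            Ux = "\<lambda>t s. uy (z + Complex s t)"] lin'[OF duy] r(1) e by simp_all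
  then obtain d1 d2 where d12: "d1 > 0" "d2 > 0"
    "\<And>h. 0 < h \<Longrightarrow> h < d1 \<Longrightarrow> \<bar>U h h - U h 0 - U 0 h + U 0 0 - b * h\<^sup>2\<bar> \<le> e * h\<^sup>2"
    "\<And>h. 0 < h \<Longrightarrow> h < d2 \<Longrightarrow> \<bar>U h h - U 0 h - U h 0 + U 0 0 - c * h\<^sup>2\<bar> \<le> e * h\<^sup>2" by blast
  define h where "h = min d1 d2 / 2"
  have h: "0 < h" "h < d1" "h < d2" using d12(1,2) by (auto simp: h_def)
  have "\<bar>b * h\<^sup>2 - c * h\<^sup>2\<bar> \<le> 2 * e * h\<^sup>2" using d12(3)[of h] d12(4)[of h] h by (simp add: abs_le_iff)
  also have "b * h\<^sup>2 - c * h\<^sup>2 = (b - c) * h\<^sup>2" by (simp add: algebra_simps)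
  finally have "\<bar>b - c\<bar> * h\<^sup>2 \<le> 2 * e * h\<^sup>2" by (simp add: abs_mult)
  then have "\<bar>b - c\<bar> \<le> 2 * e" using h by simp
  then show False using e by (simp add: e_def)
qed

text \<open>The function \<open>u\<^sub>x - \<i> u\<^sub>y\<close> satisfies the Cauchy-Riemann equations: one of them is the Laplace equation, the
other the symmetry of the second derivatives. On a convex set it has a primitive, whose real part is
\<open>u\<close> up to a constant.\<close>

lemma harmonic_on_imp_Re_holomorphic:
  assumes "harmonic_on u S" "convex S"
  obtains g where "g holomorphic_on S" "\<And>z. z \<in> S \<Longrightarrow> u z = Re (g z)"
proof -
  obtain ux uy uxx uxy uyx uyy where S: "open S"
    and du: "\<And>z. z \<in> S \<Longrightarrow> (u has_derivative (\<lambda>h. ux z * Re h + uy z * Im h)) (at z)"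
    and dux: "\<And>z. z \<in> S \<Longrightarrow> (ux has_derivative (\<lambda>h. uxx z * Re h + uxy z * Im h)) (at z)"
    and duy: "\<And>z. z \<in> S \<Longrightarrow> (uy has_derivative (\<lambda>h. uyx z * Re h + uyy z * Im h)) (at z)"
    and lap: "\<And>z. z \<in> S \<Longrightarrow> uxx z + uyy z = 0"
    using assms(1) unfolding harmonic_on_def by blast
  define p where "p z = complex_of_real (ux z) - \<i> * complex_of_real (uy z)" for z
  have dp: "(p has_field_derivative (uxx z - \<i> * uyx z)) (at z)" if "z \<in> S" for z
  proof -
    have "uxy z = uyx z" using mixed_partials_eq[OF S that du dux duy] that by blast
    moreover have "uyy z = - uxx z" using lap[OF that] by simp
    ultimately have "(p has_derivative (\<lambda>h. complex_of_real (uxx z * Re h + uyx z * Im h)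
                 - \<i> * complex_of_real (uyx z * Re h - uxx z * Im h))) (at z)"
      unfolding p_def using dux[OF that] duy[OF that]
      by (auto intro!: derivative_eq_intros)
    then show ?thesis unfolding has_field_derivative_def
      by (rule has_derivative_eq_rhs) (auto simp: fun_eq_iff complex_eq_iff algebra_simps)
  qed
  then have hol: "p holomorphic_on S" using S by (auto simp: holomorphic_on_open)
  obtain g where g: "\<And>z. z \<in> S \<Longrightarrow> (g has_field_derivative p z) (at z)"
    using holomorphic_convex_primitive'[OF assms(2) S hol] S by (metis at_within_open)
  have "\<exists>c. \<forall>z\<in>S. u z - Re (g z) = c"
  proof (rule has_derivative_zero_constant[OF assms(2)])
    fix z assume z: "z \<in> S"
    have "((\<lambda>z. Re (g z)) has_derivative (\<lambda>h. Re (p z * h))) (at z)"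
      using g[OF z] unfolding has_field_derivative_def
      by (rule has_derivative_compose[OF _ has_derivative_Re[OF has_derivative_ident]])
    from has_derivative_diff[OF du[OF z] this]
    show "((\<lambda>z. u z - Re (g z)) has_derivative (\<lambda>h. 0)) (at z within S)"
      by (auto intro!: has_derivative_at_withinI simp: p_def)
  qed
  then obtain c where c: "\<And>z. z \<in> S \<Longrightarrow> u z - Re (g z) = c" by blast
  show thesis
  proof
    show "(\<lambda>z. g z + of_real c) holomorphic_on S"
      using g S by (intro holomorphic_intros) (auto simp: holomorphic_on_open)
    show "u z = Re (g z + of_real c)" if "z \<in> S" for z using c[OF that] by simp
  qed
qed

lemma Re_holomorphic_imp_harmonic_on:
  assumes S: "open S" and g: "g holomorphic_on S" and u: "\<And>z. z \<in> S \<Longrightarrow> u z = Re (g z)"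
  shows "harmonic_on u S"
proof -
  have g': "deriv g holomorphic_on S" by (intro holomorphic_deriv g S)
  have g'': "deriv (deriv g) holomorphic_on S" by (intro holomorphic_deriv g' S)
  have dRe: "((\<lambda>z. Re (f z)) has_derivative (\<lambda>h. Re (deriv f z) * Re h + (- Im (deriv f z)) * Im h)) (at z)"
    and dIm: "((\<lambda>z. - Im (f z)) has_derivative (\<lambda>h. (- Im (deriv f z)) * Re h + (- Re (deriv f z)) * Im h)) (at z)"
    if "f holomorphic_on S" "z \<in> S" for f z
  proof -
    have d: "(f has_derivative (*) (deriv f z)) (at z)"
      using holomorphic_derivI[OF that(1) S that(2)] by (simp add: has_field_derivative_def)
    show "((\<lambda>z. Re (f z)) has_derivative (\<lambda>h. Re (deriv f z) * Re h + (- Im (deriv f z)) * Im h)) (at z)"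
      by (rule has_derivative_eq_rhs[OF has_derivative_Re[OF d]]) auto
    show "((\<lambda>z. - Im (f z)) has_derivative (\<lambda>h. (- Im (deriv f z)) * Re h + (- Re (deriv f z)) * Im h)) (at z)"
      by (rule has_derivative_eq_rhs[OF has_derivative_minus[OF has_derivative_Im[OF d]]])
         (auto simp: algebra_simps)
  qed
  have "(u has_derivative (\<lambda>h. Re (deriv g z) * Re h + (- Im (deriv g z)) * Im h)) (at z)" if "z \<in> S" for z
    by (rule has_derivative_transform_within_open[OF dRe[OF g that] S that]) (simp add: u)
  moreover have "continuous_on S (\<lambda>z. Re (deriv (deriv g) z))" "continuous_on S (\<lambda>z. - Im (deriv (deriv g) z))"
    "continuous_on S (\<lambda>z. - Re (deriv (deriv g) z))"
    using holomorphic_on_imp_continuous_on[OF g''] by (auto intro: continuous_intros)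
  ultimately show ?thesis unfolding harmonic_on_def
    using S dRe[OF g'] dIm[OF g'] \<open>\<And>z. z \<in> S \<Longrightarrow> (u has_derivative _) _\<close>
    by (intro conjI, blast,
        rule_tac x = "\<lambda>z. Re (deriv g z)" in exI, rule_tac x = "\<lambda>z. - Im (deriv g z)" in exI,
        rule_tac x = "\<lambda>z. Re (deriv (deriv g) z)" in exI, rule_tac x = "\<lambda>z. - Im (deriv (deriv g) z)" in exI,
        rule_tac x = "\<lambda>z. - Im (deriv (deriv g) z)" in exI, rule_tac x = "\<lambda>z. - Re (deriv (deriv g) z)" in exI)
       (intro conjI ballI, simp_all)
qed

lemma harmonic_map_on_imp_Re_holomorphic:
  fixes f :: "complex \<Rightarrow> real ^ 'n"
  assumes "harmonic_map_on f S" "convex S"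
  obtains g where "\<And>j. g j holomorphic_on S" "\<And>j z. z \<in> S \<Longrightarrow> f z $ j = Re (g j z)"
proof -
  have "\<forall>j. \<exists>g. g holomorphic_on S \<and> (\<forall>z\<in>S. f z $ j = Re (g z))"
  proof
    fix j
    have "harmonic_on (\<lambda>z. f z $ j) S" using assms by (simp add: harmonic_map_on_def)
    then show "\<exists>g. g holomorphic_on S \<and> (\<forall>z\<in>S. f z $ j = Re (g z))"
    proof (rule harmonic_on_imp_Re_holomorphic[OF _ assms(2)])
      fix g assume "g holomorphic_on S" "\<And>z. z \<in> S \<Longrightarrow> f z $ j = Re (g z)"
      then show "\<exists>g. g holomorphic_on S \<and> (\<forall>z\<in>S. f z $ j = Re (g z))" by (intro exI[of _ g] conjI ballI)
    qed
  qed
  then have "\<exists>g. \<forall>j. g j holomorphic_on S \<and> (\<forall>z\<in>S. f z $ j = Re (g j z))" by (rule choice)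
  then obtain g where "\<forall>j. g j holomorphic_on S \<and> (\<forall>z\<in>S. f z $ j = Re (g j z))" ..
  then show thesis by (intro that[of g]) simp_all
qed

text \<open>If \<open>f\<close> has components \<open>Re g\<^sub>j\<close>, then its angular derivative at \<open>z\<close> has components \<open>Re (\<i> z g\<^sub>j'(z))\<close>. This is
harmonic, and it is the velocity of the image circles.\<close>

lemma angular_deriv_harmonic:
  fixes f :: "complex \<Rightarrow> real ^ 'n"
  assumes "harmonic_map_on f (ball 0 1)"
  shows "harmonic_map_on (angular_deriv f) (ball 0 1)"
    and "\<And>r. 0 < r \<Longrightarrow> r < 1 \<Longrightarrow>
      curve_length 0 (2 * pi) (circle_image f r) = (\<integral>\<^sup>+t\<in>{0..2*pi}. ennreal (norm (angular_deriv f (rcis r t))) \<partial>lborel)"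
proof -
  obtain g where g: "\<And>j. g j holomorphic_on ball 0 1" "\<And>j z. z \<in> ball 0 1 \<Longrightarrow> f z $ j = Re (g j z)"
    using harmonic_map_on_imp_Re_holomorphic[OF assms convex_ball] by metis
  define D where "D z = (\<chi> j. Re (\<i> * z * deriv (g j) z))" for z
  have der: "((\<lambda>t. f (rcis r t)) has_vector_derivative D (rcis r t)) (at t)" if "0 \<le> r" "r < 1" for r t
  proof -
    have ball: "rcis r s \<in> ball 0 1" for s using that by (simp add: rcis_def norm_mult)
    have "((\<lambda>t. rcis r t) has_vector_derivative \<i> * rcis r t) (at t)"
    proof -
      have "((\<lambda>z. of_real r * exp (\<i> * z)) has_field_derivative \<i> * rcis r t) (at (of_real t))"
        by (auto intro!: derivative_eq_intros simp: rcis_def cis_conv_exp)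
      from has_vector_derivative_real_field[OF this] show ?thesis by (simp add: rcis_def cis_conv_exp)
    qed
    moreover have "(g j has_field_derivative deriv (g j) (rcis r t)) (at (rcis r t))" for j
      by (rule holomorphic_derivI[OF g(1) open_ball ball])
    ultimately have "((\<lambda>t. g j (rcis r t)) has_vector_derivative \<i> * rcis r t * deriv (g j) (rcis r t)) (at t)" for j
      using field_vector_diff_chain_at[of "\<lambda>t. rcis r t" _ t "g j"] by (simp add: o_def)
    then have "((\<lambda>t. Re (g j (rcis r t))) has_vector_derivative Re (\<i> * rcis r t * deriv (g j) (rcis r t))) (at t)" for j
      by (rule bounded_linear.has_vector_derivative[OF bounded_linear_Re])
    then have "((\<lambda>t. f (rcis r t) $ j) has_vector_derivative D (rcis r t) $ j) (at t)" for j
      using ball by (simp add: g(2) D_def)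
    then show ?thesis
      unfolding has_vector_derivative_def by (subst has_derivative_componentwise_within)
        (auto simp: Basis_vec_def inner_axis)
  qed
  have ang: "angular_deriv f z = D z" if "z \<in> ball 0 1" for z
  proof -
    have "angular_deriv f z = D (rcis (cmod z) (Arg z))"
      unfolding angular_deriv_def by (rule vector_derivative_at, rule der) (use that in auto)
    then show ?thesis by (simp add: rcis_cmod_Arg)
  qed
  have D_hol: "(\<lambda>z. \<i> * z * deriv (g j) z) holomorphic_on ball 0 1" for j
    by (intro holomorphic_intros holomorphic_deriv g) auto
  show "harmonic_map_on (angular_deriv f) (ball 0 1)"
    unfolding harmonic_map_on_def
    by (intro allI Re_holomorphic_imp_harmonic_on[OF open_ball D_hol]) (simp add: ang D_def)
  fix r :: real assume r: "0 < r" "r < 1"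
  have ball: "rcis r s \<in> ball 0 1" for s using r by (simp add: rcis_def norm_mult)
  have "continuous_on UNIV (\<lambda>t. D (rcis r t))" unfolding D_def
  proof (rule continuous_on_vec_lambda)
    fix j
    show "continuous_on UNIV (\<lambda>t. Re (\<i> * rcis r t * deriv (g j) (rcis r t)))"
      by (intro continuous_on_Re continuous_on_compose2[OF holomorphic_on_imp_continuous_on[OF D_hol]])
         (use ball in \<open>auto simp: rcis_def intro!: continuous_intros\<close>)
  qed
  then have "curve_length 0 (2 * pi) (circle_image f r) = (\<integral>\<^sup>+t\<in>{0..2*pi}. ennreal (norm (D (rcis r t))) \<partial>lborel)"
    using curve_length_C1_eq_integral[of 0 "2 * pi" "\<lambda>t. f (rcis r t)" "\<lambda>t. D (rcis r t)"] der r
    by (simp add: circle_image_def[abs_def])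
  then show "curve_length 0 (2 * pi) (circle_image f r) =
      (\<integral>\<^sup>+t\<in>{0..2*pi}. ennreal (norm (angular_deriv f (rcis r t))) \<partial>lborel)"
    by (simp add: ang[OF ball])
qed

section \<open>A maximum principle with a countable exceptional set\<close>

lemma mean_value_circle:
  assumes g: "g holomorphic_on ball 0 1" and R: "0 < R" "R < 1"
  shows "((\<lambda>x. g (of_real R * cis (2 * pi * x))) has_integral g 0) {0..1}"
proof -
  have sub: "cball 0 R \<subseteq> ball 0 1" using R by auto
  have "((\<lambda>u. g u / (u - 0)) has_contour_integral 2 * of_real pi * \<i> * g 0) (circlepath 0 R)"
    by (rule Cauchy_integral_circlepath)
       (use R sub g holomorphic_on_imp_continuous_on in \<open>auto intro: continuous_on_subset holomorphic_on_subset\<close>)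
  then have "((\<lambda>x. g (circlepath 0 R x) / circlepath 0 R x * vector_derivative (circlepath 0 R) (at x within {0..1}))
      has_integral 2 * of_real pi * \<i> * g 0) {0..1}"
    by (simp add: has_contour_integral_def)
  then have "((\<lambda>x. 2 * of_real pi * \<i> * g (of_real R * cis (2 * pi * x))) has_integral 2 * of_real pi * \<i> * g 0) {0..1}"
  proof (rule has_integral_eq[rotated])
    fix x :: real assume x: "x \<in> {0..1}"
    have *: "exp (2 * of_real pi * \<i> * of_real x) = cis (2 * pi * x)" by (simp add: cis_conv_exp mult_ac)
    have "vector_derivative (circlepath 0 R) (at x within {0..1}) = 2 * pi * \<i> * R * cis (2 * pi * x)"
      using vector_derivative_circlepath01[of x 0 R] x * by simp
    moreover have "circlepath 0 R x = of_real R * cis (2 * pi * x)" unfolding circlepath * by simp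
    ultimately show "g (circlepath 0 R x) / circlepath 0 R x * vector_derivative (circlepath 0 R) (at x within {0..1}) =
        2 * of_real pi * \<i> * g (of_real R * cis (2 * pi * x))"
      using R by simp
  qed
  from has_integral_mult_right[OF this, of "1 / (2 * of_real pi * \<i>)"] show ?thesis by simp
qed

lemma mobius_norm_identity:
  "(cmod (1 + cnj a * z))\<^sup>2 - (cmod (z + a))\<^sup>2 = (1 - (cmod a)\<^sup>2) * (1 - (cmod z)\<^sup>2)"
  unfolding cmod_power2 by (simp add: power2_eq_square algebra_simps)

text \<open>A Moebius transformation moves the point \<open>a\<close> to the centre, where the value is the mean over concentric
circles. The part of the function above \<open>L\<close> tends to zero boundedly, off a countable set of directions,
as the circles expand; hence its mean tends to zero.\<close>

lemma Re_holomorphic_le_of_boundary_limits: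
  assumes g: "g holomorphic_on ball 0 1" and M: "\<And>z. z \<in> ball 0 1 \<Longrightarrow> \<bar>Re (g z)\<bar> \<le> M"
    and S: "countable S"
    and lim: "\<And>\<zeta>. cmod \<zeta> = 1 \<Longrightarrow> \<zeta> \<notin> S \<Longrightarrow> \<exists>l\<le>L. ((\<lambda>z. Re (g z)) \<longlongrightarrow> l) (at \<zeta> within ball 0 1)"
    and a: "cmod a < 1"
  shows "Re (g a) \<le> L"
proof -
  define \<phi> where "\<phi> z = (z + a) / (1 + cnj a * z)" for z
  have a2: "0 < 1 - (cmod a)\<^sup>2" using a by (simp add: abs_square_less_1)
  have den: "1 + cnj a * z \<noteq> 0" if "cmod z \<le> 1" for z
  proof
    assume "1 + cnj a * z = 0"
    then have "cnj a * z = - 1" by (simp add: add_eq_0_iff)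
    then have "cmod a * cmod z = 1" by (metis complex_mod_cnj norm_minus_cancel norm_mult norm_one)
    moreover have "cmod a * cmod z \<le> cmod a" using that by (simp add: mult_left_le)
    ultimately show False using a by simp
  qed
  have \<phi>_ball: "cmod (\<phi> z) < 1" if "cmod z < 1" for z
  proof -
    have "0 < 1 - (cmod z)\<^sup>2" using that by (simp add: abs_square_less_1)
    from mult_pos_pos[OF a2 this] have "(cmod (z + a))\<^sup>2 < (cmod (1 + cnj a * z))\<^sup>2"
      using mobius_norm_identity[of a z] by linarith
    then have "cmod (z + a) < cmod (1 + cnj a * z)" by (rule power_less_imp_less_base) simp
    then show ?thesis using den[of z] that by (simp add: \<phi>_def norm_divide)
  qed
  have \<phi>_sphere: "cmod (\<phi> z) = 1" if "cmod z = 1" for z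
  proof -
    have "(cmod (z + a))\<^sup>2 = (cmod (1 + cnj a * z))\<^sup>2" using mobius_norm_identity[of a z] that by simp
    then have "cmod (z + a) = cmod (1 + cnj a * z)" by (simp add: power2_eq_iff_nonneg)
    then show ?thesis using den[of z] that by (simp add: \<phi>_def norm_divide)
  qed
  have \<phi>_inj: "z = w" if "cmod z = 1" "cmod w = 1" "\<phi> z = \<phi> w" for z w
  proof -
    have "(z + a) * (1 + cnj a * w) = (w + a) * (1 + cnj a * z)"
      using that den[of z] den[of w] by (simp add: \<phi>_def frac_eq_eq)
    then have "(z - w) * (1 - a * cnj a) = 0" by (simp add: algebra_simps)
    moreover have "1 - a * cnj a \<noteq> 0"
      using a2 by (metis complex_norm_square eq_iff_diff_eq_0 less_irrefl of_real_1 of_real_eq_iff)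
    ultimately show ?thesis by simp
  qed
  have \<phi>_cont: "continuous_on (cball 0 1) \<phi>" unfolding \<phi>_def by (intro continuous_intros) (use den in auto)
  have "\<phi> holomorphic_on ball 0 1" unfolding \<phi>_def by (intro holomorphic_intros) (use den in auto)
  then have hol: "(\<lambda>z. g (\<phi> z)) holomorphic_on ball 0 1"
    by (rule holomorphic_on_compose_gen[OF _ g, unfolded o_def]) (use \<phi>_ball in auto)
  define R where "R n = 1 - 1 / (real n + 2)" for n
  have R: "0 < R n" "R n < 1" for n by (auto simp: R_def field_simps)
  have R_lim: "R \<longlonglongrightarrow> 1" unfolding R_def by real_asymp
  define z where "z n x = of_real (R n) * cis (2 * pi * x)" for n x
  have z_ball: "cmod (z n x) < 1" for n x using R[of n] by (simp add: z_def norm_mult)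
  define v where "v n x = max (Re (g (\<phi> (z n x))) - L) 0" for n x
  have v_bound: "\<bar>v n x\<bar> \<le> M + \<bar>L\<bar>" for n x
    using M[of "\<phi> (z n x)"] \<phi>_ball[OF z_ball[of n x]] by (auto simp: v_def max_def)
  have gz_cont: "continuous_on {0..1} (\<lambda>x. g (\<phi> (z n x)))" for n
    by (rule continuous_on_compose2[OF holomorphic_on_imp_continuous_on[OF hol]])
       (use z_ball in \<open>auto simp: z_def intro!: continuous_intros\<close>)
  have v_int: "v n integrable_on {0..1}" for n
    unfolding v_def by (intro integrable_continuous_real continuous_intros gz_cont)
  have mean: "Re (g a) - L \<le> integral {0..1} (v n)" for n
  proof -
    have "((\<lambda>x. g (\<phi> (z n x))) has_integral g a) {0..1}"
      using mean_value_circle[OF hol R[of n]] by (simp add: \<phi>_def z_def)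
    from has_integral_Re[OF this] have "((\<lambda>x. Re (g (\<phi> (z n x))) - L) has_integral Re (g a) - L) {0..1}"
      using has_integral_diff[OF _ has_integral_const_real[of L 0 1]] by fastforce
    then show ?thesis by (rule has_integral_le[OF _ integrable_integral[OF v_int]]) (simp add: v_def)
  qed
  define N where "N = {x \<in> {0..<1::real}. \<phi> (cis (2 * pi * x)) \<in> S} \<union> {1}"
  have "inj_on (\<lambda>x. \<phi> (cis (2 * pi * x))) {x \<in> {0..<1}. \<phi> (cis (2 * pi * x)) \<in> S}"
  proof (rule inj_onI)
    fix x y :: real
    assume xy: "x \<in> {x \<in> {0..<1}. \<phi> (cis (2 * pi * x)) \<in> S}" "y \<in> {x \<in> {0..<1}. \<phi> (cis (2 * pi * x)) \<in> S}"
      and "\<phi> (cis (2 * pi * x)) = \<phi> (cis (2 * pi * y))"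
    then have "cis (2 * pi * x) = cis (2 * pi * y)" using \<phi>_inj[of "cis (2 * pi * x)" "cis (2 * pi * y)"] by simp
    then have "sin (2 * pi * x) = sin (2 * pi * y) \<and> cos (2 * pi * x) = cos (2 * pi * y)" by (simp add: complex_eq_iff)
    then obtain n :: int where "2 * pi * x = 2 * pi * y + 2 * pi * n" unfolding sin_cos_eq_iff by auto
    then have "2 * pi * x = 2 * pi * (y + n)" by (simp add: algebra_simps)
    then have n: "x = y + n" by simp
    then have "\<bar>real_of_int n\<bar> < 1" using xy by auto
    then have "n = 0" by linarith
    then show "x = y" using n by simp
  qed
  moreover have "countable ((\<lambda>x. \<phi> (cis (2 * pi * x))) ` {x \<in> {0..<1}. \<phi> (cis (2 * pi * x)) \<in> S})"
    by (rule countable_subset[OF _ S]) auto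
  ultimately have "countable N" unfolding N_def by (auto dest: countable_image_inj_on)
  then have N: "negligible N" using negligible_countable_Union[of "(\<lambda>x. {x}) ` N"] by auto
  have v_lim: "(\<lambda>n. v n x) \<longlonglongrightarrow> 0" if x: "x \<in> {0..1} - N" for x
  proof -
    let ?\<zeta> = "\<phi> (cis (2 * pi * x))"
    have "?\<zeta> \<notin> S" using x by (auto simp: N_def)
    moreover have \<zeta>: "cmod ?\<zeta> = 1" by (rule \<phi>_sphere) simp
    ultimately obtain l where l: "l \<le> L" "((\<lambda>z. Re (g z)) \<longlongrightarrow> l) (at ?\<zeta> within ball 0 1)"
      using lim by blast
    have "(\<lambda>n. z n x) \<longlonglongrightarrow> of_real 1 * cis (2 * pi * x)" unfolding z_def by (intro tendsto_intros R_lim)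
    then have "(\<lambda>n. \<phi> (z n x)) \<longlonglongrightarrow> ?\<zeta>"
      by (intro continuous_on_tendsto_compose[OF \<phi>_cont]) (use z_ball in \<open>auto intro!: always_eventually less_imp_le\<close>)
    moreover have "\<phi> (z n x) \<noteq> ?\<zeta>" for n using \<phi>_ball[OF z_ball[of n x]] \<zeta> by (metis less_irrefl)
    then have "eventually (\<lambda>n. \<phi> (z n x) \<in> ball 0 1 \<and> \<phi> (z n x) \<noteq> ?\<zeta>) sequentially"
      using \<phi>_ball[OF z_ball] by (intro always_eventually) simp
    ultimately have "filterlim (\<lambda>n. \<phi> (z n x)) (at ?\<zeta> within ball 0 1) sequentially"
      unfolding filterlim_at by blast
    from filterlim_compose[OF l(2) this] have "(\<lambda>n. max (Re (g (\<phi> (z n x))) - L) 0) \<longlonglongrightarrow> max (l - L) 0"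
      by (intro tendsto_intros)
    then show ?thesis using l(1) by (simp add: v_def max_def)
  qed
  define u where "u n x = (if x \<in> N then 0 else v n x)" for n x
  have u_int: "u n integrable_on {0..1}" for n
    by (rule integrable_spike[OF v_int N]) (simp add: u_def)
  have "(\<lambda>n. integral {0..1} (u n)) \<longlonglongrightarrow> integral {0..1} (\<lambda>x::real. 0::real)"
  proof (rule dominated_convergence(2))
    show "u n integrable_on {0..1}" for n by (rule u_int)
    show "(\<lambda>x. M + \<bar>L\<bar>) integrable_on {0..1::real}" by (rule integrable_const_ivl)
    show "norm (u n x) \<le> M + \<bar>L\<bar>" for n x
      using v_bound[of n x] by (auto simp: u_def)
    show "(\<lambda>n. u n x) \<longlonglongrightarrow> 0" if "x \<in> {0..1}" for x
      using v_lim[of x] that by (cases "x \<in> N") (simp_all add: u_def)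
  qed
  moreover have "integral {0..1} (u n) = integral {0..1} (v n)" for n
    by (rule integral_spike[OF N]) (simp add: u_def)
  ultimately have "(\<lambda>n. integral {0..1} (v n)) \<longlonglongrightarrow> 0" by simp
  then have "Re (g a) - L \<le> 0" by (rule LIMSEQ_le_const) (use mean in auto)
  then show ?thesis by simp
qed

section \<open>Length of image circles and boundary values\<close>

text \<open>The length of a polygon inscribed in the image circle is the value at \<open>r\<close> of a bounded harmonic function
built from rotated copies of \<open>f\<close> and the directions of the edges. Its boundary values are bounded by
lengths of polygons inscribed in the boundary curve, because \<open>X\<close> keeps the vertices in cyclic order.\<close>

lemma boundary_values_length_bound:
  fixes f :: "complex \<Rightarrow> real ^ 'n"
  assumes harm: "harmonic_map_on f (ball 0 1)" and bdd: "bounded (f ` ball 0 1)"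
    and E: "countable E"
    and lim: "\<And>t. t \<notin> E \<Longrightarrow> (f \<longlongrightarrow> \<psi> (X t)) (at (cis t) within ball 0 1)"
    and \<psi>: "\<And>t. \<psi> (t + 2 * pi) = \<psi> t"
    and X: "mono X" "\<And>t. X (t + 2 * pi) = X t + 2 * pi"
    and r: "0 < r" "r < 1"
  shows "curve_length 0 (2 * pi) (circle_image f r) \<le> curve_length 0 (2 * pi) \<psi>"
proof (cases "curve_length 0 (2 * pi) \<psi> = top")
  case False
  then obtain L where L: "0 \<le> L" "curve_length 0 (2 * pi) \<psi> = ennreal L"
    by (cases "curve_length 0 (2 * pi) \<psi>") auto
  obtain g where g: "\<And>j. g j holomorphic_on ball 0 1" "\<And>j z. z \<in> ball 0 1 \<Longrightarrow> f z $ j = Re (g j z)"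
    using harmonic_map_on_imp_Re_holomorphic[OF harm convex_ball] by metis
  obtain B where B: "\<And>z. z \<in> ball 0 1 \<Longrightarrow> norm (f z) \<le> B" using bdd unfolding bounded_iff by blast
  show ?thesis unfolding L(2)
  proof (rule curve_length_le)
    fix n and t :: "nat \<Rightarrow> real" assume t: "t 0 = 0" "t n = 2 * pi" "mono_on {..n} t"
    define c where "c i = sgn (f (rcis r (t (Suc i))) - f (rcis r (t i)))" for i
    have c: "norm (c i) \<le> 1" for i by (simp add: c_def norm_sgn)
    define G where "G z = (\<Sum>i<n. \<Sum>j\<in>UNIV. of_real (c i $ j) * (g j (z * cis (t (Suc i))) - g j (z * cis (t i))))" for z
    have rot: "z * cis s \<in> ball 0 1" if "z \<in> ball 0 1" for z s using that by (simp add: norm_mult)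
    have G: "Re (G z) = (\<Sum>i<n. c i \<bullet> (f (z * cis (t (Suc i))) - f (z * cis (t i))))" if "z \<in> ball 0 1" for z
      using rot[OF that] g(2) unfolding G_def by (simp add: inner_vec_def)
    have rot_hol: "(\<lambda>z. g j (z * cis s)) holomorphic_on ball 0 1" for j s
      by (rule holomorphic_on_compose_gen[OF _ g(1), unfolded o_def]) (use rot in \<open>auto intro!: holomorphic_intros\<close>)
    define S where "S = cis ` (\<Union>i\<le>n. (\<lambda>e. e - t i) ` E)"
    have "Re (G (of_real r)) \<le> L"
    proof (rule Re_holomorphic_le_of_boundary_limits[where g = G and S = S and M = "\<Sum>i<n. 2 * B"])
      show "G holomorphic_on ball 0 1" unfolding G_def by (intro holomorphic_intros rot_hol)
      show "\<bar>Re (G z)\<bar> \<le> (\<Sum>i<n. 2 * B)" if z: "z \<in> ball 0 1" for z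
      proof -
        have "\<bar>c i \<bullet> (f (z * cis (t (Suc i))) - f (z * cis (t i)))\<bar> \<le> 2 * B" for i
        proof -
          have "\<bar>c i \<bullet> (f (z * cis (t (Suc i))) - f (z * cis (t i)))\<bar>
              \<le> norm (c i) * norm (f (z * cis (t (Suc i))) - f (z * cis (t i)))" by (rule Cauchy_Schwarz_ineq2)
          also have "\<dots> \<le> 1 * (norm (f (z * cis (t (Suc i)))) + norm (f (z * cis (t i))))"
            using c[of i] by (intro mult_mono norm_triangle_ineq4) auto
          also have "\<dots> \<le> 2 * B" using B[OF rot[OF z], of "t (Suc i)"] B[OF rot[OF z], of "t i"] by simp
          finally show ?thesis .
        qed
        then show ?thesis unfolding G[OF z] by (intro order_trans[OF sum_abs] sum_mono) auto
      qed
      show "countable S" unfolding S_def using E by auto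
      show "\<exists>l\<le>L. ((\<lambda>z. Re (G z)) \<longlongrightarrow> l) (at \<zeta> within ball 0 1)" if \<zeta>: "cmod \<zeta> = 1" "\<zeta> \<notin> S" for \<zeta>
      proof -
        obtain s where s: "\<zeta> = cis s" using rcis_cmod_Arg[of \<zeta>] \<zeta>(1) by (auto simp: rcis_def intro: that[of "Arg \<zeta>"])
        have notE: "s + t i \<notin> E" if "i \<le> n" for i
          using \<zeta>(2) that unfolding s S_def by (force simp: image_iff)
        have flim: "((\<lambda>z. f (z * cis (t i))) \<longlongrightarrow> \<psi> (X (s + t i))) (at \<zeta> within ball 0 1)" if "i \<le> n" for i
        proof (rule filterlim_compose[OF lim[OF notE[OF that]]])
          have "((\<lambda>z. z * cis (t i)) \<longlongrightarrow> \<zeta> * cis (t i)) (at \<zeta> within ball 0 1)" by (intro tendsto_intros)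
          also have "\<zeta> * cis (t i) = cis (s + t i)" by (simp add: s cis_mult)
          finally have "((\<lambda>z. z * cis (t i)) \<longlongrightarrow> cis (s + t i)) (at \<zeta> within ball 0 1)" .
          moreover have "z * cis (t i) \<noteq> cis (s + t i)" if "z \<in> ball 0 1" for z
            using rot[OF that, of "t i"] by auto
          then have "eventually (\<lambda>z. z * cis (t i) \<in> ball 0 1 \<and> z * cis (t i) \<noteq> cis (s + t i)) (at \<zeta> within ball 0 1)"
            unfolding eventually_at using rot by (intro exI[of _ 1] conjI ballI impI zero_less_one; blast)
          ultimately show "filterlim (\<lambda>z. z * cis (t i)) (at (cis (s + t i)) within ball 0 1) (at \<zeta> within ball 0 1)"
            unfolding filterlim_at by blast
        qed
        define p where "p i = X (s + t i)" for i
        define l where "l = (\<Sum>i<n. c i \<bullet> (\<psi> (p (Suc i)) - \<psi> (p i)))"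
        have "((\<lambda>z. \<Sum>i<n. c i \<bullet> (f (z * cis (t (Suc i))) - f (z * cis (t i)))) \<longlongrightarrow> l) (at \<zeta> within ball 0 1)"
          unfolding l_def p_def by (intro tendsto_intros flim) auto
        moreover have "eventually (\<lambda>z. (\<Sum>i<n. c i \<bullet> (f (z * cis (t (Suc i))) - f (z * cis (t i)))) = Re (G z)) (at \<zeta> within ball 0 1)"
          unfolding eventually_at using G by (intro exI[of _ 1]) auto
        ultimately have "((\<lambda>z. Re (G z)) \<longlongrightarrow> l) (at \<zeta> within ball 0 1)" by (rule Lim_transform_eventually)
        moreover have "l \<le> L"
        proof -
          have "mono_on {..n} p" using t(3) X(1) by (auto simp: p_def monotone_on_def)
          from polygon_le_curve_length[OF this, of \<psi>]
          have "(\<Sum>i<n. ennreal (dist (\<psi> (p i)) (\<psi> (p (Suc i))))) \<le> curve_length (X s) (X s + 2 * pi) \<psi>"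
            using t X(2)[of s] by (simp add: p_def)
          also have "\<dots> \<le> curve_length 0 (2 * pi) \<psi>" by (rule curve_length_periodic_shift_le[where \<gamma> = \<psi>, OF \<psi>]) simp
          finally have "(\<Sum>i<n. dist (\<psi> (p i)) (\<psi> (p (Suc i)))) \<le> L" using L by (simp add: sum_ennreal)
          moreover have "c i \<bullet> (\<psi> (p (Suc i)) - \<psi> (p i)) \<le> dist (\<psi> (p i)) (\<psi> (p (Suc i)))" for i
          proof -
            have "c i \<bullet> (\<psi> (p (Suc i)) - \<psi> (p i)) \<le> norm (c i) * norm (\<psi> (p (Suc i)) - \<psi> (p i))"
              by (rule norm_cauchy_schwarz)
            also have "\<dots> \<le> 1 * norm (\<psi> (p (Suc i)) - \<psi> (p i))" using c by (intro mult_right_mono) auto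
            finally show ?thesis by (simp add: dist_norm norm_minus_commute)
          qed
          then have "l \<le> (\<Sum>i<n. dist (\<psi> (p i)) (\<psi> (p (Suc i))))" unfolding l_def by (intro sum_mono) blast
          ultimately show ?thesis by linarith
        qed
        ultimately show ?thesis by blast
      qed
      show "cmod (of_real r) < 1" using r by simp
    qed
    moreover have "Re (G (of_real r)) = (\<Sum>i<n. dist (circle_image f r (t i)) (circle_image f r (t (Suc i))))"
    proof -
      have "c i \<bullet> (f (rcis r (t (Suc i))) - f (rcis r (t i))) = dist (circle_image f r (t i)) (circle_image f r (t (Suc i)))" for i
      proof -
        have "sgn v \<bullet> v = norm v" for v :: "real ^ 'n"
          by (cases "v = 0") (simp_all add: sgn_div_norm dot_square_norm power2_eq_square)
        then show ?thesis by (simp add: c_def circle_image_def dist_norm norm_minus_commute)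
      qed
      then show ?thesis using G[of "of_real r"] r by (simp add: rcis_def)
    qed
    ultimately have "(\<Sum>i<n. dist (circle_image f r (t i)) (circle_image f r (t (Suc i)))) \<le> L" by simp
    then have "ennreal (\<Sum>i<n. dist (circle_image f r (t i)) (circle_image f r (t (Suc i)))) \<le> ennreal L"
      by (rule ennreal_leI)
    then show "(\<Sum>i<n. ennreal (dist (circle_image f r (t i)) (circle_image f r (t (Suc i))))) \<le> ennreal L"
      by (subst sum_ennreal) auto
  qed
qed simp

section \<open>Disk homeomorphisms in logarithmic coordinates\<close>

lemma period_int_multiple:
  fixes f :: "complex \<Rightarrow> complex"
  assumes per: "\<And>w. w \<in> S \<Longrightarrow> f (w + p) = f w + q" and S: "\<And>w n::int. w \<in> S \<Longrightarrow> w + of_int n * p \<in> S"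
    and "w \<in> S"
  shows "f (w + of_int n * p) = f w + of_int n * q"
proof -
  have nat: "f (w + of_nat m * p) = f w + of_nat m * q" if "w \<in> S" for w m
  proof (induction m)
    case (Suc m)
    have "w + of_nat m * p \<in> S" using S[OF that, of "int m"] by simp
    from per[OF this] show ?case using Suc by (simp add: algebra_simps)
  qed simp
  show ?thesis
  proof (cases n rule: int_cases2)
    case (nonneg m)
    then show ?thesis using nat[OF \<open>w \<in> S\<close>, of m] by simp
  next
    case (nonpos m)
    then show ?thesis using nat[OF S[OF \<open>w \<in> S\<close>, of n], of m] by simp
  qed
qed

text \<open>A disk homeomorphism \<open>F\<close>, normalized to turn in the positive direction, in the coordinate \<open>w\<close> with
\<open>z = exp w\<close>: a map \<open>h\<close> with \<open>exp (h w) = F (exp w)\<close>. Only a neighbourhood of the circle is used, so that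
logarithms exist: \<open>h\<close> lives on the half-strip from \<open>a\<close> to \<open>0\<close>. The lift \<open>k\<close> of the inverse of \<open>F\<close> lives on a
possibly thinner half-strip, starting at \<open>b\<close>, which it maps into the domain
of \<open>h\<close>. The real part is the logarithm of the modulus, the imaginary part is the angle. The last two assumptions say that \<open>F\<close> and its inverse are
proper.\<close>

locale annulus_lift =
  fixes a b :: real and h k :: "complex \<Rightarrow> complex"
  assumes neg: "a < 0" "b < 0"
    and h_cont: "continuous_on {w. a \<le> Re w \<and> Re w < 0} h"
    and k_cont: "continuous_on {v. b \<le> Re v \<and> Re v < 0} k"
    and h_neg: "\<And>w. a \<le> Re w \<Longrightarrow> Re w < 0 \<Longrightarrow> Re (h w) < 0"
    and k_range: "\<And>v. b \<le> Re v \<Longrightarrow> Re v < 0 \<Longrightarrow> a \<le> Re (k v) \<and> Re (k v) < 0"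
    and h_k: "\<And>v. b \<le> Re v \<Longrightarrow> Re v < 0 \<Longrightarrow> h (k v) = v"
    and k_h: "\<And>w. a \<le> Re w \<Longrightarrow> Re w < 0 \<Longrightarrow> b \<le> Re (h w) \<Longrightarrow> k (h w) = w"
    and h_period: "\<And>w. a \<le> Re w \<Longrightarrow> Re w < 0 \<Longrightarrow> h (w + 2 * pi * \<i>) = h w + 2 * pi * \<i>"
    and h_proper: "\<And>c. c < 0 \<Longrightarrow> \<exists>a'\<in>{a..<0}. \<forall>w. a' \<le> Re w \<and> Re w < 0 \<longrightarrow> c < Re (h w)"
    and k_proper: "\<And>c. c < 0 \<Longrightarrow> \<exists>b'\<in>{b..<0}. \<forall>v. b' \<le> Re v \<and> Re v < 0 \<longrightarrow> c < Re (k v)"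
begin

lemma h_period_int:
  assumes "a \<le> Re w" "Re w < 0"
  shows "h (w + 2 * pi * of_int n * \<i>) = h w + 2 * pi * of_int n * \<i>"
proof -
  have "h (w + of_int n * (2 * pi * \<i>)) = h w + of_int n * (2 * pi * \<i>)"
    by (rule period_int_multiple[where S = "{w. a \<le> Re w \<and> Re w < 0}"]) (use h_period assms in auto)
  then show ?thesis by (simp add: mult_ac)
qed

lemma k_period_int:
  assumes "b \<le> Re v" "Re v < 0"
  shows "k (v + 2 * pi * of_int n * \<i>) = k v + 2 * pi * of_int n * \<i>"
proof -
  let ?w = "k v + 2 * pi * of_int n * \<i>"
  have w: "a \<le> Re ?w" "Re ?w < 0" using k_range[OF assms] by auto
  have "h ?w = v + 2 * pi * of_int n * \<i>"
    using h_period_int[of "k v" n] k_range[OF assms] h_k[OF assms] by simp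
  then show ?thesis using k_h[OF w] assms by simp
qed

lemma h_angle_cont:
  assumes "a \<le> r" "r < 0"
  shows "continuous_on S (\<lambda>s. Im (h (Complex r s)))"
proof -
  have "continuous_on S (\<lambda>s. h (Complex r s))"
    by (rule continuous_on_compose2[OF h_cont]) (use assms in \<open>auto intro!: continuous_intros simp: Complex_eq\<close>)
  then show ?thesis by (intro continuous_intros)
qed

lemma k_angle_cont:
  assumes "S \<subseteq> {b..<0}"
  shows "continuous_on S (\<lambda>\<rho>. Im (k (Complex \<rho> x)))"
proof -
  have "continuous_on S (\<lambda>\<rho>. k (Complex \<rho> x))"
    by (rule continuous_on_compose2[OF k_cont]) (use assms in \<open>auto intro!: continuous_intros simp: Complex_eq\<close>)
  then show ?thesis by (intro continuous_intros)
qed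

lemma h_angle_shift:
  assumes "a \<le> r" "r < 0"
  shows "Im (h (Complex r (s + 2 * pi * of_int n))) = Im (h (Complex r s)) + 2 * pi * of_int n"
proof -
  have "Complex r (s + 2 * pi * of_int n) = Complex r s + 2 * pi * of_int n * \<i>" by (simp add: complex_eq_iff)
  then show ?thesis using h_period_int[of "Complex r s" n] assms by simp
qed

lemma h_angle_surj:
  assumes r: "a \<le> r" "r < 0" and "Im (h (Complex r s)) \<le> x"
  obtains s' where "s \<le> s'" "Im (h (Complex r s')) = x"
proof -
  define n where "n = \<lceil>(x - Im (h (Complex r s))) / (2 * pi)\<rceil>"
  have "0 \<le> (x - Im (h (Complex r s))) / (2 * pi)" using assms by simp
  then have n0: "0 \<le> n" unfolding n_def by linarith
  have "(x - Im (h (Complex r s))) / (2 * pi) \<le> of_int n" unfolding n_def by simp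
  then have n: "x \<le> Im (h (Complex r s)) + 2 * pi * of_int n" by (simp add: field_simps)
  have "\<exists>s'\<ge>s. s' \<le> s + 2 * pi * of_int n \<and> Im (h (Complex r s')) = x"
    by (rule IVT') (use assms n n0 h_angle_shift[OF r] h_angle_cont[OF r] in auto)
  then show thesis using that by blast
qed

text \<open>The curve \<open>\<rho> \<mapsto> k (Complex \<rho> x)\<close> is the preimage of the radius at angle \<open>x\<close>; its end is at \<open>\<rho> \<rightarrow> 0\<close>. Up to
the boundary case, \<open>upper x T\<close> and \<open>lower x T\<close> say that the upper limit of the angle along it is at most \<open>T\<close>, and the lower
limit at least \<open>T\<close>. Both limits may be infinite a priori; bounds that hold eventually avoid extended reals.\<close>

definition upper :: "real \<Rightarrow> real \<Rightarrow> bool" where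
  "upper x T \<longleftrightarrow> (\<exists>\<rho>\<^sub>1\<in>{b..<0}. \<forall>\<rho>\<in>{\<rho>\<^sub>1..<0}. Im (k (Complex \<rho> x)) \<le> T)"

definition lower :: "real \<Rightarrow> real \<Rightarrow> bool" where
  "lower x T \<longleftrightarrow> (\<exists>\<rho>\<^sub>1\<in>{b..<0}. \<forall>\<rho>\<in>{\<rho>\<^sub>1..<0}. T \<le> Im (k (Complex \<rho> x)))"

text \<open>Arbitrarily close to the circle, the preimage of the radius at angle \<open>x\<close> connects the two sides of the sector
between the angles \<open>c\<close> and \<open>d\<close>. Sectors are taken in the disk, hence the multiples of \<open>2 \<pi>\<close>: a preimage that
spirals to infinity crosses every sector, too.\<close>

definition crosses :: "real \<Rightarrow> real \<Rightarrow> real \<Rightarrow> bool" where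
  "crosses x c d \<longleftrightarrow> (\<forall>\<rho>\<^sub>1\<in>{b..<0}. \<exists>\<rho>\<^sub>2\<in>{\<rho>\<^sub>1..<0}. \<exists>\<rho>\<^sub>3\<in>{\<rho>\<^sub>1..<0}. \<exists>n::int.
     Im (k (Complex \<rho>\<^sub>2 x)) = c + 2 * pi * of_int n \<and> Im (k (Complex \<rho>\<^sub>3 x)) = d + 2 * pi * of_int n)"

text \<open>If the angle of \<open>h\<close> at \<open>w\<close> were at most \<open>x\<close>, then, moving from \<open>w\<close> along the vertical line in the direction of
increasing angle, \<open>h\<close> would reach the angle \<open>x\<close>. That happens on the preimage of the radius at angle \<open>x\<close>,
which near its end does not rise above the height \<open>T\<close>.\<close>

lemma upper_imp_angle_gt:
  assumes "upper x T"
  shows "\<exists>a'\<in>{a..<0}. \<forall>w. a' \<le> Re w \<and> Re w < 0 \<and> T < Im w \<longrightarrow> x < Im (h w)"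
proof -
  obtain \<rho> where \<rho>: "\<rho> \<in> {b..<0}" and up: "\<And>\<rho>'. \<rho> \<le> \<rho>' \<Longrightarrow> \<rho>' < 0 \<Longrightarrow> Im (k (Complex \<rho>' x)) \<le> T"
    using assms unfolding upper_def by auto
  obtain a' where a': "a' \<in> {a..<0}" and high: "\<And>w. a' \<le> Re w \<Longrightarrow> Re w < 0 \<Longrightarrow> \<rho> < Re (h w)"
    using h_proper[of \<rho>] \<rho> by auto
  have "x < Im (h w)" if w: "a' \<le> Re w" "Re w < 0" "T < Im w" for w
  proof (rule ccontr)
    assume "\<not> x < Im (h w)"
    moreover have r: "a \<le> Re w" "Re w < 0" using w a' by auto
    ultimately obtain s where s: "Im w \<le> s" "Im (h (Complex (Re w) s)) = x"
      using h_angle_surj[OF r, of "Im w" x] by auto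
    let ?u = "Complex (Re w) s"
    have u: "\<rho> < Re (h ?u)" "Re (h ?u) < 0" using high[of ?u] h_neg[of ?u] w r by auto
    have "Complex (Re (h ?u)) x = h ?u" using s by (simp add: complex_eq_iff)
    then have "k (Complex (Re (h ?u)) x) = ?u" using k_h[of ?u] u r \<rho> by auto
    then have "s \<le> T" using up[of "Re (h ?u)"] u by simp
    then show False using s w by simp
  qed
  then show ?thesis using a' by blast
qed

lemma upper_antimono:
  assumes "upper y T" "x \<le> y"
  shows "upper x T"
proof -
  obtain a' where a': "a' \<in> {a..<0}"
    and gt: "\<And>w. a' \<le> Re w \<Longrightarrow> Re w < 0 \<Longrightarrow> T < Im w \<Longrightarrow> y < Im (h w)"
    using upper_imp_angle_gt[OF assms(1)] by blast
  obtain b' where b': "b' \<in> {b..<0}" and near: "\<And>v. b' \<le> Re v \<Longrightarrow> Re v < 0 \<Longrightarrow> a' < Re (k v)"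
    using k_proper[of a'] a' by auto
  have "Im (k (Complex \<rho> x)) \<le> T" if "\<rho> \<in> {b'..<0}" for \<rho>
  proof (rule ccontr)
    assume "\<not> Im (k (Complex \<rho> x)) \<le> T"
    then have "y < Im (h (k (Complex \<rho> x)))"
      using gt[of "k (Complex \<rho> x)"] near[of "Complex \<rho> x"] k_range[of "Complex \<rho> x"] that b' by auto
    then show False using h_k[of "Complex \<rho> x"] that b' assms(2) by auto
  qed
  then show ?thesis unfolding upper_def using b' by blast
qed

lemma upper_mono: "upper x T \<Longrightarrow> T \<le> T' \<Longrightarrow> upper x T'"
  unfolding upper_def by (meson order_trans)

text \<open>Complex conjugation reverses the order of angles, so that facts about \<open>lower\<close> are facts about \<open>upper\<close> for the
conjugate lift.\<close>

lemma annulus_lift_cnj: "annulus_lift a b (\<lambda>w. cnj (h (cnj w))) (\<lambda>v. cnj (k (cnj v)))"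
proof
  show "a < 0" "b < 0" by (rule neg)+
  show "continuous_on {w. a \<le> Re w \<and> Re w < 0} (\<lambda>w. cnj (h (cnj w)))"
    by (intro continuous_intros continuous_on_compose2[OF h_cont]) auto
  show "continuous_on {w. b \<le> Re w \<and> Re w < 0} (\<lambda>w. cnj (k (cnj w)))"
    by (intro continuous_intros continuous_on_compose2[OF k_cont]) auto
  show "cnj (h (cnj (w + 2 * pi * \<i>))) = cnj (h (cnj w)) + 2 * pi * \<i>" if "a \<le> Re w" "Re w < 0" for w
    using h_period_int[of "cnj w" "-1"] that by (simp add: complex_eq_iff)
  show "\<exists>a'\<in>{a..<0}. \<forall>w. a' \<le> Re w \<and> Re w < 0 \<longrightarrow> c < Re (cnj (h (cnj w)))" if "c < 0" for c
    using h_proper[OF that] by (metis complex_cnj(1) cnj.sel(1))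
  show "\<exists>a'\<in>{b..<0}. \<forall>w. a' \<le> Re w \<and> Re w < 0 \<longrightarrow> c < Re (cnj (k (cnj w)))" if "c < 0" for c
    using k_proper[OF that] by (metis complex_cnj(1) cnj.sel(1))
qed (use h_neg k_range h_k k_h in auto)

lemma upper_cnj_iff: "annulus_lift.upper b (\<lambda>v. cnj (k (cnj v))) (- x) (- T) \<longleftrightarrow> lower x T"
proof -
  have "cnj (Complex \<rho> (- x)) = Complex \<rho> x" for \<rho> by (simp add: complex_eq_iff)
  then show ?thesis unfolding annulus_lift.upper_def[OF annulus_lift_cnj] lower_def by simp
qed

lemma lower_imp_angle_lt:
  assumes "lower x T"
  shows "\<exists>a'\<in>{a..<0}. \<forall>w. a' \<le> Re w \<and> Re w < 0 \<and> Im w < T \<longrightarrow> Im (h w) < x"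
proof -
  obtain a' where "a' \<in> {a..<0}"
    and "\<And>w. a' \<le> Re w \<Longrightarrow> Re w < 0 \<Longrightarrow> - T < Im w \<Longrightarrow> - x < Im (cnj (h (cnj w)))"
    using annulus_lift.upper_imp_angle_gt[OF annulus_lift_cnj, of "- x" "- T"] assms upper_cnj_iff by blast
  from this(1) this(2)[of "cnj _"] show ?thesis by (intro bexI[of _ a']) auto
qed

lemma lower_mono:
  assumes "lower x T" "x \<le> y"
  shows "lower y T"
  using annulus_lift.upper_antimono[OF annulus_lift_cnj, of "- x" "- T" "- y"] assms upper_cnj_iff by auto

lemma k_angle_shift:
  assumes "b \<le> \<rho>" "\<rho> < 0"
  shows "Im (k (Complex \<rho> (x + 2 * pi * of_int n))) = Im (k (Complex \<rho> x)) + 2 * pi * of_int n"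
proof -
  have "Complex \<rho> (x + 2 * pi * of_int n) = Complex \<rho> x + 2 * pi * of_int n * \<i>" by (simp add: complex_eq_iff)
  then show ?thesis using k_period_int[of "Complex \<rho> x" n] assms by simp
qed

lemma upper_shift: "upper x T \<Longrightarrow> upper (x + 2 * pi * of_int n) (T + 2 * pi * of_int n)"
  unfolding upper_def by (force simp: k_angle_shift)

lemma lower_shift: "lower x T \<Longrightarrow> lower (x + 2 * pi * of_int n) (T + 2 * pi * of_int n)"
  unfolding lower_def by (force simp: k_angle_shift)

lemma lower_upper_le:
  assumes "lower x T" "upper x T'"
  shows "T \<le> T'"
proof -
  obtain \<rho> \<rho>' where "\<rho> \<in> {b..<0}" "\<rho>' \<in> {b..<0}" and
    *: "\<forall>r\<in>{\<rho>..<0}. T \<le> Im (k (Complex r x))" "\<forall>r\<in>{\<rho>'..<0}. Im (k (Complex r x)) \<le> T'"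
    using assms unfolding lower_def upper_def by auto
  then have "max \<rho> \<rho>' \<in> {\<rho>..<0}" "max \<rho> \<rho>' \<in> {\<rho>'..<0}" by auto
  then show ?thesis using * by (meson order_trans)
qed

lemma k_angle_crossing:
  assumes "\<rho>\<^sub>2 \<in> {b..<0}" "\<rho>\<^sub>3 \<in> {b..<0}"
    and "Im (k (Complex \<rho>\<^sub>2 x)) \<le> c" "c \<le> Im (k (Complex \<rho>\<^sub>3 x))"
  obtains \<rho> where "\<rho> \<in> {min \<rho>\<^sub>2 \<rho>\<^sub>3..max \<rho>\<^sub>2 \<rho>\<^sub>3}" "Im (k (Complex \<rho> x)) = c"
proof -
  have "connected ((\<lambda>\<rho>. Im (k (Complex \<rho> x))) ` {min \<rho>\<^sub>2 \<rho>\<^sub>3..max \<rho>\<^sub>2 \<rho>\<^sub>3})"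
    by (rule connected_continuous_image[OF k_angle_cont]) (use assms in auto)
  from connectedD_interval[OF this _ _ assms(3,4)]
  have "c \<in> (\<lambda>\<rho>. Im (k (Complex \<rho> x))) ` {min \<rho>\<^sub>2 \<rho>\<^sub>3..max \<rho>\<^sub>2 \<rho>\<^sub>3}" by auto
  then show thesis using that by blast
qed

lemma crossesI:
  assumes "c < d"
    and "\<And>\<rho>. \<rho> \<in> {b..<0} \<Longrightarrow> \<exists>\<rho>\<^sub>2\<in>{\<rho>..<0}. \<exists>\<rho>\<^sub>3\<in>{\<rho>..<0}. \<exists>n::int.
      Im (k (Complex \<rho>\<^sub>2 x)) \<le> c + 2 * pi * of_int n \<and> d + 2 * pi * of_int n \<le> Im (k (Complex \<rho>\<^sub>3 x))"
  shows "crosses x c d"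
  unfolding crosses_def
proof
  fix \<rho> assume \<rho>: "\<rho> \<in> {b..<0}"
  obtain \<rho>\<^sub>2 \<rho>\<^sub>3 and n :: int where *: "\<rho>\<^sub>2 \<in> {\<rho>..<0}" "\<rho>\<^sub>3 \<in> {\<rho>..<0}"
    "Im (k (Complex \<rho>\<^sub>2 x)) \<le> c + 2 * pi * of_int n" "d + 2 * pi * of_int n \<le> Im (k (Complex \<rho>\<^sub>3 x))"
    using assms(2)[OF \<rho>] by blast
  have b: "\<rho>\<^sub>2 \<in> {b..<0}" "\<rho>\<^sub>3 \<in> {b..<0}" using *(1,2) \<rho> by auto
  obtain \<sigma> where "\<sigma> \<in> {min \<rho>\<^sub>2 \<rho>\<^sub>3..max \<rho>\<^sub>2 \<rho>\<^sub>3}" "Im (k (Complex \<sigma> x)) = c + 2 * pi * of_int n"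
    by (rule k_angle_crossing[OF b *(3)]) (use *(4) assms(1) in auto)
  moreover obtain \<tau> where "\<tau> \<in> {min \<rho>\<^sub>2 \<rho>\<^sub>3..max \<rho>\<^sub>2 \<rho>\<^sub>3}" "Im (k (Complex \<tau> x)) = d + 2 * pi * of_int n"
    by (rule k_angle_crossing[OF b _ *(4)]) (use *(3) assms(1) in auto)
  moreover have "{min \<rho>\<^sub>2 \<rho>\<^sub>3..max \<rho>\<^sub>2 \<rho>\<^sub>3} \<subseteq> {\<rho>..<0}" using *(1,2) by auto
  ultimately show "\<exists>\<rho>\<^sub>2\<in>{\<rho>..<0}. \<exists>\<rho>\<^sub>3\<in>{\<rho>..<0}. \<exists>n::int.
     Im (k (Complex \<rho>\<^sub>2 x)) = c + 2 * pi * of_int n \<and> Im (k (Complex \<rho>\<^sub>3 x)) = d + 2 * pi * of_int n"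
    by blast
qed

lemma not_upper_not_lower_imp_crosses:
  assumes "c < d" "\<not> upper x d" "\<not> lower x c"
  shows "crosses x c d"
proof (rule crossesI[OF assms(1)])
  fix \<rho> assume \<rho>: "\<rho> \<in> {b..<0}"
  obtain \<rho>\<^sub>2 where "\<rho>\<^sub>2 \<in> {\<rho>..<0}" "Im (k (Complex \<rho>\<^sub>2 x)) < c"
    using assms(3) \<rho> unfolding lower_def by (meson not_le)
  moreover obtain \<rho>\<^sub>3 where "\<rho>\<^sub>3 \<in> {\<rho>..<0}" "d < Im (k (Complex \<rho>\<^sub>3 x))"
    using assms(2) \<rho> unfolding upper_def by (meson not_le)
  ultimately show "\<exists>\<rho>\<^sub>2\<in>{\<rho>..<0}. \<exists>\<rho>\<^sub>3\<in>{\<rho>..<0}. \<exists>n::int.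
      Im (k (Complex \<rho>\<^sub>2 x)) \<le> c + 2 * pi * of_int n \<and> d + 2 * pi * of_int n \<le> Im (k (Complex \<rho>\<^sub>3 x))"
    by (intro bexI[of _ \<rho>\<^sub>2] bexI[of _ \<rho>\<^sub>3] exI[of _ 0]) auto
qed

lemma not_upper_imp_crosses:
  assumes "c < d" "\<And>T. \<not> upper x T"
  shows "crosses x c d"
proof (rule crossesI[OF assms(1)])
  fix \<rho> assume \<rho>: "\<rho> \<in> {b..<0}"
  define n where "n = \<lceil>(Im (k (Complex \<rho> x)) - c) / (2 * pi)\<rceil>"
  have "(Im (k (Complex \<rho> x)) - c) / (2 * pi) \<le> of_int n" by (simp add: n_def)
  then have "Im (k (Complex \<rho> x)) \<le> c + 2 * pi * of_int n" by (simp add: field_simps)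
  moreover obtain \<rho>' where "\<rho>' \<in> {\<rho>..<0}" "d + 2 * pi * of_int n < Im (k (Complex \<rho>' x))"
    using assms(2)[of "d + 2 * pi * of_int n"] \<rho> unfolding upper_def by (meson not_le)
  ultimately show "\<exists>\<rho>\<^sub>2\<in>{\<rho>..<0}. \<exists>\<rho>\<^sub>3\<in>{\<rho>..<0}. \<exists>n::int.
      Im (k (Complex \<rho>\<^sub>2 x)) \<le> c + 2 * pi * of_int n \<and> d + 2 * pi * of_int n \<le> Im (k (Complex \<rho>\<^sub>3 x))"
    using \<rho> by (intro bexI[of _ \<rho>] bexI[of _ \<rho>'] exI[of _ n]) auto
qed

lemma not_lower_imp_crosses:
  assumes "c < d" "\<And>T. \<not> lower x T"
  shows "crosses x c d"
proof (rule crossesI[OF assms(1)])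
  fix \<rho> assume \<rho>: "\<rho> \<in> {b..<0}"
  define n where "n = \<lfloor>(Im (k (Complex \<rho> x)) - d) / (2 * pi)\<rfloor>"
  have "of_int n \<le> (Im (k (Complex \<rho> x)) - d) / (2 * pi)" by (simp add: n_def)
  then have "d + 2 * pi * of_int n \<le> Im (k (Complex \<rho> x))" by (simp add: field_simps)
  moreover obtain \<rho>' where "\<rho>' \<in> {\<rho>..<0}" "Im (k (Complex \<rho>' x)) < c + 2 * pi * of_int n"
    using assms(2)[of "c + 2 * pi * of_int n"] \<rho> unfolding lower_def by (meson not_le)
  ultimately show "\<exists>\<rho>\<^sub>2\<in>{\<rho>..<0}. \<exists>\<rho>\<^sub>3\<in>{\<rho>..<0}. \<exists>n::int.
      Im (k (Complex \<rho>\<^sub>2 x)) \<le> c + 2 * pi * of_int n \<and> d + 2 * pi * of_int n \<le> Im (k (Complex \<rho>\<^sub>3 x))"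
    using \<rho> by (intro bexI[of _ \<rho>] bexI[of _ \<rho>'] exI[of _ n]) auto
qed

end

text \<open>For harmonic \<open>f\<close> the assumption follows from \<open>crosses_both_imp_eq\<close>; the consequences drawn here are purely
topological.\<close>

locale noncrossing_lift = annulus_lift +
  assumes noncrossing: "\<And>x y c d. x < y \<Longrightarrow> y < x + 2 * pi \<Longrightarrow> c < d \<Longrightarrow> d < c + 2 * pi \<Longrightarrow>
    \<not> (crosses x c d \<and> crosses y c d)"
begin

text \<open>If the upper limit of the angle for \<open>x\<close> exceeded the lower limit for a larger \<open>y\<close>, then, by monotonicity of
both limits, the preimages of both radii would cross every interval in between.\<close>

lemma upper_or_lower:
  assumes "x < y" "c < d"
  shows "upper x d \<or> lower y c"
proof (rule ccontr)
  assume neither: "\<not> (upper x d \<or> lower y c)"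
  \<comment> \<open>shrink both intervals below one period, as \<open>noncrossing\<close> requires\<close>
  define z where "z = min y (x + 1)"
  define d' where "d' = min d (c + 1)"
  have z: "x < z" "z \<le> y" "z < x + 2 * pi" and d': "c < d'" "d' \<le> d" "d' < c + 2 * pi"
    using assms pi_gt3 by (auto simp: z_def d'_def)
  have "\<not> upper x d'" "\<not> lower z c"
    using neither upper_mono[of x d' d] lower_mono[of z c y] d' z by auto
  moreover from this have "\<not> upper z d'" "\<not> lower x c"
    using upper_antimono[of z d' x] lower_mono[of x c z] z by auto
  ultimately show False
    using noncrossing[OF z(1,3) d'(1,3)] not_upper_not_lower_imp_crosses[OF d'(1)] by auto
qed

text \<open>Without an upper bound for one \<open>x\<close> there is none for any larger angle either, and then the preimages of two
radii cross all sectors.\<close>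

lemma ex_upper: "\<exists>T. upper x T"
proof (rule ccontr)
  assume no: "\<nexists>T. upper x T"
  have "\<not> upper (x + 1) T" for T using upper_antimono[of "x + 1" T x] no by auto
  then have "crosses (x + 1) 0 1" by (intro not_upper_imp_crosses) auto
  moreover have "crosses x 0 1" using no by (intro not_upper_imp_crosses) auto
  ultimately show False using noncrossing[of x "x + 1" 0 1] pi_gt3 by simp
qed

lemma ex_lower: "\<exists>T. lower x T"
proof (rule ccontr)
  assume no: "\<nexists>T. lower x T"
  have "\<not> lower (x - 1) T" for T using lower_mono[of "x - 1" T x] no by auto
  then have "crosses (x - 1) 0 1" by (intro not_lower_imp_crosses) auto
  moreover have "crosses x 0 1" using no by (intro not_lower_imp_crosses) auto
  ultimately show False using noncrossing[of "x - 1" x 0 1] pi_gt3 by simp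
qed

text \<open>The angle of \<open>F\<close> at the boundary point of angle \<open>t\<close>: the supremum of the \<open>x\<close> for which the preimage of the radius
at angle \<open>x\<close> ends strictly before \<open>t\<close>.\<close>

definition bdry :: "real \<Rightarrow> real" where
  "bdry t = Sup {x. \<exists>T<t. upper x T}"

lemma bdry_set_ne: "{x. \<exists>T<t. upper x T} \<noteq> {}"
proof -
  obtain T where T: "upper 0 T" using ex_upper by blast
  define n where "n = \<lfloor>(t - T) / (2 * pi)\<rfloor> - 1"
  have "of_int n < (t - T) / (2 * pi)" unfolding n_def by linarith
  then have "T + 2 * pi * of_int n < t" by (simp add: field_simps)
  then show ?thesis using upper_shift[OF T, of n] by auto
qed

lemma bdry_set_bdd: "bdd_above {x. \<exists>T<t. upper x T}"
proof -
  obtain T where T: "lower 0 T" using ex_lower by blast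
  define n where "n = \<lceil>(t - T) / (2 * pi)\<rceil>"
  have "(t - T) / (2 * pi) \<le> of_int n" unfolding n_def by linarith
  then have n: "t \<le> T + 2 * pi * of_int n" by (simp add: field_simps)
  have "x \<le> 2 * pi * of_int n" if "T' < t" "upper x T'" for x T'
  proof (rule ccontr)
    assume "\<not> x \<le> 2 * pi * of_int n"
    then have "lower x (T + 2 * pi * of_int n)" using lower_mono[OF lower_shift[OF T, of n], of x] by simp
    from lower_upper_le[OF this that(2)] show False using that n by simp
  qed
  then show ?thesis by (intro bdd_aboveI) auto
qed

lemma bdry_mono: "s \<le> t \<Longrightarrow> bdry s \<le> bdry t"
  unfolding bdry_def by (rule cSup_subset_mono[OF bdry_set_ne bdry_set_bdd]) (auto intro: less_le_trans)

lemma upper_of_less_bdry: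
  assumes "x < bdry t" shows "\<exists>T<t. upper x T"
  using less_cSupD[OF bdry_set_ne, of x t] assms upper_antimono unfolding bdry_def by (auto intro: less_imp_le)

lemma bdry_upper: "upper x T \<Longrightarrow> T < t \<Longrightarrow> x \<le> bdry t"
  unfolding bdry_def by (rule cSup_upper[OF _ bdry_set_bdd]) auto

lemma bdry_shift: "bdry (t + 2 * pi) = bdry t + 2 * pi"
proof (rule antisym)
  show "bdry (t + 2 * pi) \<le> bdry t + 2 * pi"
  proof (rule dense_le)
    fix x assume "x < bdry (t + 2 * pi)"
    then obtain T where "T < t + 2 * pi" "upper x T" using upper_of_less_bdry by blast
    then have "x - 2 * pi \<le> bdry t" using upper_shift[of x T "-1"] by (intro bdry_upper) auto
    then show "x \<le> bdry t + 2 * pi" by simp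
  qed
  have "bdry t \<le> bdry (t + 2 * pi) - 2 * pi"
  proof (rule dense_le)
    fix x assume "x < bdry t"
    then obtain T where "T < t" "upper x T" using upper_of_less_bdry by blast
    then have "x + 2 * pi \<le> bdry (t + 2 * pi)" using upper_shift[of x T 1] by (intro bdry_upper) auto
    then show "x \<le> bdry (t + 2 * pi) - 2 * pi" by simp
  qed
  then show "bdry t + 2 * pi \<le> bdry (t + 2 * pi)" by simp
qed

text \<open>The preimages of the radii at angles above \<open>bdry t\<close> end strictly after \<open>t\<close>. Together with those at angles
below \<open>bdry t\<close>, which end strictly before \<open>t\<close>, they confine the angles of \<open>h\<close> near \<open>\<i> t\<close>.
This fails if preimages for a whole interval of angles end at \<open>t\<close>.\<close>

definition regular :: "real \<Rightarrow> bool" where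
  "regular t \<longleftrightarrow> (\<forall>y>bdry t. \<exists>T>t. lower y T)"

text \<open>For an exceptional \<open>t\<close>, preimages of radii end at \<open>t\<close> for a whole interval of angles. These intervals are
disjoint for different \<open>t\<close>, and each contains a rational number.\<close>

lemma countable_not_regular: "countable {t. \<not> regular t}"
proof -
  have "\<exists>q::rat. bdry t < of_rat q \<and> (\<forall>T>t. \<not> lower (of_rat q) T)" if nr: "\<not> regular t" for t
  proof -
    obtain y where y: "bdry t < y" "\<And>T. T > t \<Longrightarrow> \<not> lower y T"
      using nr unfolding regular_def by blast
    obtain q where q: "bdry t < of_rat q" "of_rat q < y" using of_rat_dense[OF y(1)] by blast
    then show ?thesis using y(2) lower_mono[of "of_rat q" _ y] by (intro exI[of _ q]) auto
  qed
  then obtain q :: "real \<Rightarrow> rat" where q: "\<And>t. \<not> regular t \<Longrightarrow> bdry t < of_rat (q t)"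
    "\<And>t T. \<not> regular t \<Longrightarrow> T > t \<Longrightarrow> \<not> lower (of_rat (q t)) T" by metis
  have sep: "of_rat (q s) < (of_rat (q t) :: real)" if "\<not> regular s" "\<not> regular t" "s < t" for s t
  proof -
    have "of_rat (q s) \<le> bdry t"
    proof (rule dense_le)
      fix x assume x: "x < (of_rat (q s) :: real)"
      define c where "c = s + (t - s) / 3"
      define d where "d = s + (t - s) / 2"
      have cd: "s < c" "c < d" "d < t" using that by (auto simp: c_def d_def field_simps)
      then have "upper x d" using upper_or_lower[OF x cd(2)] q(2)[OF that(1) cd(1)] by auto
      then show "x \<le> bdry t" using cd by (intro bdry_upper) auto
    qed
    then show ?thesis using q(1)[OF that(2)] by simp
  qed
  have "inj_on q {t. \<not> regular t}"
  proof (rule inj_onI)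
    fix s t assume "s \<in> {t. \<not> regular t}" "t \<in> {t. \<not> regular t}" "q s = q t"
    then show "s = t" using sep[of s t] sep[of t s] by (cases s t rule: linorder_cases) auto
  qed
  then show ?thesis by (rule countableI')
qed

lemma regular_angle_limit:
  assumes "regular t" "e > 0"
  shows "\<exists>a'\<in>{a..<0}. \<exists>\<delta>>0. \<forall>w. a' \<le> Re w \<and> Re w < 0 \<and> \<bar>Im w - t\<bar> < \<delta> \<longrightarrow> \<bar>Im (h w) - bdry t\<bar> < e"
proof -
  obtain T where T: "T < t" "upper (bdry t - e) T" using upper_of_less_bdry[of "bdry t - e" t] assms(2) by auto
  obtain T' where T': "t < T'" "lower (bdry t + e) T'"
    using assms unfolding regular_def by (meson less_add_same_cancel1)
  obtain a1 where a1: "a1 \<in> {a..<0}"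
    "\<And>w. a1 \<le> Re w \<Longrightarrow> Re w < 0 \<Longrightarrow> T < Im w \<Longrightarrow> bdry t - e < Im (h w)"
    using upper_imp_angle_gt[OF T(2)] by blast
  obtain a2 where a2: "a2 \<in> {a..<0}"
    "\<And>w. a2 \<le> Re w \<Longrightarrow> Re w < 0 \<Longrightarrow> Im w < T' \<Longrightarrow> Im (h w) < bdry t + e"
    using lower_imp_angle_lt[OF T'(2)] by blast
  show ?thesis
  proof (intro bexI[of _ "max a1 a2"] exI[of _ "min (t - T) (T' - t)"] conjI allI impI)
    fix w assume w: "max a1 a2 \<le> Re w \<and> Re w < 0 \<and> \<bar>Im w - t\<bar> < min (t - T) (T' - t)"
    then have "T < Im w" "Im w < T'" by auto
    then show "\<bar>Im (h w) - bdry t\<bar> < e" using w a1(2)[of w] a2(2)[of w] by auto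
  qed (use T T' a1 a2 in auto)
qed

end

section \<open>Existence of the logarithmic lift\<close>

lemma ball_homeomorphism_proper:
  fixes F G :: "complex \<Rightarrow> complex"
  assumes hom: "homeomorphism (ball 0 1) (ball 0 1) F G" and "c < 1"
  obtains R where "0 < R" "R < 1" "\<And>z. cmod z < 1 \<Longrightarrow> R \<le> cmod z \<Longrightarrow> c < cmod (F z)"
proof -
  let ?c = "max c 0"
  let ?K = "G ` cball 0 ?c"
  have sub: "cball 0 ?c \<subseteq> (ball 0 1 :: complex set)" using \<open>c < 1\<close> by auto
  have "compact ?K"
    using hom sub by (intro compact_continuous_image) (auto simp: homeomorphism_def intro: continuous_on_subset)
  then have "\<exists>x\<in>?K. \<forall>y\<in>?K. cmod y \<le> cmod x"
    by (intro continuous_attains_sup continuous_intros) auto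
  then obtain x where x: "x \<in> ?K" "\<And>y. y \<in> ?K \<Longrightarrow> cmod y \<le> cmod x" by blast
  have "?K \<subseteq> ball 0 1" using homeomorphism_image2[OF hom] sub by blast
  then have "cmod x < 1" using x(1) by auto
  show thesis
  proof
    show "0 < (1 + cmod x) / 2" "(1 + cmod x) / 2 < 1"
      using \<open>cmod x < 1\<close> norm_ge_zero[of x] by (simp_all add: add_pos_nonneg)
    fix z :: complex assume z: "cmod z < 1" "(1 + cmod x) / 2 \<le> cmod z"
    show "c < cmod (F z)"
    proof (rule ccontr)
      assume "\<not> c < cmod (F z)"
      then have "G (F z) \<in> ?K" by auto
      then have "cmod z \<le> cmod x" using x(2) homeomorphism_apply1[OF hom, of z] z(1) by auto
      then show False using z \<open>cmod x < 1\<close> by simp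
    qed
  qed
qed

text \<open>Two continuous logarithms of the same function on a connected set differ by a constant multiple of \<open>2 \<pi> \<i>\<close>.\<close>

lemma exp_eq_1_imp_constant:
  fixes d :: "complex \<Rightarrow> complex"
  assumes "connected S" "continuous_on S d" "\<And>x. x \<in> S \<Longrightarrow> exp (d x) = 1"
  shows "\<exists>n::int. \<forall>x\<in>S. d x = 2 * pi * of_int n * \<i>"
proof (cases "S = {}")
  case False
  then obtain x0 where x0: "x0 \<in> S" by blast
  have int: "\<exists>n::int. d x = 2 * pi * of_int n * \<i>" if "x \<in> S" for x
    using assms(3)[OF that] unfolding exp_eq_1 by (auto simp: complex_eq_iff)
  have "d constant_on S"
  proof (rule continuous_discrete_range_constant[OF assms(1,2)])
    fix x assume x: "x \<in> S"
    have "2 * pi \<le> cmod (d y - d x)" if y: "y \<in> S" "d y \<noteq> d x" for y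
    proof -
      obtain m n :: int where mn: "d x = 2 * pi * of_int m * \<i>" "d y = 2 * pi * of_int n * \<i>"
        using int x y by blast
      then have "d y - d x = complex_of_real (2 * pi * of_int (n - m)) * \<i>" by (simp add: algebra_simps)
      then have "cmod (d y - d x) = \<bar>2 * pi * of_int (n - m)\<bar>"
        by (simp only: norm_mult norm_of_real norm_ii mult_1_right)
      moreover have "1 \<le> \<bar>real_of_int (n - m)\<bar>" using y(2) mn by (cases "n = m") auto
      ultimately show ?thesis by (simp add: abs_mult)
    qed
    then show "\<exists>e>0. \<forall>y. y \<in> S \<and> d y \<noteq> d x \<longrightarrow> e \<le> cmod (d y - d x)"
      by (intro exI[of _ "2 * pi"]) auto
  qed
  then show ?thesis using int[OF x0] x0 unfolding constant_on_def by metis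
qed simp

text \<open>Close to the circle \<open>F\<close> and its inverse omit zero and have continuous logarithms in the coordinate \<open>w\<close>, since
half-strips are contractible. The degrees \<open>m\<close> and \<open>m'\<close> of the two lifts are integers with product \<open>1\<close>.\<close>

lemma ball_homeomorphism_lift_degree:
  fixes F G :: "complex \<Rightarrow> complex"
  assumes hom: "homeomorphism (ball 0 1) (ball 0 1) F G"
  obtains a b h k and m :: int where "a < 0" "b < 0" "m = 1 \<or> m = -1"
    "continuous_on {w. a \<le> Re w \<and> Re w < 0} h" "continuous_on {v. b \<le> Re v \<and> Re v < 0} k"
    "\<And>w. a \<le> Re w \<Longrightarrow> Re w < 0 \<Longrightarrow> exp (h w) = F (exp w)"
    "\<And>w. a \<le> Re w \<Longrightarrow> Re w < 0 \<Longrightarrow> Re (h w) < 0"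
    "\<And>v. b \<le> Re v \<Longrightarrow> Re v < 0 \<Longrightarrow> a \<le> Re (k v) \<and> Re (k v) < 0"
    "\<And>v. b \<le> Re v \<Longrightarrow> Re v < 0 \<Longrightarrow> h (k v) = v"
    "\<And>w. a \<le> Re w \<Longrightarrow> Re w < 0 \<Longrightarrow> b \<le> Re (h w) \<Longrightarrow> k (h w) = w"
    "\<And>w. a \<le> Re w \<Longrightarrow> Re w < 0 \<Longrightarrow> h (w + 2 * pi * \<i>) = h w + of_int m * (2 * pi * \<i>)"
    "\<And>c. c < 0 \<Longrightarrow> \<exists>a'\<in>{a..<0}. \<forall>w. a' \<le> Re w \<and> Re w < 0 \<longrightarrow> c < Re (h w)"
    "\<And>c. c < 0 \<Longrightarrow> \<exists>b'\<in>{b..<0}. \<forall>v. b' \<le> Re v \<and> Re v < 0 \<longrightarrow> c < Re (k v)"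
proof -
  have FG: "continuous_on (ball 0 1) F" "continuous_on (ball 0 1) G"
    "\<And>z. cmod z < 1 \<Longrightarrow> G (F z) = z" "\<And>z. cmod z < 1 \<Longrightarrow> F (G z) = z"
    using hom unfolding homeomorphism_def by auto
  have FG5: "cmod (F z) < 1" "cmod (G z) < 1" if "cmod z < 1" for z
    using homeomorphism_image1[OF hom] homeomorphism_image2[OF hom] that
    by (metis imageI mem_ball_0)+
  obtain R where R: "0 < R" "R < 1" "\<And>z. cmod z < 1 \<Longrightarrow> R \<le> cmod z \<Longrightarrow> 0 < cmod (F z)"
    using ball_homeomorphism_proper[OF hom, of 0] by auto
  obtain R' where R': "0 < R'" "R' < 1" "\<And>z. cmod z < 1 \<Longrightarrow> R' \<le> cmod z \<Longrightarrow> R < cmod (G z)"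
    using ball_homeomorphism_proper[OF homeomorphism_symD[OF hom] \<open>R < 1\<close>] by auto
  define a b where "a = ln R" and "b = ln R'"
  have ab: "a < 0" "b < 0" "exp a = R" "exp b = R'" using R R' by (auto simp: a_def b_def)
  define A where "A c = {w. c \<le> Re w} \<inter> {w. Re w < 0}" for c
  have A_iff: "w \<in> A c \<longleftrightarrow> c \<le> Re w \<and> Re w < 0" for w c by (simp add: A_def)
  have convA: "convex (A c)" for c
    unfolding A_def by (intro convex_Int convex_halfspace_Re_ge convex_halfspace_Re_lt)
  have ball: "exp w \<in> ball 0 1" "cmod (exp w) < 1" if "w \<in> A c" for w c
    using that by (auto simp: A_iff norm_exp_eq_Re)
  have normR: "R \<le> cmod (exp w)" if "w \<in> A a" for w using that ab by (simp add: A_iff norm_exp_eq_Re flip: ab(3))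
  have normR': "R' \<le> cmod (exp w)" if "w \<in> A b" for w using that ab by (simp add: A_iff norm_exp_eq_Re flip: ab(4))
  have "continuous_on (A a) (\<lambda>w. F (exp w))"
    by (intro continuous_on_compose2[OF FG(1)] continuous_intros) (use ball in auto)
  moreover have "F (exp w) \<noteq> 0" if "w \<in> A a" for w using R(3)[OF ball(2)[OF that] normR[OF that]] by auto
  ultimately obtain h0 where h0: "continuous_on (A a) h0" "\<And>w. w \<in> A a \<Longrightarrow> F (exp w) = exp (h0 w)"
    using continuous_logarithm_on_contractible[of "A a"] convA convex_imp_contractible by blast
  have "continuous_on (A b) (\<lambda>w. G (exp w))"
    by (intro continuous_on_compose2[OF FG(2)] continuous_intros) (use ball in auto)
  moreover have GR: "R < cmod (G (exp w))" if "w \<in> A b" for w using R'(3)[OF ball(2)[OF that] normR'[OF that]] .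
  moreover have "G (exp w) \<noteq> 0" if "w \<in> A b" for w using GR[OF that] R(1) by auto
  ultimately obtain k where k: "continuous_on (A b) k" "\<And>w. w \<in> A b \<Longrightarrow> G (exp w) = exp (k w)"
    using continuous_logarithm_on_contractible[of "A b"] convA convex_imp_contractible by blast
  have kA: "k v \<in> A a" if "v \<in> A b" for v
  proof -
    have "exp a < exp (Re (k v))" using GR[OF that] k(2)[OF that] ab by (simp add: norm_exp_eq_Re)
    moreover have "exp (Re (k v)) < 1"
      using FG5(2)[OF ball(2)[OF that]] k(2)[OF that] by (simp add: norm_exp_eq_Re)
    ultimately show ?thesis by (simp add: A_iff)
  qed
  have "continuous_on (A b) (\<lambda>v. h0 (k v) - v)"
    by (intro continuous_intros continuous_on_compose2[OF h0(1)] k(1)) (use kA in auto)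
  moreover have "exp (h0 (k v) - v) = 1" if "v \<in> A b" for v
    using h0(2)[OF kA[OF that]] k(2)[OF that] FG(4)[OF ball(2)[OF that]] by (simp add: exp_diff)
  ultimately obtain n :: int where n: "\<And>v. v \<in> A b \<Longrightarrow> h0 (k v) - v = 2 * pi * of_int n * \<i>"
    using exp_eq_1_imp_constant[OF convex_connected[OF convA]] by blast
  define h where "h w = h0 w - 2 * pi * of_int n * \<i>" for w
  have h: "continuous_on (A a) h" "\<And>w. w \<in> A a \<Longrightarrow> exp (h w) = F (exp w)"
    "\<And>v. v \<in> A b \<Longrightarrow> h (k v) = v"
    using n h0 exp_plus_2pin[of _ "- n"] by (auto simp: h_def intro!: continuous_intros simp: algebra_simps)
  have hneg: "Re (h w) < 0" if "w \<in> A a" for w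
    using h(2)[OF that] FG5(1)[OF ball(2)[OF that]] by (metis norm_exp_eq_Re exp_less_one_iff)
  have shiftA: "w + of_int j * (2 * pi * \<i>) \<in> A c" if "w \<in> A c" for w c and j :: int
    using that by (simp add: A_iff)
  have period: "\<exists>m::int. \<forall>w\<in>A c. l (w + 2 * pi * \<i>) - l w = 2 * pi * of_int m * \<i>"
    if l: "continuous_on (A c) l" "\<And>w. w \<in> A c \<Longrightarrow> exp (l w) = P (exp w)" for c l P
  proof (rule exp_eq_1_imp_constant[OF convex_connected[OF convA]])
    show "continuous_on (A c) (\<lambda>w. l (w + 2 * pi * \<i>) - l w)"
      by (intro continuous_intros continuous_on_compose2[OF l(1)] l(1)) (use shiftA[of _ c 1] in auto)
    show "exp (l (w + 2 * pi * \<i>) - l w) = 1" if "w \<in> A c" for w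
    proof -
      have "exp (l (w + 2 * pi * \<i>)) = exp (l w)"
        using l(2)[OF that] l(2)[OF shiftA[OF that, of 1]] exp_plus_2pin[of w 1] by (simp add: mult_ac)
      then show ?thesis by (simp add: exp_diff)
    qed
  qed
  obtain m :: int where "\<forall>w\<in>A a. h (w + 2 * pi * \<i>) - h w = 2 * pi * of_int m * \<i>"
    using period[OF h(1,2)] by blast
  then have m: "\<And>w. w \<in> A a \<Longrightarrow> h (w + 2 * pi * \<i>) = h w + of_int m * (2 * pi * \<i>)"
    by (simp add: algebra_simps)
  obtain m' :: int where "\<forall>w\<in>A b. k (w + 2 * pi * \<i>) - k w = 2 * pi * of_int m' * \<i>"
    using period[OF k(1) k(2)[symmetric]] by blast
  then have m': "\<And>w. w \<in> A b \<Longrightarrow> k (w + 2 * pi * \<i>) = k w + of_int m' * (2 * pi * \<i>)"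
    by (simp add: algebra_simps)
  have hper: "h (w + of_int j * (2 * pi * \<i>)) = h w + of_int j * (of_int m * (2 * pi * \<i>))" if "w \<in> A a" for w and j :: int
    by (rule period_int_multiple[where S = "A a"]) (use m shiftA that in auto)
  have mm: "m * m' = 1"
  proof -
    \<comment> \<open>compare \<open>h (k (v + 2 \<pi> \<i>))\<close> with \<open>h (k v)\<close>\<close>
    let ?v = "complex_of_real b"
    have v: "?v \<in> A b" "?v + 2 * pi * \<i> \<in> A b" using ab by (simp_all add: A_iff)
    have "?v + 2 * pi * \<i> = h (k ?v + of_int m' * (2 * pi * \<i>))" unfolding m'[OF v(1), symmetric] h(3)[OF v(2)] ..
    also have "\<dots> = ?v + of_int m' * (of_int m * (2 * pi * \<i>))" unfolding hper[OF kA[OF v(1)]] h(3)[OF v(1)] ..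
    finally have "2 * pi * \<i> * (of_int (m * m') - 1) = 0" by (simp add: algebra_simps)
    then have "complex_of_int (m * m') = 1" by (simp only: mult_eq_0_iff) auto
    then show ?thesis by (metis of_int_eq_1_iff)
  qed
  then have m1: "m = 1 \<or> m = -1" by (auto simp: zmult_eq_1_iff)
  have kh: "k (h w) = w" if "w \<in> A a" "b \<le> Re (h w)" for w
  proof -
    have hb: "h w \<in> A b" using that hneg by (simp add: A_iff)
    have "exp (k (h w)) = exp w"
      using k(2)[OF hb] h(2)[OF that(1)] FG(3)[OF ball(2)[OF that(1)]] by simp
    then obtain l :: int where l: "k (h w) = w + of_int l * (2 * pi * \<i>)"
      by (auto simp: exp_eq algebra_simps)
    have "h w = h w + of_int l * (of_int m * (2 * pi * \<i>))"
      using h(3)[OF hb] hper[OF that(1), of l] l by simp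
    then have "l = 0" using m1 by auto
    then show ?thesis using l by simp
  qed
  have proper: "\<exists>a'\<in>{r..<0}. \<forall>w. a' \<le> Re w \<and> Re w < 0 \<longrightarrow> c < Re (l w)"
    if P: "homeomorphism (ball 0 1) (ball 0 1) P P'" "c < 0" "r < 0" "\<And>w. w \<in> A r \<Longrightarrow> exp (l w) = P (exp w)"
    for P P' l and c r :: real
  proof -
    obtain R where R: "0 < R" "R < 1" "\<And>z. cmod z < 1 \<Longrightarrow> R \<le> cmod z \<Longrightarrow> exp c < cmod (P z)"
      using ball_homeomorphism_proper[OF P(1), of "exp c"] P(2) by auto
    have "c < Re (l w)" if w: "max r (ln R) \<le> Re w" "Re w < 0" for w
    proof -
      have "exp (ln R) \<le> exp (Re w)" using w by simp
      then have "R \<le> cmod (exp w)" using R by (simp add: norm_exp_eq_Re)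
      moreover have "cmod (exp w) < 1" using w by (simp add: norm_exp_eq_Re)
      ultimately have "exp c < cmod (P (exp w))" using R by blast
      also have "P (exp w) = exp (l w)" using P(4)[of w] w by (simp add: A_iff)
      finally show ?thesis by (simp add: norm_exp_eq_Re)
    qed
    then show ?thesis using R P(3) by (intro bexI[of _ "max r (ln R)"]) auto
  qed
  show thesis
  proof (rule that[of a b m h k])
    show "a < 0" "b < 0" "m = 1 \<or> m = - 1" by (rule ab m1)+
    show "continuous_on {w. a \<le> Re w \<and> Re w < 0} h" "continuous_on {v. b \<le> Re v \<and> Re v < 0} k"
      using h(1) k(1) by (simp_all add: A_def Int_def)
    show "\<exists>a'\<in>{a..<0}. \<forall>w. a' \<le> Re w \<and> Re w < 0 \<longrightarrow> c < Re (h w)" if "c < 0" for c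
      by (rule proper[OF hom that ab(1) h(2)])
    show "\<exists>b'\<in>{b..<0}. \<forall>v. b' \<le> Re v \<and> Re v < 0 \<longrightarrow> c < Re (k v)" if "c < 0" for c
      by (rule proper[OF homeomorphism_symD[OF hom] that ab(2) k(2)[symmetric]])
    show "a \<le> Re (k v) \<and> Re (k v) < 0" if "b \<le> Re v" "Re v < 0" for v
      using kA[of v] that by (simp add: A_iff)
    show "exp (h w) = F (exp w)" "Re (h w) < 0" "h (w + 2 * pi * \<i>) = h w + of_int m * (2 * pi * \<i>)"
      if "a \<le> Re w" "Re w < 0" for w
      using h(2)[of w] hneg[of w] m[of w] that by (simp_all add: A_iff)
    show "h (k v) = v" if "b \<le> Re v" "Re v < 0" for v using h(3)[of v] that by (simp add: A_iff)
    show "k (h w) = w" if "a \<le> Re w" "Re w < 0" "b \<le> Re (h w)" for w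
      using kh[of w] that by (simp add: A_iff)
  qed
qed

text \<open>If the degree is \<open>-1\<close>, conjugation after \<open>F\<close> turns it into \<open>1\<close>.\<close>

lemma ball_homeomorphism_lift:
  fixes F G :: "complex \<Rightarrow> complex"
  assumes hom: "homeomorphism (ball 0 1) (ball 0 1) F G"
  obtains \<sigma> a b h k where "\<sigma> = id \<or> \<sigma> = cnj" "annulus_lift a b h k"
    "\<And>w. a \<le> Re w \<Longrightarrow> Re w < 0 \<Longrightarrow> exp (h w) = \<sigma> (F (exp w))"
proof (rule ball_homeomorphism_lift_degree[OF hom])
  fix a b h k and m :: int
  assume *: "a < 0" "b < 0" and m: "m = 1 \<or> m = -1"
    and cont: "continuous_on {w. a \<le> Re w \<and> Re w < 0} h" "continuous_on {v. b \<le> Re v \<and> Re v < 0} k"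
    and exp_h: "\<And>w. a \<le> Re w \<Longrightarrow> Re w < 0 \<Longrightarrow> exp (h w) = F (exp w)"
    and **: "\<And>w. a \<le> Re w \<Longrightarrow> Re w < 0 \<Longrightarrow> Re (h w) < 0"
      "\<And>v. b \<le> Re v \<Longrightarrow> Re v < 0 \<Longrightarrow> a \<le> Re (k v) \<and> Re (k v) < 0"
      "\<And>v. b \<le> Re v \<Longrightarrow> Re v < 0 \<Longrightarrow> h (k v) = v"
      "\<And>w. a \<le> Re w \<Longrightarrow> Re w < 0 \<Longrightarrow> b \<le> Re (h w) \<Longrightarrow> k (h w) = w"
    and per: "\<And>w. a \<le> Re w \<Longrightarrow> Re w < 0 \<Longrightarrow> h (w + 2 * pi * \<i>) = h w + of_int m * (2 * pi * \<i>)"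
    and proper: "\<And>c. c < 0 \<Longrightarrow> \<exists>a'\<in>{a..<0}. \<forall>w. a' \<le> Re w \<and> Re w < 0 \<longrightarrow> c < Re (h w)"
      "\<And>c. c < 0 \<Longrightarrow> \<exists>b'\<in>{b..<0}. \<forall>v. b' \<le> Re v \<and> Re v < 0 \<longrightarrow> c < Re (k v)"
  show thesis using m
  proof
    assume "m = 1"
    then have "annulus_lift a b h k" using * ** cont per proper by unfold_locales auto
    then show thesis using that[of id a b h k] exp_h by auto
  next
    assume m: "m = -1"
    have "annulus_lift a b (\<lambda>w. cnj (h w)) (\<lambda>v. k (cnj v))"
    proof
      show "continuous_on {v. b \<le> Re v \<and> Re v < 0} (\<lambda>v. k (cnj v))"
        by (intro continuous_on_compose2[OF cont(2)] continuous_intros) auto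
      show "\<exists>b'\<in>{b..<0}. \<forall>v. b' \<le> Re v \<and> Re v < 0 \<longrightarrow> c < Re (k (cnj v))" if "c < 0" for c
        using proper(2)[OF that] by (metis complex_cnj(1) cnj.sel(1))
    qed (use * ** cont per proper m in \<open>auto intro: continuous_intros\<close>)
    then show thesis using that[of cnj a b "\<lambda>w. cnj (h w)" "\<lambda>v. k (cnj v)"] exp_h by (auto simp: exp_cnj[symmetric])
  qed
qed

section \<open>Harmonic functions that are small along a crossing path\<close>

lemma Re_holomorphic_le_of_frontier:
  assumes "open W" "bounded W" "g holomorphic_on W" "continuous_on (closure W) g"
    and "\<And>z. z \<in> frontier W \<Longrightarrow> Re (g z) \<le> B" and "z \<in> W"
  shows "Re (g z) \<le> B"
proof -
  have "norm (exp (g z)) \<le> exp B"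
    by (rule maximum_modulus_frontier[where S = W])
       (use assms in \<open>auto intro!: holomorphic_intros continuous_intros simp: interior_open norm_exp_eq_Re\<close>)
  then show ?thesis by (simp add: norm_exp_eq_Re)
qed

text \<open>This is the Fashoda theorem for a rectangle. The path \<open>p\<close> may leave the strip; it is clamped to the
rectangle, which adds points only on the lines \<open>Im w = c\<close> and \<open>Im w = d\<close>, and these \<open>\<gamma>\<close> avoids.\<close>

lemma strip_crossing_paths_meet:
  fixes p \<gamma> :: "real \<Rightarrow> complex"
  assumes "c < d" "lo < hi"
    and p: "continuous_on {0..1} p" "Im (p 0) = c" "Im (p 1) = d"
      "\<And>s. s \<in> {0..1} \<Longrightarrow> lo \<le> Re (p s) \<and> Re (p s) \<le> hi"
    and \<gamma>: "path \<gamma>" "Re (pathstart \<gamma>) = lo" "Re (pathfinish \<gamma>) = hi"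
      "\<And>w. w \<in> path_image \<gamma> \<Longrightarrow> lo \<le> Re w \<and> Re w \<le> hi \<and> c < Im w \<and> Im w < d"
  shows "\<exists>w \<in> path_image \<gamma>. w \<in> p ` {0..1}"
proof -
  define v :: "real \<Rightarrow> real \<Rightarrow> real ^ 2" where "v x y = (\<chi> i. if i = 1 then x else y)" for x y
  have v_nth: "v x y $ 1 = x" "v x y $ 2 = y" for x y by (simp_all add: v_def)
  have v_cont: "continuous_on S (\<lambda>s. v (f s) (g s))" if "continuous_on S f" "continuous_on S g"
    for S :: "real set" and f g
  proof -
    have "continuous_on S (\<lambda>s. if i = 1 then f s else g s)" for i :: 2 using that by (cases "i = 1") auto
    then show ?thesis unfolding v_def by (rule continuous_on_vec_lambda)
  qed
  define P where "P s = v (max c (min d (Im (p s)))) (Re (p s))" for s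
  define G where "G s = v (Im (\<gamma> s)) (Re (\<gamma> s))" for s
  have "path P" unfolding path_def P_def using p(1) by (intro v_cont continuous_intros)
  moreover have "path G" using \<gamma>(1) unfolding path_def G_def by (intro v_cont continuous_intros)
  moreover have "path_image P \<subseteq> cbox (v c lo) (v d hi)"
    using p(4) \<open>c < d\<close> unfolding path_image_def P_def by (auto simp: mem_box_cart forall_2 v_nth)
  moreover have "path_image G \<subseteq> cbox (v c lo) (v d hi)"
    using \<gamma>(4) unfolding path_image_def G_def by (force simp: mem_box_cart forall_2 v_nth)
  moreover have "pathstart P $ 1 = v c lo $ 1" "pathfinish P $ 1 = v d hi $ 1"
    using p(2,3) \<open>c < d\<close> by (simp_all add: P_def v_nth pathstart_def pathfinish_def)
  moreover have "pathstart G $ 2 = v c lo $ 2" "pathfinish G $ 2 = v d hi $ 2"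
    using \<gamma>(2,3) by (simp_all add: G_def v_nth pathstart_def pathfinish_def)
  ultimately obtain z where "z \<in> path_image P" "z \<in> path_image G" by (rule fashoda)
  then obtain s t where s: "s \<in> {0..1}" and t: "t \<in> {0..1}" and "P s = G t"
    unfolding path_image_def by auto
  then have eq: "max c (min d (Im (p s))) = Im (\<gamma> t)" "Re (p s) = Re (\<gamma> t)"
    unfolding P_def G_def by (metis v_nth)+
  have "c < Im (\<gamma> t)" "Im (\<gamma> t) < d" using \<gamma>(4)[of "\<gamma> t"] t by (auto simp: path_image_def)
  then have "\<gamma> t = p s" using eq by (auto simp: complex_eq_iff max_def min_def split: if_splits)
  then have "\<gamma> t \<in> p ` {0..1}" using s by auto
  moreover have "\<gamma> t \<in> path_image \<gamma>" using t by (simp add: path_image_def)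
  ultimately show ?thesis by blast
qed

text \<open>Let the path \<open>p\<close> cross the strip \<open>c < Im w < d\<close> to the right of the point \<open>w0\<close> on its centre line, and let \<open>W\<close>
be the part of the strip, to the left of \<open>p\<close> and between \<open>Re w = - \<delta>\<close> and \<open>0\<close>, that is connected with \<open>w0\<close>.
On \<open>p\<close> the function is at most \<open>e\<close>; on the remaining boundary of \<open>W\<close> it is at most \<open>M\<close>, which is dominated by the
barrier \<open>M / \<delta>\<^sup>2 ((Im w - t)\<^sup>2 - Re w (Re w + 2 \<delta>))\<close>. The barrier is harmonic, nonnegative on the rectangle, at least \<open>M\<close> on
its left, upper and lower sides, and it vanishes at \<open>\<i> t\<close>. The maximum principle on \<open>W\<close> gives the estimate.\<close>

lemma crossing_estimate_aux:
  fixes p :: "real \<Rightarrow> complex"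
  assumes hol: "g holomorphic_on ball 0 1" and M: "\<And>z. z \<in> ball 0 1 \<Longrightarrow> Re (g z) \<le> M" "0 \<le> M"
    and "0 \<le> e" and "c < d"
    and p: "continuous_on {0..1} p" "Im (p 0) = c" "Im (p 1) = d"
    and p_re: "\<And>s. s \<in> {0..1} \<Longrightarrow> r < Re (p s) \<and> Re (p s) < 0"
    and small: "\<And>s. s \<in> {0..1} \<Longrightarrow> Re (g (exp (p s))) \<le> e"
    and r: "- ((d - c) / 2) < r" "r < 0"
  shows "Re (g (exp (Complex r ((c + d) / 2)))) \<le> e + 4 * M / (d - c) * (- r)"
proof -
  define \<delta> where "\<delta> = (d - c) / 2"
  define t where "t = (c + d) / 2"
  have \<delta>: "\<delta> > 0" "c = t - \<delta>" "d = t + \<delta>" using \<open>c < d\<close> by (auto simp: \<delta>_def t_def field_simps)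
  define K where "K = p ` {0..1}"
  have K: "compact K" unfolding K_def by (intro compact_continuous_image p(1) compact_Icc)
  have "continuous_on {0..1} (\<lambda>s. Re (p s))" using p(1) by (intro continuous_intros)
  then obtain s where s: "s \<in> {0..1}" "\<And>s'. s' \<in> {0..1} \<Longrightarrow> Re (p s') \<le> Re (p s)"
    using continuous_attains_sup[of "{0..1::real}"] by force
  \<comment> \<open>\<open>p s\<close> is the rightmost point of the path, so \<open>p\<close> stays to the left of the line \<open>Re w = hi\<close>\<close>
  define hi where "hi = Re (p s) / 2"
  have hi: "Re w < hi" if "w \<in> K" for w using that s p_re[OF s(1)] unfolding K_def hi_def by force
  have hi_r: "r < hi" "hi < 0" using p_re[OF s(1)] r unfolding hi_def by auto
  define w0 where "w0 = Complex r t"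
  define Q where "Q = {w. - \<delta> < Re w} \<inter> {w. Re w < hi} \<inter> {w. c < Im w} \<inter> {w. Im w < d}"
  define Q' where "Q' = {w. - \<delta> \<le> Re w} \<inter> {w. Re w \<le> hi} \<inter> {w. c \<le> Im w} \<inter> {w. Im w \<le> d}"
  have "open Q" unfolding Q_def
    by (intro open_Int open_halfspace_Re_gt open_halfspace_Re_lt open_halfspace_Im_gt open_halfspace_Im_lt)
  have "closed Q'" unfolding Q'_def
    by (intro closed_Int closed_halfspace_Re_ge closed_halfspace_Re_le closed_halfspace_Im_ge closed_halfspace_Im_le)
  have "Q \<subseteq> Q'" by (auto simp: Q_def Q'_def)
  have "Q' \<subseteq> cbox (Complex (-\<delta>) c) (Complex hi d)" by (auto simp: Q'_def cbox_complex_eq)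
  then have "bounded Q'" using bounded_cbox bounded_subset by blast
  have QK: "open (Q - K)" using \<open>open Q\<close> K by (simp add: compact_imp_closed open_Diff)
  define W where "W = connected_component_set (Q - K) w0"
  have w0: "w0 \<in> Q - K"
  proof -
    have "w0 \<notin> K"
    proof
      assume "w0 \<in> K"
      then obtain s where "s \<in> {0..1}" "w0 = p s" unfolding K_def by blast
      then show False using p_re[of s] by (metis complex.sel(1) less_irrefl w0_def)
    qed
    then show ?thesis using r hi_r \<delta> by (auto simp: Q_def w0_def \<delta>_def[symmetric])
  qed
  have W: "open W" "w0 \<in> W" "W \<subseteq> Q - K" "connected W"
    using QK w0 unfolding W_def by (simp_all add: open_connected_component connected_component_subset)
  have clW: "closure W \<subseteq> Q'"
    using W(3) \<open>Q \<subseteq> Q'\<close> by (intro closure_minimal[OF _ \<open>closed Q'\<close>]) auto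
  \<comment> \<open>A point of \<open>W\<close> near the right side would give a path through \<open>W\<close> from the left to the right side that
misses the crossing path.\<close>
  have not_top: False if z: "z \<in> closure W" "Re z = hi" for z
  proof -
    have "z \<notin> K" using hi z by force
    then obtain \<eta> where \<eta>: "\<eta> > 0" "ball z \<eta> \<inter> K = {}"
      using K by (metis compact_imp_closed open_Compl open_contains_ball ComplI disjoint_eq_subset_Compl)
    obtain w1 where w1: "w1 \<in> W" "dist w1 z < \<eta>" using z(1) \<eta>(1) closure_approachable by blast
    have w1Q: "- \<delta> < Re w1" "Re w1 < hi" "c < Im w1" "Im w1 < d" using w1(1) W(3) by (auto simp: Q_def)
    obtain \<pi> where \<pi>: "path \<pi>" "path_image \<pi> \<subseteq> W" "pathstart \<pi> = w0" "pathfinish \<pi> = w1"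
      using W(1,2,4) w1(1) connected_open_path_connected path_connected_def by metis
    define \<gamma> where "\<gamma> = linepath (Complex (- \<delta>) t) w0 +++ \<pi> +++ linepath w1 (Complex hi (Im w1))"
    have "path \<gamma>" using \<pi> by (auto simp: \<gamma>_def intro!: path_join_imp)
    have first: "Im w = t \<and> - \<delta> \<le> Re w \<and> Re w \<le> r" if "w \<in> closed_segment (Complex (- \<delta>) t) w0" for w
    proof -
      have "closed_segment (Complex (- \<delta>) t) w0 \<subseteq> {w. - \<delta> \<le> Re w} \<inter> {w. Re w \<le> r} \<inter> {w. Im w \<le> t} \<inter> {w. t \<le> Im w}"
        by (rule closed_segment_subset)
           (use r in \<open>auto simp: w0_def \<delta>_def intro!: convex_Int convex_halfspace_Re_ge convex_halfspace_Re_le convex_halfspace_Im_le convex_halfspace_Im_ge\<close>)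
      from subsetD[OF this that] show ?thesis by auto
    qed
    have last: "Im w = Im w1 \<and> Re w1 \<le> Re w \<and> Re w \<le> hi" if "w \<in> closed_segment w1 (Complex hi (Im w1))" for w
    proof -
      have "closed_segment w1 (Complex hi (Im w1)) \<subseteq>
          {w. Re w1 \<le> Re w} \<inter> {w. Re w \<le> hi} \<inter> {w. Im w \<le> Im w1} \<inter> {w. Im w1 \<le> Im w}"
        by (rule closed_segment_subset)
           (use w1Q in \<open>auto intro!: convex_Int convex_halfspace_Re_ge convex_halfspace_Re_le convex_halfspace_Im_le convex_halfspace_Im_ge\<close>)
      from subsetD[OF this that] show ?thesis by auto
    qed
    have image: "path_image \<gamma> = closed_segment (Complex (- \<delta>) t) w0 \<union> (path_image \<pi> \<union> closed_segment w1 (Complex hi (Im w1)))"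
      unfolding \<gamma>_def using \<pi> by (simp add: path_image_join)
    have "\<exists>w \<in> path_image \<gamma>. w \<in> p ` {0..1}"
    proof (rule strip_crossing_paths_meet[OF \<open>c < d\<close> _ p])
      show "- \<delta> < hi" using hi_r r by (simp add: \<delta>_def)
      show "- \<delta> \<le> Re (p s) \<and> Re (p s) \<le> hi" if "s \<in> {0..1}" for s
        using p_re[OF that] hi[of "p s"] that r by (auto simp: K_def \<delta>_def)
      show "- \<delta> \<le> Re w \<and> Re w \<le> hi \<and> c < Im w \<and> Im w < d" if "w \<in> path_image \<gamma>" for w
        using that first[of w] last[of w] \<pi>(2) W(3) w1Q hi_r \<delta> unfolding image Q_def by fastforce
    qed (use \<open>path \<gamma>\<close> in \<open>auto simp: \<gamma>_def\<close>)
    then obtain w where w: "w \<in> path_image \<gamma>" "w \<in> K" by (auto simp: K_def)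
    have "r < Re w" using w(2) p_re by (auto simp: K_def)
    then have "w \<in> closed_segment w1 (Complex hi (Im w1))"
      using w first[of w] \<pi>(2) W(3) unfolding image by auto
    from last[OF this] have "\<bar>Re (w - z)\<bar> \<le> \<bar>Re (w1 - z)\<bar>" "Im (w - z) = Im (w1 - z)"
      using z by auto
    then have "cmod (w - z) \<le> cmod (w1 - z)" unfolding cmod_def
      by (intro real_sqrt_le_mono add_mono) (auto simp: power2_le_iff_abs_le abs_le_square_iff)
    then have "w \<in> ball z \<eta>" using w1(2) by (simp add: dist_norm norm_minus_commute)
    then show False using \<eta>(2) w(2) by blast
  qed
  define q where "q w = g (exp w) - of_real (M / \<delta>\<^sup>2) * (- (w - \<i> * t)\<^sup>2 - 2 * \<delta> * (w - \<i> * t))" for w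
  have Re_q: "Re (q w) = Re (g (exp w)) - M / \<delta>\<^sup>2 * ((Im w - t)\<^sup>2 + (- Re w) * (Re w + 2 * \<delta>))" for w
  proof -
    have "Re (of_real m * (- (w - \<i> * t)\<^sup>2 - 2 * \<delta> * (w - \<i> * t))) = m * ((Im w - t)\<^sup>2 + (- Re w) * (Re w + 2 * \<delta>))" for m
      by (simp add: power2_eq_square algebra_simps)
    then show ?thesis by (simp add: q_def)
  qed
  have hol_q: "q holomorphic_on {w. Re w < 0}"
  proof -
    have "(g \<circ> exp) holomorphic_on {w. Re w < 0}"
      by (rule holomorphic_on_compose_gen[OF _ hol]) (auto intro: holomorphic_intros simp: norm_exp_eq_Re)
    then show ?thesis unfolding q_def o_def by (intro holomorphic_intros)
  qed
  have Q'_left: "Q' \<subseteq> {w. Re w < 0}" using hi_r by (auto simp: Q'_def)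
  have "Re (q w0) \<le> e"
  proof (rule Re_holomorphic_le_of_frontier[where W = W and g = q and z = w0])
    show "open W" "w0 \<in> W" by (rule W)+
    show "bounded W" using clW \<open>bounded Q'\<close> bounded_subset closure_subset by blast
    show "q holomorphic_on W" using hol_q clW Q'_left closure_subset by (blast intro: holomorphic_on_subset)
    show "continuous_on (closure W) q"
      using holomorphic_on_imp_continuous_on[OF hol_q] clW Q'_left by (blast intro: continuous_on_subset)
    show "Re (q z) \<le> e" if z: "z \<in> frontier W" for z
    proof -
      have zc: "z \<in> closure W" using z by (simp add: frontier_def)
      then have zQ': "- \<delta> \<le> Re z" "Re z \<le> hi" "c \<le> Im z" "Im z \<le> d" using clW by (auto simp: Q'_def)
      have "z \<in> frontier (Q - K)" using z frontier_of_connected_component_subset unfolding W_def by blast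
      then have zQK: "z \<notin> Q - K" using QK by (simp add: frontier_def interior_open)
      have barrier: "0 \<le> (- Re z) * (Re z + 2 * \<delta>)" using zQ' hi_r \<delta> by (intro mult_nonneg_nonneg) auto
      then have nonneg: "0 \<le> M / \<delta>\<^sup>2 * ((Im z - t)\<^sup>2 + (- Re z) * (Re z + 2 * \<delta>))"
        using M(2) \<delta>(1) barrier by (intro mult_nonneg_nonneg[of "M / \<delta>\<^sup>2"] add_nonneg_nonneg[OF zero_le_power2 barrier]) auto
      show ?thesis
      proof (cases "z \<in> K")
        case True
        then show ?thesis using small nonneg unfolding K_def Re_q by fastforce
      next
        case False
        then have "Re z = - \<delta> \<or> Im z = c \<or> Im z = d"
          using zQK zQ' not_top[OF zc] by (auto simp: Q_def)
        then have "\<delta>\<^sup>2 \<le> (Im z - t)\<^sup>2 + (- Re z) * (Re z + 2 * \<delta>)"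
          using barrier \<delta> by (auto simp: power2_eq_square)
        then have "M / \<delta>\<^sup>2 * \<delta>\<^sup>2 \<le> M / \<delta>\<^sup>2 * ((Im z - t)\<^sup>2 + (- Re z) * (Re z + 2 * \<delta>))"
          using M(2) by (intro mult_left_mono) auto
        moreover have "Re (g (exp z)) \<le> M"
          by (rule M(1)) (use zQ' hi_r in \<open>simp add: norm_exp_eq_Re\<close>)
        ultimately show ?thesis using \<open>0 \<le> e\<close> \<delta>(1) unfolding Re_q by simp
      qed
    qed
  qed
  then have "Re (g (exp w0)) \<le> e + M / \<delta>\<^sup>2 * ((- r) * (r + 2 * \<delta>))"
    unfolding Re_q by (simp add: w0_def)
  also have "M / \<delta>\<^sup>2 * ((- r) * (r + 2 * \<delta>)) \<le> M / \<delta>\<^sup>2 * ((- r) * (2 * \<delta>))"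
    using M(2) r by (intro mult_left_mono) auto
  also have "\<dots> = 4 * M / (d - c) * (- r)"
  proof -
    have "d - c = 2 * \<delta>" by (simp add: \<delta>_def)
    then show ?thesis using \<delta>(1) by (simp add: power2_eq_square field_simps)
  qed
  finally show ?thesis by (simp add: w0_def t_def)
qed

text \<open>The form in which the estimate is applied: the crossing takes place in any of the strips that the exponential
function maps to the same sector, and in either direction.\<close>

lemma crossing_estimate:
  assumes hol: "g holomorphic_on ball 0 1" and M: "\<And>z. z \<in> ball 0 1 \<Longrightarrow> Re (g z) \<le> M" "0 \<le> M"
    and "0 \<le> e" and "c < d"
    and p: "continuous_on (closed_segment (\<rho>\<^sub>2 :: real) \<rho>\<^sub>3) p" "Im (p \<rho>\<^sub>2) = c + 2 * pi * of_int n" "Im (p \<rho>\<^sub>3) = d + 2 * pi * of_int n"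
    and p_re: "\<And>\<rho>. \<rho> \<in> closed_segment \<rho>\<^sub>2 \<rho>\<^sub>3 \<Longrightarrow> r < Re (p \<rho>) \<and> Re (p \<rho>) < 0"
    and small: "\<And>\<rho>. \<rho> \<in> closed_segment \<rho>\<^sub>2 \<rho>\<^sub>3 \<Longrightarrow> Re (g (exp (p \<rho>))) \<le> e"
    and r: "- ((d - c) / 2) < r" "r < 0"
  shows "Re (g (exp (Complex r ((c + d) / 2)))) \<le> e + 4 * M / (d - c) * (- r)"
proof -
  define p' where "p' s = p (linepath \<rho>\<^sub>2 \<rho>\<^sub>3 s) - 2 * pi * of_int n * \<i>" for s :: real
  have in_seg: "linepath \<rho>\<^sub>2 \<rho>\<^sub>3 s \<in> closed_segment \<rho>\<^sub>2 \<rho>\<^sub>3" if "s \<in> {0..1}" for s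
    using that linepath_in_path by simp
  have exp_p': "exp (p' s) = exp (p (linepath \<rho>\<^sub>2 \<rho>\<^sub>3 s))" for s
    using exp_plus_2pin[of "p' s" n] by (simp add: p'_def mult_ac)
  show ?thesis
  proof (rule crossing_estimate_aux[OF hol M \<open>0 \<le> e\<close> \<open>c < d\<close> _ _ _ _ _ r, where p = p'])
    show "continuous_on {0..1} p'" unfolding p'_def
      by (intro continuous_intros continuous_on_compose2[OF p(1)]) (use in_seg in auto)
  qed (use in_seg p p_re small exp_p' in \<open>auto simp: p'_def linepath_def\<close>)
qed

section \<open>Boundary values of the harmonic homeomorphism\<close>

text \<open>A harmonic map \<open>f = \<Phi> \<circ> F\<close>, where \<open>h\<close> is the lift of \<open>F\<close> in logarithmic coordinates.\<close>

locale harmonic_lift = annulus_lift +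
  fixes f \<Phi> :: "complex \<Rightarrow> real ^ 'n"
  assumes harmonic: "harmonic_map_on f (ball 0 1)" and bdd: "bounded (f ` ball 0 1)"
    and \<Phi>_cont: "continuous_on (cball 0 1) \<Phi>" and \<Phi>_inj: "inj_on \<Phi> (cball 0 1)"
    and f_lift: "\<And>w. a \<le> Re w \<Longrightarrow> Re w < 0 \<Longrightarrow> f (exp w) = \<Phi> (exp (h w))"
begin

lemma f_exp_k: "b \<le> Re v \<Longrightarrow> Re v < 0 \<Longrightarrow> f (exp (k v)) = \<Phi> (exp v)"
  using f_lift k_range h_k by simp

text \<open>The crossings can be taken to the right of the given point and so late that the function is at most \<open>e\<close> on them,
for every positive \<open>e\<close>; the barrier term of \<open>crossing_estimate\<close> is all that remains.\<close>

lemma crosses_imp_radial_bound: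
  assumes cross: "crosses x c d" and "c < d"
    and g: "g holomorphic_on ball 0 1" "\<And>z. z \<in> ball 0 1 \<Longrightarrow> Re (g z) \<le> M" "0 \<le> M"
    and lim: "\<And>e. e > 0 \<Longrightarrow> \<exists>\<rho>\<^sub>1\<in>{b..<0}. \<forall>\<rho>\<in>{\<rho>\<^sub>1..<0}. Re (g (exp (k (Complex \<rho> x)))) \<le> e"
    and r: "- ((d - c) / 2) < r" "r < 0"
  shows "Re (g (exp (Complex r ((c + d) / 2)))) \<le> 4 * M / (d - c) * (- r)"
proof (rule field_le_epsilon)
  fix e :: real assume "e > 0"
  obtain \<rho> where \<rho>: "\<rho> \<in> {b..<0}" "\<And>\<rho>'. \<rho>' \<in> {\<rho>..<0} \<Longrightarrow> Re (g (exp (k (Complex \<rho>' x)))) \<le> e"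
    using lim[OF \<open>e > 0\<close>] by blast
  obtain b' where b': "b' \<in> {b..<0}" "\<And>v. b' \<le> Re v \<Longrightarrow> Re v < 0 \<Longrightarrow> r < Re (k v)"
    using k_proper[OF r(2)] by blast
  have "max \<rho> b' \<in> {b..<0}" using \<rho>(1) b'(1) by auto
  then obtain \<rho>\<^sub>2 \<rho>\<^sub>3 and n :: int where *: "\<rho>\<^sub>2 \<in> {max \<rho> b'..<0}" "\<rho>\<^sub>3 \<in> {max \<rho> b'..<0}"
    "Im (k (Complex \<rho>\<^sub>2 x)) = c + 2 * pi * of_int n" "Im (k (Complex \<rho>\<^sub>3 x)) = d + 2 * pi * of_int n"
    using cross unfolding crosses_def by blast
  have seg: "closed_segment \<rho>\<^sub>2 \<rho>\<^sub>3 \<subseteq> {max \<rho> b'..<0}"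
    using *(1,2) by (auto simp: closed_segment_eq_real_ivl split: if_splits)
  have "Re (g (exp (Complex r ((c + d) / 2)))) \<le> e + 4 * M / (d - c) * (- r)"
  proof (rule crossing_estimate[OF g _ \<open>c < d\<close> _ *(3,4) _ _ r])
    show "continuous_on (closed_segment \<rho>\<^sub>2 \<rho>\<^sub>3) (\<lambda>\<rho>. k (Complex \<rho> x))"
      by (rule continuous_on_compose2[OF k_cont])
         (use seg b'(1) in \<open>auto intro!: continuous_intros simp: Complex_eq\<close>)
    fix \<rho>' assume "\<rho>' \<in> closed_segment \<rho>\<^sub>2 \<rho>\<^sub>3"
    then have \<rho>': "\<rho> \<le> \<rho>'" "b' \<le> \<rho>'" "\<rho>' < 0" using seg by auto
    show "r < Re (k (Complex \<rho>' x)) \<and> Re (k (Complex \<rho>' x)) < 0"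
      using b'(2)[of "Complex \<rho>' x"] k_range[of "Complex \<rho>' x"] \<rho>' b'(1) by auto
    show "Re (g (exp (k (Complex \<rho>' x)))) \<le> e" using \<rho>(2) \<rho>' by auto
  qed (use \<open>e > 0\<close> in auto)
  then show "Re (g (exp (Complex r ((c + d) / 2)))) \<le> 4 * M / (d - c) * (- r) + e" by simp
qed

lemma f_exp_k_tendsto:
  assumes "e > 0"
  shows "\<exists>\<rho>\<^sub>1\<in>{b..<0}. \<forall>\<rho>\<in>{\<rho>\<^sub>1..<0}. norm (f (exp (k (Complex \<rho> x))) - \<Phi> (cis x)) \<le> e"
proof -
  obtain \<delta> where \<delta>: "\<delta> > 0" "\<And>z. z \<in> cball 0 1 \<Longrightarrow> dist z (cis x) < \<delta> \<Longrightarrow> dist (\<Phi> z) (\<Phi> (cis x)) < e"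
    using \<Phi>_cont \<open>e > 0\<close> unfolding continuous_on_iff by (metis mem_cball_0 norm_cis order_refl)
  define \<rho>\<^sub>1 where "\<rho>\<^sub>1 = max b (- \<delta> / 2)"
  have "norm (f (exp (k (Complex \<rho> x))) - \<Phi> (cis x)) \<le> e" if \<rho>: "\<rho> \<in> {\<rho>\<^sub>1..<0}" for \<rho>
  proof -
    have "exp (Complex \<rho> x) = of_real (exp \<rho>) * cis x" by (simp add: exp_eq_polar)
    then have "exp (Complex \<rho> x) - cis x = of_real (exp \<rho> - 1) * cis x" by (simp add: algebra_simps)
    then have "dist (exp (Complex \<rho> x)) (cis x) = \<bar>exp \<rho> - 1\<bar>"
      by (simp only: dist_norm norm_mult norm_of_real norm_cis mult_1_right)
    also have "\<dots> \<le> - \<rho>"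
    proof -
      have "exp \<rho> \<le> 1" using \<rho> by simp
      then show ?thesis using exp_ge_add_one_self[of \<rho>] by linarith
    qed
    also have "\<dots> < \<delta>" using \<rho> \<delta>(1) by (auto simp: \<rho>\<^sub>1_def)
    finally show ?thesis
      using \<delta>(2)[of "exp (Complex \<rho> x)"] f_exp_k[of "Complex \<rho> x"] \<rho>
      by (auto simp: \<rho>\<^sub>1_def norm_exp_eq_Re dist_norm)
  qed
  moreover have "\<rho>\<^sub>1 \<in> {b..<0}" using neg \<delta>(1) by (auto simp: \<rho>\<^sub>1_def)
  ultimately show ?thesis by blast
qed

lemma crosses_imp_radial_limit:
  assumes cross: "crosses x c d" and "c < d" "e > 0"
  shows "\<exists>r\<^sub>0<0. \<forall>r\<in>{r\<^sub>0..<0}. \<bar>f (exp (Complex r ((c + d) / 2))) $ j - \<Phi> (cis x) $ j\<bar> \<le> e"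
proof -
  have "harmonic_on (\<lambda>z. f z $ j) (ball 0 1)" using harmonic by (simp add: harmonic_map_on_def)
  then obtain g where g: "g holomorphic_on ball 0 1" "\<And>z. z \<in> ball 0 1 \<Longrightarrow> f z $ j = Re (g z)"
    using harmonic_on_imp_Re_holomorphic[of _ "ball 0 1"] convex_ball by blast
  obtain B where B: "\<And>z. z \<in> ball 0 1 \<Longrightarrow> norm (f z) \<le> B" using bdd unfolding bounded_iff by blast
  define L where "L = \<Phi> (cis x) $ j"
  define M where "M = B + \<bar>L\<bar>"
  have M: "\<bar>Re (g z) - L\<bar> \<le> M" if "z \<in> ball 0 1" for z
    using B[OF that] component_le_norm_cart[of "f z" j] g(2)[OF that] by (simp add: M_def)
  have "0 \<le> M" using M[of 0] by simp
  \<comment> \<open>for \<open>r\<close> above this value \<open>crosses_imp_radial_bound\<close> applies and its bound is at most \<open>e\<close>\<close>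
  define r\<^sub>0 where "r\<^sub>0 = - (min ((d - c) / 4) (e * (d - c) / (4 * M + 1)))"
  have r0: "r\<^sub>0 < 0" using \<open>c < d\<close> \<open>e > 0\<close> \<open>0 \<le> M\<close> by (auto simp: r\<^sub>0_def)
  have "\<bar>f (exp (Complex r ((c + d) / 2))) $ j - \<Phi> (cis x) $ j\<bar> \<le> e" if r: "r \<in> {r\<^sub>0..<0}" for r
  proof -
    let ?w = "Complex r ((c + d) / 2)"
    have bound: "s * (Re (g (exp ?w)) - L) \<le> e" if s: "s = 1 \<or> s = -1" for s :: real
    proof -
      have lim: "\<exists>\<rho>\<^sub>1\<in>{b..<0}. \<forall>\<rho>\<in>{\<rho>\<^sub>1..<0}. Re (of_real s * (g (exp (k (Complex \<rho> x))) - of_real L)) \<le> e'"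
        if e': "e' > 0" for e'
      proof -
        obtain \<rho>\<^sub>1 where \<rho>\<^sub>1: "\<rho>\<^sub>1\<in>{b..<0}"
          "\<And>\<rho>. \<rho> \<in> {\<rho>\<^sub>1..<0} \<Longrightarrow> norm (f (exp (k (Complex \<rho> x))) - \<Phi> (cis x)) \<le> e'"
          using f_exp_k_tendsto[OF e'] by blast
        have "Re (of_real s * (g (exp (k (Complex \<rho> x))) - of_real L)) \<le> e'" if \<rho>: "\<rho> \<in> {\<rho>\<^sub>1..<0}" for \<rho>
        proof -
          have "exp (k (Complex \<rho> x)) \<in> ball 0 1"
            using k_range[of "Complex \<rho> x"] \<rho> \<rho>\<^sub>1(1) by (auto simp: norm_exp_eq_Re)
          from g(2)[OF this] have "\<bar>Re (g (exp (k (Complex \<rho> x)))) - L\<bar> \<le> e'"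
            using \<rho>\<^sub>1(2)[OF \<rho>] component_le_norm_cart[of "f (exp (k (Complex \<rho> x))) - \<Phi> (cis x)" j]
            by (simp add: L_def)
          then show ?thesis using s by auto
        qed
        then show ?thesis using \<rho>\<^sub>1(1) by blast
      qed
      have "Re (of_real s * (g (exp ?w) - of_real L)) \<le> 4 * M / (d - c) * (- r)"
      proof (rule crosses_imp_radial_bound[OF cross \<open>c < d\<close> _ _ \<open>0 \<le> M\<close> lim])
        show "(\<lambda>z. of_real s * (g z - of_real L)) holomorphic_on ball 0 1" by (intro holomorphic_intros g)
        show "Re (of_real s * (g z - of_real L)) \<le> M" if "z \<in> ball 0 1" for z using M[OF that] s by auto
        show "- ((d - c) / 2) < r" "r < 0" using r \<open>c < d\<close> by (auto simp: r\<^sub>0_def)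
      qed
      also have "\<dots> \<le> 4 * M / (d - c) * (e * (d - c) / (4 * M + 1))"
        using r \<open>c < d\<close> \<open>0 \<le> M\<close> by (intro mult_left_mono) (auto simp: r\<^sub>0_def)
      also have "\<dots> = e * (4 * M / (4 * M + 1))" using \<open>c < d\<close> by simp
      also have "\<dots> \<le> e * 1" using \<open>0 \<le> M\<close> \<open>e > 0\<close> by (intro mult_left_mono) auto
      finally show ?thesis by simp
    qed
    have "exp ?w \<in> ball 0 1" using r by (simp add: norm_exp_eq_Re)
    from g(2)[OF this] show ?thesis using bound[of 1] bound[of "-1"] by (simp add: L_def abs_le_iff)
  qed
  then show ?thesis using r0 by blast
qed

text \<open>Both \<open>\<Phi> (cis x)\<close> and \<open>\<Phi> (cis y)\<close> are the radial limit of \<open>f\<close> at the midpoint of the arc.\<close>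

lemma crosses_both_imp_eq:
  assumes "crosses x c d" "crosses y c d" "c < d"
  shows "cis x = cis y"
proof -
  have "\<Phi> (cis x) $ j = \<Phi> (cis y) $ j" for j
  proof -
    have "\<bar>\<Phi> (cis x) $ j - \<Phi> (cis y) $ j\<bar> \<le> 0 + e" if "e > 0" for e
    proof -
      have "e / 2 > 0" using that by simp
      then obtain r s where rs: "r < 0" "s < 0"
        "\<And>t. t \<in> {r..<0} \<Longrightarrow> \<bar>f (exp (Complex t ((c + d) / 2))) $ j - \<Phi> (cis x) $ j\<bar> \<le> e / 2"
        "\<And>t. t \<in> {s..<0} \<Longrightarrow> \<bar>f (exp (Complex t ((c + d) / 2))) $ j - \<Phi> (cis y) $ j\<bar> \<le> e / 2"
        using crosses_imp_radial_limit[OF assms(1,3), of "e / 2" j] crosses_imp_radial_limit[OF assms(2,3), of "e / 2" j]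
        by blast
      have "max r s \<in> {r..<0}" "max r s \<in> {s..<0}" using rs(1,2) by auto
      from rs(3)[OF this(1)] rs(4)[OF this(2)] show ?thesis by linarith
    qed
    then have "\<bar>\<Phi> (cis x) $ j - \<Phi> (cis y) $ j\<bar> \<le> 0" by (rule field_le_epsilon)
    then show ?thesis by simp
  qed
  then have "\<Phi> (cis x) = \<Phi> (cis y)" by (simp add: vec_eq_iff)
  then show ?thesis using \<Phi>_inj by (auto simp: inj_on_def)
qed

sublocale noncrossing_lift
proof
  fix x y c d :: real
  assume xy: "x < y" "y < x + 2 * pi" and "c < d"
  show "\<not> (crosses x c d \<and> crosses y c d)"
  proof
    assume "crosses x c d \<and> crosses y c d"
    then have "cis x = cis y" using crosses_both_imp_eq \<open>c < d\<close> by blast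
    then have "sin y = sin x \<and> cos y = cos x" by (simp add: complex_eq_iff)
    then obtain n :: int where n: "y = x + 2 * pi * n" unfolding sin_cos_eq_iff by auto
    then have "0 < 2 * pi * of_int n" "2 * pi * of_int n < 2 * pi" using xy by auto
    then have "0 < n" "n < 1" by (simp_all add: zero_less_mult_iff)
    then show False by simp
  qed
qed

text \<open>The limit of \<open>h\<close> at \<open>\<i> t\<close> is transported to the disk by the branch of the logarithm near \<open>cis t\<close> with value
\<open>\<i> t\<close> there.\<close>

lemma regular_boundary_limit:
  assumes "regular t"
  shows "(f \<longlongrightarrow> \<Phi> (cis (bdry t))) (at (cis t) within ball 0 1)"
proof -
  let ?H = "{w. Re w < 0}"
  have h_lim: "(h \<longlongrightarrow> Complex 0 (bdry t)) (at (\<i> * t) within ?H)"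
  proof (rule tendstoI)
    fix e :: real assume "e > 0"
    then have "e / 2 > 0" by simp
    obtain a1 \<delta> where a1: "a1 \<in> {a..<0}" "\<delta> > 0"
      "\<And>w. a1 \<le> Re w \<and> Re w < 0 \<and> \<bar>Im w - t\<bar> < \<delta> \<Longrightarrow> \<bar>Im (h w) - bdry t\<bar> < e / 2"
      using regular_angle_limit[OF assms \<open>e / 2 > 0\<close>] by blast
    obtain a2 where a2: "a2 \<in> {a..<0}" "\<And>w. a2 \<le> Re w \<and> Re w < 0 \<Longrightarrow> - (e / 2) < Re (h w)"
      using h_proper[of "- (e / 2)"] \<open>e > 0\<close> by auto
    have "dist (h w) (Complex 0 (bdry t)) < e"
      if w: "w \<in> ?H" "dist w (\<i> * t) < min \<delta> (min (- a1) (- a2))" for w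
    proof -
      have "\<bar>Re w\<bar> \<le> dist w (\<i> * t)" "\<bar>Im w - t\<bar> \<le> dist w (\<i> * t)"
        using abs_Re_le_cmod[of "w - \<i> * t"] abs_Im_le_cmod[of "w - \<i> * t"] by (simp_all add: dist_norm)
      then have w': "a1 \<le> Re w" "a2 \<le> Re w" "Re w < 0" "\<bar>Im w - t\<bar> < \<delta>" using w by auto
      have "cmod (h w - Complex 0 (bdry t)) \<le> \<bar>Re (h w)\<bar> + \<bar>Im (h w) - bdry t\<bar>"
        using cmod_le[of "h w - Complex 0 (bdry t)"] by simp
      also have "\<dots> < e / 2 + e / 2"
        using a1(3)[of w] a2(2)[of w] h_neg[of w] w' a1(1) by (intro add_strict_mono) auto
      finally show ?thesis by (simp add: dist_norm)
    qed
    then show "eventually (\<lambda>w. dist (h w) (Complex 0 (bdry t)) < e) (at (\<i> * t) within ?H)"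
      unfolding eventually_at using a1 a2 by (intro exI[of _ "min \<delta> (min (- a1) (- a2))"]) auto
  qed
  define w where "w z = \<i> * t + Ln (z * cis (- t))" for z
  have exp_w: "exp (w z) = z" if "z \<noteq> 0" for z
    using that by (simp add: w_def exp_add cis_conv_exp mult.commute exp_minus)
  have ev: "eventually (\<lambda>z. z \<in> ball 0 1 \<and> z \<noteq> 0) (at (cis t) within ball 0 1)"
    unfolding eventually_at by (intro exI[of _ 1]) auto
  have Re_w: "Re (w z) < 0" if "z \<in> ball 0 1" "z \<noteq> 0" for z
  proof -
    have "exp (Re (w z)) < exp 0" using exp_w[OF that(2)] that(1) by (metis norm_exp_eq_Re exp_zero mem_ball_0)
    then show ?thesis by simp
  qed
  have "isCont w (cis t)"
    unfolding w_def by (intro continuous_intros) (simp add: cis_mult)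
  then have "(w \<longlongrightarrow> w (cis t)) (at (cis t) within ball 0 1)"
    using continuous_at_imp_continuous_at_within continuous_within by blast
  also have "w (cis t) = \<i> * t" by (simp add: w_def cis_mult)
  finally have w_tendsto: "(w \<longlongrightarrow> \<i> * t) (at (cis t) within ball 0 1)" .
  have "eventually (\<lambda>z. w z \<in> ?H \<and> w z \<noteq> \<i> * t) (at (cis t) within ball 0 1)"
    using ev
  proof eventually_elim
    case (elim z)
    then show ?case using Re_w[of z] by (metis (mono_tags) mem_Collect_eq Re_i_times Im_complex_of_real less_irrefl neg_0_equal_iff_equal)
  qed
  with w_tendsto have w_lim: "filterlim w (at (\<i> * t) within ?H) (at (cis t) within ball 0 1)"
    unfolding filterlim_at by blast
  have "((\<lambda>z. exp (h (w z))) \<longlongrightarrow> exp (Complex 0 (bdry t))) (at (cis t) within ball 0 1)"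
    by (intro tendsto_exp filterlim_compose[OF h_lim w_lim])
  moreover have near: "eventually (\<lambda>z. z \<in> ball 0 1 \<and> z \<noteq> 0 \<and> a \<le> Re (w z)) (at (cis t) within ball 0 1)"
  proof -
    have "((\<lambda>z. Re (w z)) \<longlongrightarrow> Re (\<i> * t)) (at (cis t) within ball 0 1)"
      by (intro tendsto_Re w_tendsto)
    then have "eventually (\<lambda>z. a < Re (w z)) (at (cis t) within ball 0 1)"
      by (rule order_tendstoD) (use neg in auto)
    with ev show ?thesis by eventually_elim auto
  qed
  ultimately have "((\<lambda>z. \<Phi> (exp (h (w z)))) \<longlongrightarrow> \<Phi> (exp (Complex 0 (bdry t)))) (at (cis t) within ball 0 1)"
    by (intro continuous_on_tendsto_compose[OF \<Phi>_cont])
       (auto elim!: eventually_mono simp: norm_exp_eq_Re intro!: less_imp_le h_neg Re_w)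
  moreover have "eventually (\<lambda>z. \<Phi> (exp (h (w z))) = f z) (at (cis t) within ball 0 1)"
    using near by eventually_elim (use f_lift Re_w exp_w in \<open>metis (full_types)\<close>)
  moreover have "exp (Complex 0 (bdry t)) = cis (bdry t)" by (simp add: exp_eq_polar)
  ultimately show ?thesis using Lim_transform_eventually by fastforce
qed

end

section \<open>Comparison of the lengths\<close>

context harmonic_lift
begin

text \<open>On the circle of radius \<open>exp \<rho>\<close> the angle of \<open>F\<close> is a continuous function \<open>\<theta>\<close> that grows by \<open>2 \<pi>\<close> in one turn. By
the intermediate value theorem it takes the values \<open>t\<^sub>i\<close> at increasing arguments \<open>s\<^sub>i\<close> within one turn. There \<open>F\<close> is
close to the points \<open>cis t\<^sub>i\<close>, because it is close to the circle.\<close>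

lemma polygon_le_circle_image_length:
  fixes t :: "nat \<Rightarrow> real"
  assumes t: "t 0 = 0" "t n = 2 * pi" "mono_on {..n} t" and "e > 0"
  shows "\<exists>r\<^sub>0<1. \<forall>r. r\<^sub>0 < r \<and> r < 1 \<longrightarrow>
    (\<Sum>i<n. dist (\<Phi> (cis (t i))) (\<Phi> (cis (t (Suc i))))) \<le> curve_length 0 (2 * pi) (circle_image f r) + ennreal e"
proof -
  \<comment> \<open>the \<open>n\<close> edges have two ends each; adding one avoids division by zero\<close>
  define e' where "e' = e / (2 * (real n + 1))"
  have e': "e' > 0" "2 * real n * e' \<le> e" using \<open>e > 0\<close> by (auto simp: e'_def field_simps)
  have "uniformly_continuous_on (cball 0 1) \<Phi>" by (rule compact_uniformly_continuous[OF \<Phi>_cont compact_cball])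
  then obtain \<delta> where \<delta>: "\<delta> > 0"
    "\<And>z w. cmod z \<le> 1 \<Longrightarrow> cmod w \<le> 1 \<Longrightarrow> dist w z < \<delta> \<Longrightarrow> dist (\<Phi> w) (\<Phi> z) < e'"
    unfolding uniformly_continuous_on_def using e'(1) by (metis mem_cball_0)
  obtain a' where a': "a' \<in> {a..<0}" "\<And>w. a' \<le> Re w \<Longrightarrow> Re w < 0 \<Longrightarrow> - \<delta> < Re (h w)"
    using h_proper[of "- \<delta>"] \<delta>(1) by auto
  have main: "(\<Sum>i<n. dist (\<Phi> (cis (t i))) (\<Phi> (cis (t (Suc i))))) \<le> curve_length 0 (2 * pi) (circle_image f (exp \<rho>)) + ennreal e"
    if \<rho>: "a' \<le> \<rho>" "\<rho> < 0" for \<rho>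
  proof -
    define \<theta> where "\<theta> s = Im (h (Complex \<rho> s))" for s
    have r: "a \<le> \<rho>" "\<rho> < 0" using \<rho> a'(1) by auto
    have \<theta>_shift: "\<theta> (s + 2 * pi) = \<theta> s + 2 * pi" for s
      using h_angle_shift[OF r, of s 1] by (simp add: \<theta>_def)
    have \<theta>_cont: "continuous_on S \<theta>" for S unfolding \<theta>_def by (rule h_angle_cont[OF r])
    \<comment> \<open>turning back \<open>N\<close> times makes the angle nonpositive, so that the value \<open>0\<close> is attained later\<close>
    define N where "N = \<lceil>\<theta> 0 / (2 * pi)\<rceil>"
    have "\<theta> 0 / (2 * pi) \<le> of_int N" by (simp add: N_def)
    then have "\<theta> (0 + 2 * pi * of_int (- N)) \<le> 0"
      using h_angle_shift[OF r, of 0 "- N"] by (simp add: \<theta>_def field_simps)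
    then obtain s\<^sub>0 where s0: "\<theta> s\<^sub>0 = 0" using h_angle_surj[OF r] unfolding \<theta>_def by blast
    have "\<exists>s. s 0 = s\<^sub>0 \<and> (\<forall>i\<le>m. \<theta> (s i) = t i \<and> s i \<le> s\<^sub>0 + 2 * pi) \<and> (\<forall>i<m. s i \<le> s (Suc i))" if "m \<le> n" for m
      using that
    proof (induction m)
      case 0
      show ?case using s0 t(1) by (intro exI[of _ "\<lambda>_. s\<^sub>0"]) auto
    next
      case (Suc m)
      then obtain s where s: "s 0 = s\<^sub>0" "\<And>i. i \<le> m \<Longrightarrow> \<theta> (s i) = t i \<and> s i \<le> s\<^sub>0 + 2 * pi"
        "\<And>i. i < m \<Longrightarrow> s i \<le> s (Suc i)" by auto
      have "t m \<le> t (Suc m)" "t (Suc m) \<le> 2 * pi"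
        using monotone_onD[OF t(3), of m "Suc m"] monotone_onD[OF t(3), of "Suc m" n] Suc.prems t(2) by auto
      then have "\<exists>x\<ge>s m. x \<le> s\<^sub>0 + 2 * pi \<and> \<theta> x = t (Suc m)"
        using s(2)[of m] \<theta>_shift[of s\<^sub>0] s0 by (intro IVT' \<theta>_cont) auto
      then obtain x where x: "s m \<le> x" "x \<le> s\<^sub>0 + 2 * pi" "\<theta> x = t (Suc m)" by blast
      define s' where "s' = s (Suc m := x)"
      have "s' 0 = s\<^sub>0" using s(1) by (simp add: s'_def)
      moreover have "\<theta> (s' i) = t i \<and> s' i \<le> s\<^sub>0 + 2 * pi" if "i \<le> Suc m" for i
        using that s(2)[of i] x by (cases "i = Suc m") (auto simp: s'_def)
      moreover have "s' i \<le> s' (Suc i)" if "i < Suc m" for i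
        using that s(3)[of i] x by (cases "i = m") (auto simp: s'_def)
      ultimately show ?case by blast
    qed
    from this[of n] obtain s where s: "s 0 = s\<^sub>0" "\<And>i. i \<le> n \<Longrightarrow> \<theta> (s i) = t i \<and> s i \<le> s\<^sub>0 + 2 * pi"
      "\<And>i. i < n \<Longrightarrow> s i \<le> s (Suc i)" by auto
    \<comment> \<open>lengthening the polygon by the end point of the period only increases it\<close>
    define u where "u i = (if i \<le> n then s i else s\<^sub>0 + 2 * pi)" for i
    have u_mono: "u i \<le> u (Suc i)" for i using s(2)[of i] s(3)[of i] by (auto simp: u_def)
    have "mono_on {..Suc n} u" using lift_Suc_mono_le[of u] u_mono by (auto simp: monotone_on_def)
    let ?\<gamma> = "circle_image f (exp \<rho>)"
    have "(\<Sum>i<n. ennreal (dist (?\<gamma> (s i)) (?\<gamma> (s (Suc i))))) = (\<Sum>i<n. ennreal (dist (?\<gamma> (u i)) (?\<gamma> (u (Suc i)))))"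
      by (intro sum.cong) (auto simp: u_def)
    also have "\<dots> \<le> (\<Sum>i<Suc n. ennreal (dist (?\<gamma> (u i)) (?\<gamma> (u (Suc i)))))" by simp
    also have "\<dots> \<le> curve_length s\<^sub>0 (s\<^sub>0 + 2 * pi) ?\<gamma>"
      using polygon_le_curve_length[OF \<open>mono_on {..Suc n} u\<close>, of ?\<gamma>] s(1) by (simp add: u_def)
    also have "\<dots> \<le> curve_length 0 (2 * pi) ?\<gamma>"
      by (rule curve_length_periodic_shift_le) (simp_all add: circle_image_def rcis_def cis_mult[symmetric] flip: cis_mult)
    finally have len: "(\<Sum>i<n. ennreal (dist (?\<gamma> (s i)) (?\<gamma> (s (Suc i))))) \<le> curve_length 0 (2 * pi) ?\<gamma>" .
    have close: "dist (?\<gamma> (s i)) (\<Phi> (cis (t i))) \<le> e'" if "i \<le> n" for i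
    proof -
      let ?w = "Complex \<rho> (s i)"
      have Re_h: "- \<delta> < Re (h ?w)" "Re (h ?w) < 0" using a'(2)[of ?w] h_neg[of ?w] \<rho> r by auto
      have "?\<gamma> (s i) = f (exp ?w)" by (simp add: circle_image_def rcis_def exp_eq_polar)
      also have "\<dots> = \<Phi> (exp (h ?w))" using f_lift[of ?w] r by simp
      finally have eq: "?\<gamma> (s i) = \<Phi> (exp (h ?w))" .
      have "exp (h ?w) = of_real (exp (Re (h ?w))) * cis (t i)"
        using s(2)[OF that] by (simp add: exp_eq_polar \<theta>_def)
      then have "exp (h ?w) - cis (t i) = of_real (exp (Re (h ?w)) - 1) * cis (t i)" by (simp add: algebra_simps)
      then have "dist (exp (h ?w)) (cis (t i)) = \<bar>exp (Re (h ?w)) - 1\<bar>"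
        by (simp only: dist_norm norm_mult norm_of_real norm_cis mult_1_right)
      moreover have "exp (Re (h ?w)) < 1" using Re_h by simp
      moreover have "1 - \<delta> < exp (Re (h ?w))" using exp_ge_add_one_self[of "Re (h ?w)"] Re_h by linarith
      ultimately have "dist (exp (h ?w)) (cis (t i)) < \<delta>" by linarith
      then show ?thesis using \<delta>(2)[of "cis (t i)" "exp (h ?w)"] Re_h unfolding eq
        by (simp add: norm_exp_eq_Re)
    qed
    have "(\<Sum>i<n. dist (\<Phi> (cis (t i))) (\<Phi> (cis (t (Suc i))))) \<le> (\<Sum>i<n. dist (?\<gamma> (s i)) (?\<gamma> (s (Suc i))) + 2 * e')"
    proof (rule sum_mono)
      fix i assume "i \<in> {..<n}"
      then have "dist (?\<gamma> (s i)) (\<Phi> (cis (t i))) \<le> e'" "dist (?\<gamma> (s (Suc i))) (\<Phi> (cis (t (Suc i)))) \<le> e'"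
        using close by auto
      moreover have "dist (\<Phi> (cis (t i))) (\<Phi> (cis (t (Suc i)))) \<le>
          dist (?\<gamma> (s i)) (\<Phi> (cis (t i))) + dist (?\<gamma> (s i)) (?\<gamma> (s (Suc i))) + dist (?\<gamma> (s (Suc i))) (\<Phi> (cis (t (Suc i))))"
        by metric
      ultimately show "dist (\<Phi> (cis (t i))) (\<Phi> (cis (t (Suc i)))) \<le> dist (?\<gamma> (s i)) (?\<gamma> (s (Suc i))) + 2 * e'" by linarith
    qed
    also have "\<dots> = (\<Sum>i<n. dist (?\<gamma> (s i)) (?\<gamma> (s (Suc i)))) + 2 * real n * e'" by (simp add: sum.distrib)
    also have "\<dots> \<le> (\<Sum>i<n. dist (?\<gamma> (s i)) (?\<gamma> (s (Suc i)))) + e" using e'(2) by simp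
    finally have "ennreal (\<Sum>i<n. dist (\<Phi> (cis (t i))) (\<Phi> (cis (t (Suc i))))) \<le> ennreal ((\<Sum>i<n. dist (?\<gamma> (s i)) (?\<gamma> (s (Suc i)))) + e)"
      by (rule ennreal_leI)
    also have "\<dots> = (\<Sum>i<n. ennreal (dist (?\<gamma> (s i)) (?\<gamma> (s (Suc i))))) + ennreal e"
      using \<open>e > 0\<close> by (simp add: sum_nonneg sum_ennreal)
    also have "\<dots> \<le> curve_length 0 (2 * pi) ?\<gamma> + ennreal e" by (intro add_right_mono len)
    finally show ?thesis .
  qed
  show ?thesis
  proof (intro exI[of _ "exp a'"] conjI allI impI)
    show "exp a' < 1" using a'(1) by simp
    fix r assume r: "exp a' < r \<and> r < 1"
    then have "0 < r" using exp_gt_zero[of a'] by linarith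
    moreover from this have "a' \<le> ln r" "ln r < 0" using r by (simp_all add: ln_ge_iff)
    ultimately show "(\<Sum>i<n. dist (\<Phi> (cis (t i))) (\<Phi> (cis (t (Suc i))))) \<le> curve_length 0 (2 * pi) (circle_image f r) + ennreal e"
      using main[of "ln r"] by simp
  qed
qed

lemma eventually_less_circle_image_length:
  assumes "y < curve_length 0 (2 * pi) (boundary_curve \<Phi>)"
  shows "\<exists>r\<^sub>0<1. \<forall>r. r\<^sub>0 < r \<and> r < 1 \<longrightarrow> y < curve_length 0 (2 * pi) (circle_image f r)"
proof -
  obtain n and t :: "nat \<Rightarrow> real" where t: "t 0 = 0" "t n = 2 * pi" "mono_on {..n} t"
    and less: "y < (\<Sum>i<n. ennreal (dist (\<Phi> (cis (t i))) (\<Phi> (cis (t (Suc i))))))"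
    using assms unfolding curve_length_def less_SUP_iff boundary_curve_def by auto
  define A where "A = (\<Sum>i<n. dist (\<Phi> (cis (t i))) (\<Phi> (cis (t (Suc i)))))"
  have "A \<ge> 0" unfolding A_def by (intro sum_nonneg) auto
  have yA: "y < ennreal A" using less by (simp add: A_def sum_ennreal)
  then obtain y' where y': "y = ennreal y'" "0 \<le> y'" "y' < A"
    using \<open>A \<ge> 0\<close> by (cases y) (auto simp: ennreal_less_iff)
  define e where "e = (A - y') / 2"
  have "e > 0" using y' by (simp add: e_def)
  obtain r\<^sub>0 where r0: "r\<^sub>0 < 1" "\<And>r. r\<^sub>0 < r \<Longrightarrow> r < 1 \<Longrightarrow> ennreal A \<le> curve_length 0 (2 * pi) (circle_image f r) + ennreal e"
    using polygon_le_circle_image_length[OF t \<open>e > 0\<close>] unfolding A_def by blast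
  have "y < curve_length 0 (2 * pi) (circle_image f r)" if "r\<^sub>0 < r" "r < 1" for r
  proof (rule ccontr)
    assume "\<not> y < curve_length 0 (2 * pi) (circle_image f r)"
    then have "ennreal A \<le> y + ennreal e" using r0(2)[OF that] by (meson add_right_mono not_less order_trans)
    also have "\<dots> = ennreal (y' + e)" using y' \<open>e > 0\<close> by simp
    finally have "A \<le> y' + e" using y' \<open>e > 0\<close> by (subst (asm) ennreal_le_iff) auto
    then show False using y'(3) by (simp add: e_def field_simps)
  qed
  then show ?thesis using r0(1) by blast
qed

lemma circle_image_length_le:
  assumes "0 < r" "r < 1"
  shows "curve_length 0 (2 * pi) (circle_image f r) \<le> curve_length 0 (2 * pi) (boundary_curve \<Phi>)"
proof (rule boundary_values_length_bound[OF harmonic bdd countable_not_regular])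
  show "(f \<longlongrightarrow> boundary_curve \<Phi> (bdry t)) (at (cis t) within ball 0 1)" if "t \<notin> {t. \<not> regular t}" for t
    using regular_boundary_limit[of t] that by (simp add: boundary_curve_def)
  show "boundary_curve \<Phi> (t + 2 * pi) = boundary_curve \<Phi> t" for t
    by (simp add: boundary_curve_def flip: cis_mult)
  show "mono bdry" by (simp add: mono_def bdry_mono)
qed (use assms bdry_shift in auto)

end

text \<open>Conjugation reverses the boundary curve.\<close>

lemma length_boundary_curve_cnj_le:
  "curve_length 0 (2 * pi) (boundary_curve (\<lambda>z. \<Phi> (cnj z))) \<le> curve_length 0 (2 * pi) (boundary_curve \<Phi>)"
proof -
  have "boundary_curve (\<lambda>z. \<Phi> (cnj z)) t = boundary_curve \<Phi> (0 + 2 * pi - t)" for t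
  proof -
    have "cnj (cis t) = cis (2 * pi - t)" by (simp add: complex_eq_iff)
    then show ?thesis by (simp add: boundary_curve_def)
  qed
  then have "boundary_curve (\<lambda>z. \<Phi> (cnj z)) = (\<lambda>t. boundary_curve \<Phi> (0 + 2 * pi - t))" by blast
  then show ?thesis using curve_length_reverse_le[of 0 "2 * pi" "boundary_curve \<Phi>"] by simp
qed

theorem theorem2p10:
  fixes \<Phi> f :: "complex \<Rightarrow> real ^ 'n" and \<Sigma> \<Gamma> :: "(real ^ 'n) set"
  assumes surface: "jordan_surface \<Phi> \<Sigma> \<Gamma>"
    and harmonic: "harmonic_map_on f (ball 0 1)"
    and homeo: "\<exists>g. homeomorphism (ball 0 1) (\<Sigma> - \<Gamma>) f g"
  shows "(angular_deriv f \<in> hardy_h1 \<longleftrightarrow> rectifiable 0 (2 * pi) (boundary_curve \<Phi>)) \<and>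
         (rectifiable 0 (2 * pi) (boundary_curve \<Phi>) \<longrightarrow>
           ((\<lambda>r. curve_length 0 (2 * pi) (circle_image f r)) \<longlongrightarrow>
             curve_length 0 (2 * pi) (boundary_curve \<Phi>)) (at_left 1))"
proof -
  obtain \<Psi> where \<Psi>: "homeomorphism (cball 0 1) \<Sigma> \<Phi> \<Psi>" and \<Gamma>: "\<Gamma> = \<Phi> ` sphere 0 1"
    using surface unfolding jordan_surface_def by blast
  obtain g where g: "homeomorphism (ball 0 1) (\<Sigma> - \<Gamma>) f g" using homeo by blast
  have \<Phi>_inj: "inj_on \<Phi> (cball 0 1)" using \<Psi> by (metis homeomorphism_def inj_on_inverseI)
  have \<Phi>_cont: "continuous_on (cball 0 1) \<Phi>" using \<Psi> by (simp add: homeomorphism_def)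
  have "cball 0 1 - sphere 0 1 = (ball 0 1 :: complex set)" by auto
  then have "\<Phi> ` ball 0 1 = \<Sigma> - \<Gamma>"
    using inj_on_image_set_diff[OF \<Phi>_inj, of "cball 0 1" "sphere 0 1"] \<Psi> \<Gamma>
    by (metis homeomorphism_image1 sphere_cball Diff_subset)
  then have \<Psi>': "homeomorphism (\<Sigma> - \<Gamma>) (ball 0 1) \<Psi> \<Phi>"
    using homeomorphism_of_subsets[OF \<Psi>, of "ball 0 1" _ "\<Sigma> - \<Gamma>"] by (auto intro: homeomorphism_symD)
  have hom: "homeomorphism (ball 0 1) (ball 0 1) (\<Psi> \<circ> f) (g \<circ> \<Phi>)"
    by (rule homeomorphism_compose[OF g \<Psi>'])
  obtain \<sigma> a b h k where \<sigma>: "\<sigma> = id \<or> \<sigma> = cnj" and lift: "annulus_lift a b h k"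
    and exp_h: "\<And>w. a \<le> Re w \<Longrightarrow> Re w < 0 \<Longrightarrow> exp (h w) = \<sigma> ((\<Psi> \<circ> f) (exp w))"
    using ball_homeomorphism_lift[OF hom] by blast
  \<comment> \<open>if \<open>F\<close> reverses orientation, both \<open>F\<close> and the parametrization of the surface are conjugated\<close>
  define \<Phi>' where "\<Phi>' z = \<Phi> (\<sigma> z)" for z
  have \<sigma>': "\<sigma> (\<sigma> z) = z" "cmod (\<sigma> z) = cmod z" for z using \<sigma> by auto
  have len: "curve_length 0 (2 * pi) (boundary_curve \<Phi>') = curve_length 0 (2 * pi) (boundary_curve \<Phi>)"
  proof (cases "\<sigma> = id")
    case False
    then have "\<Phi>' = (\<lambda>z. \<Phi> (cnj z))" "(\<lambda>z. \<Phi>' (cnj z)) = \<Phi>" using \<sigma> by (auto simp: \<Phi>'_def fun_eq_iff)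
    then show ?thesis using length_boundary_curve_cnj_le[of \<Phi>] length_boundary_curve_cnj_le[of \<Phi>'] by simp
  qed (simp add: \<Phi>'_def[abs_def])
  interpret harmonic_lift a b h k f \<Phi>'
  proof (rule harmonic_lift.intro[OF lift], unfold_locales)
    show "harmonic_map_on f (ball 0 1)" by (rule harmonic)
    have "compact \<Sigma>" using \<Psi> by (metis compact_cball compact_continuous_image homeomorphism_def)
    moreover have "f ` ball 0 1 \<subseteq> \<Sigma>" using homeomorphism_image1[OF g] by blast
    ultimately show "bounded (f ` ball 0 1)" using bounded_subset compact_imp_bounded by blast
    have "continuous_on (cball 0 1) \<sigma>" using \<sigma> by (auto intro: continuous_intros simp: id_def)
    then show "continuous_on (cball 0 1) \<Phi>'" unfolding \<Phi>'_def
      by (intro continuous_on_compose2[OF \<Phi>_cont]) (use \<sigma>' in auto)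
    show "inj_on \<Phi>' (cball 0 1)"
    proof (rule inj_onI)
      fix z w :: complex assume "z \<in> cball 0 1" "w \<in> cball 0 1" "\<Phi>' z = \<Phi>' w"
      then have "\<sigma> z = \<sigma> w" using inj_onD[OF \<Phi>_inj, of "\<sigma> z" "\<sigma> w"] \<sigma>' by (auto simp: \<Phi>'_def)
      then show "z = w" using \<sigma>'(1) by metis
    qed
    fix w :: complex assume w: "a \<le> Re w" "Re w < 0"
    have "f (exp w) \<in> \<Sigma>" using homeomorphism_image1[OF g] w by (force simp: norm_exp_eq_Re)
    then show "f (exp w) = \<Phi>' (exp (h w))"
      using exp_h[OF w] homeomorphism_apply2[OF \<Psi>] \<sigma>' by (simp add: \<Phi>'_def)
  qed
  let ?L = "\<lambda>r. curve_length 0 (2 * pi) (circle_image f r)"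
  have upper: "?L r \<le> curve_length 0 (2 * pi) (boundary_curve \<Phi>)" if "0 < r" "r < 1" for r
    using circle_image_length_le[OF that] len by simp
  have lower: "\<exists>r\<^sub>0<1. \<forall>r. r\<^sub>0 < r \<and> r < 1 \<longrightarrow> y < ?L r" if "y < curve_length 0 (2 * pi) (boundary_curve \<Phi>)" for y
    using eventually_less_circle_image_length[of y] that len by simp
  have hardy: "angular_deriv f \<in> hardy_h1 \<longleftrightarrow> (SUP r\<in>{0<..<1}. ?L r) < \<infinity>"
    unfolding hardy_h1_def using angular_deriv_harmonic[OF harmonic] by (simp cong: SUP_cong_simp)
  have SUP_eq: "(SUP r\<in>{0<..<1}. ?L r) = curve_length 0 (2 * pi) (boundary_curve \<Phi>)"
  proof (rule antisym)
    show "(SUP r\<in>{0<..<1}. ?L r) \<le> curve_length 0 (2 * pi) (boundary_curve \<Phi>)"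
      by (intro SUP_least) (use upper in auto)
    show "curve_length 0 (2 * pi) (boundary_curve \<Phi>) \<le> (SUP r\<in>{0<..<1}. ?L r)"
    proof (rule dense_le)
      fix y assume "y < curve_length 0 (2 * pi) (boundary_curve \<Phi>)"
      then obtain r\<^sub>0 where "r\<^sub>0 < 1" and r0: "\<And>r. r\<^sub>0 < r \<Longrightarrow> r < 1 \<Longrightarrow> y < ?L r" using lower by blast
      obtain r where "max r\<^sub>0 0 < r" "r < 1" using dense[of "max r\<^sub>0 0" 1] \<open>r\<^sub>0 < 1\<close> by auto
      then show "y \<le> (SUP r\<in>{0<..<1}. ?L r)" using r0[of r] by (intro SUP_upper2[of r]) auto
    qed
  qed
  have "(?L \<longlongrightarrow> curve_length 0 (2 * pi) (boundary_curve \<Phi>)) (at_left 1)"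
  proof (rule order_tendstoI)
    fix y assume "y < curve_length 0 (2 * pi) (boundary_curve \<Phi>)"
    then obtain r\<^sub>0 where "r\<^sub>0 < 1" and r0: "\<And>r. r\<^sub>0 < r \<Longrightarrow> r < 1 \<Longrightarrow> y < ?L r" using lower by blast
    then show "eventually (\<lambda>r. y < ?L r) (at_left 1)" unfolding eventually_at_left_field by blast
  next
    fix y assume y: "curve_length 0 (2 * pi) (boundary_curve \<Phi>) < y"
    have "?L r < y" if "0 < r" "r < 1" for r using upper[OF that] y by (rule le_less_trans)
    then show "eventually (\<lambda>r. ?L r < y) (at_left 1)" unfolding eventually_at_left_field by (intro exI[of _ 0]) auto
  qed
  then show ?thesis using hardy SUP_eq by (simp add: rectifiable_def)
qed

end
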